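(* Let $f$ be a positive, essentially bounded and lower semicontinuous function on $\mathbb T^2$, let $\Lambda$ be the intersection with $\mathbb Z^2$ of a convex polygon of $\mathbb R^2$ with $m$ vertices, and let $(g_1,\dots,g_p)$, $p\ge2$, be a factorization of $f$ defined by the Hilbert sum $F=\bigoplus_{i=1}^p\mathcal P(\mathbb S_i^-)$, as described in the context. Let $H$, $\Phi_i$ and $\gamma$ be the associated operator on $F$, functions, and map $\mathcal P(\Lambda)\to F$ described in the context. Then: 1. For every $q\in\mathcal P(\Lambda)$ the equation $H\theta=\gamma(q)$, with unknown $\theta\in F$, has a unique solution in $\operatorname{Im}H$. 2. $T_\Lambda(f)$ is invertible and, for every $q\in\mathcal P(\Lambda)$, $$T_\Lambda(f)^{-1}(q)=\frac qf-\frac1{g_1}\sum_{i=1}^p\Phi_i\theta_i,$$ where $\theta=(\theta_1,\dots,\theta_p)$ is the unique solution in $\operatorname{Im}H$ of $H\theta=\gamma(q)$.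
   Context: Notation. $\mathbb T^2$ is the torus with normalized Lebesgue measure; "positive" means strictly positive; $\hat g$ denotes Fourier coefficients and $\operatorname{Spec}(g)=\{k\in\mathbb Z^2:\hat g(k)\ne0\}$. For $A\subset\mathbb Z^2$, $\mathcal P(A)$ is the closed subspace of $L^2(\mathbb T^2)$ spanned by the trigonometric polynomials with spectrum in $A$, and $\Pi_A$ the orthogonal projection of $L^2(\mathbb T^2)$ onto it. $T_\Lambda(f):\mathcal P(\Lambda)\to\mathcal P(\Lambda)$, $T_\Lambda(f)(q)=\Pi_\Lambda(fq)$. Polygon. Let $\widetilde\Lambda\subset\mathbb R^2$ be a convex polygon with vertices $A_1,\dots,A_m$ (indices mod $m$) with coordinates in $\mathbb N$, and $\Lambda=\widetilde\Lambda\cap\mathbb Z^2$. Let $d_i$ be the line through $A_i,A_{i+1}$, $\tilde S_i^+$ the closed half-plane bounded by $d_i$ containing $\widetilde\Lambda$, $\tilde S_i^-=\mathbb R^2\setminus\tilde S_i^+$, $S_i^\pm=\tilde S_i^\pm\cap\mathbb Z^2$, and $S_{i,0}^+$ the set of integer points of the translate of $\tilde S_i^+$ by the vector $\overrightarrow{A_iO}$, $O=(0,0)$. For a vertex $A=A_i$, $\mathcal C_{A}$ is the two-sided cone with vertex $A$ bounded by $d_{i-1}$ and $d_i$, $\mathcal C_A^+$ its half-cone containing $\Lambda$, and $\mathcal C_{A,0},\mathcal C_{A,0}^+$ their translates with vertex $O$. Factorization. Fix a vertex $A$ and a two-sided cone $C_A\subset\mathcal C_{A,0}$ with vertex $O$,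 with half-cone $C_A^+\subset\mathcal C_{A,0}^+$, and a decomposition $f=\alpha\bar\alpha$ with $\alpha\in L^\infty(\mathbb T^2)$, $\operatorname{Spec}(\alpha)\subset C_A^+$, such that for each $i\in\mathbb Z/m\mathbb Z$ there is $G_i\in\{\alpha,\bar\alpha\}$ with $f=G_i\overline{G_i}$, $G_i^{\pm1}\in L^\infty(\mathbb T^2)$ and $\operatorname{Spec}(G_i)\subset S_{i,0}^+$. Group (cyclically) the sides into $p\ge2$ blocks $I_1,\dots,I_p$ of consecutive indices such that $G_k=g_i$ for all $k\in I_i$ and $g_i\ne g_{i+1}$ (with $g_{p+1}=g_1$). Put $\mathbb S_i^-=\bigcup_{k\in I_i}S_k^-$ and $\mathbb S_i^+=\mathbb Z^2\setminus\mathbb S_i^-$, so that $\Lambda=\bigcap_i\mathbb S_i^+$. Then $(g_1,\dots,g_p)$ is called the factorization of $f$ defined by the Hilbert sum $F=\bigoplus_{i=1}^p\mathcal P(\mathbb S_i^-)$. Hankel operator. $\Phi_i=\bar g_i/\bar g_1$; $\Pi_i$ is the orthogonal projection of $L^2(\mathbb T^2)$ onto $\mathcal P(\mathbb S_i^-)$; $H(i,j):\mathcal P(\mathbb S_j^-)\to\mathcal P(\mathbb S_i^-)$, $H(i,j)\theta_j=\Pi_i\big(\frac{\Phi_j}{\Phi_i}\theta_j\big)$; $H:F\to F$, $(H\theta)_i=\sum_{j=1}^pH(i,j)\theta_j$. The map $\gamma:\mathcal P(\Lambda)\to F$ is $\gamma(q)=(\gamma_i(q))_{i=1,\dots,p}$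 with $\gamma_i(q)=\Pi_i\big(\bar\Phi_i\,\frac q{\bar g_1}\big)$.
   Formalization: The factorization also requires Spec(1/G_i) ⊂ S_{i,0}^+ for each side i, not only Spec(G_i) ⊂ S_{i,0}^+; without this the formula fails, e.g. on a rectangle with f=|1+z/2|² and α=z(1+z/2). *)

theory Defs
  imports "HOL-Analysis.Analysis"
begin

section \<open>Fourier analysis on the two-dimensional torus\<close>

text \<open>Elements of the spaces \<open>L\<^sup>2\<close> and \<open>L\<^sup>\<infinity>\<close> of the torus are represented by Borel
  functions; their equality is \<open>aeq\<close>, equality almost everywhere.\<close>

definition torus :: "(complex \<times> complex) set" where
  "torus = sphere 0 1 \<times> sphere 0 1"

definition T2 :: "(complex \<times> complex) measure" where
  "T2 = distr (restrict_space lborel ({0..1} \<times> {0..1})) (restrict_space borel torus)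
          (\<lambda>(s::real, t::real). (cis (2 * pi * s), cis (2 * pi * t)))"

type_synonym tfun = "complex \<times> complex \<Rightarrow> complex"

definition aeq :: "tfun \<Rightarrow> tfun \<Rightarrow> bool" where
  "aeq g h \<longleftrightarrow> (AE x in T2. g x = h x)"

definition Linf :: "tfun set" where
  "Linf = {g \<in> borel_measurable T2. \<exists>C. AE x in T2. cmod (g x) \<le> C}"

definition L2 :: "tfun set" where
  "L2 = {g \<in> borel_measurable T2. integrable T2 (\<lambda>x. (cmod (g x))\<^sup>2)}"

definition ip :: "tfun \<Rightarrow> tfun \<Rightarrow> complex" where
  "ip g h = (LINT x|T2. g x * cnj (h x))"

definition l2norm :: "tfun \<Rightarrow> real" where
  "l2norm g = sqrt (LINT x|T2. (cmod (g x))\<^sup>2)"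

definition chr :: "int \<times> int \<Rightarrow> tfun" where
  "chr k x = (fst x powi fst k) * (snd x powi snd k)"

definition fourier :: "tfun \<Rightarrow> int \<times> int \<Rightarrow> complex" where
  "fourier g k = (LINT x|T2. g x * cnj (chr k x))"

definition Spec :: "tfun \<Rightarrow> (int \<times> int) set" where
  "Spec g = {k. fourier g k \<noteq> 0}"

definition trig_poly :: "tfun \<Rightarrow> bool" where
  "trig_poly p \<longleftrightarrow> (\<exists>K c. finite K \<and> p = (\<lambda>x. \<Sum>k\<in>K. c k * chr k x))"

text \<open>The trigonometric polynomials with spectrum in \<open>A\<close> already form a linear subspace, so the
  closed subspace they span is their \<open>L\<^sup>2\<close>-closure.\<close>

definition PS :: "(int \<times> int) set \<Rightarrow> tfun set" where
  "PS A = {g \<in> L2. \<forall>\<epsilon>>0. \<exists>p. trig_poly p \<and> Spec p \<subseteq> A \<and> l2norm (\<lambda>x. g x - p x) < \<epsilon>}"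

text \<open>The choice is unique up to \<open>aeq\<close>.\<close>

definition proj :: "(int \<times> int) set \<Rightarrow> tfun \<Rightarrow> tfun" where
  "proj A g = (SOME h. h \<in> PS A \<and> (\<forall>\<phi>\<in>PS A. ip (\<lambda>x. g x - h x) \<phi> = 0))"

definition toeplitz :: "(int \<times> int) set \<Rightarrow> (complex \<times> complex \<Rightarrow> real) \<Rightarrow> tfun \<Rightarrow> tfun" where
  "toeplitz \<Lambda> f q = proj \<Lambda> (\<lambda>x. complex_of_real (f x) * q x)"

text \<open>Invertibility of an operator on a space of functions modulo \<open>aeq\<close>: there is a bounded
  two-sided inverse (which has to respect \<open>aeq\<close>).\<close>

definition invertible_op :: "tfun set \<Rightarrow> (tfun \<Rightarrow> tfun) \<Rightarrow> bool" where
  "invertible_op V T \<longleftrightarrow> (\<forall>h\<in>V. T h \<in> V) \<and>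
     (\<exists>S. (\<forall>q\<in>V. S q \<in> V \<and> aeq (T (S q)) q \<and> aeq (S (T q)) q) \<and>
          (\<forall>q\<in>V. \<forall>r\<in>V. aeq q r \<longrightarrow> aeq (S q) (S r)) \<and>
          (\<exists>C. \<forall>q\<in>V. l2norm (S q) \<le> C * l2norm q))"

definition inverse_op :: "tfun set \<Rightarrow> (tfun \<Rightarrow> tfun) \<Rightarrow> tfun \<Rightarrow> tfun" where
  "inverse_op V T q = (SOME h. h \<in> V \<and> aeq (T h) q)"

definition lower_semicontinuous_on :: "'a::topological_space set \<Rightarrow> ('a \<Rightarrow> real) \<Rightarrow> bool" where
  "lower_semicontinuous_on S f \<longleftrightarrow>
     (\<forall>x\<in>S. \<forall>c<f x. \<forall>\<^sub>F y in at x within S. c < f y)"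


section \<open>Lattice polygons\<close>

text \<open>The vertices are \<open>A 0, \<dots>, A (m - 1)\<close>, in cyclic order.\<close>

definition ipt :: "int \<times> int \<Rightarrow> real \<times> real" where
  "ipt k = (of_int (fst k), of_int (snd k))"

definition vertex :: "(nat \<Rightarrow> nat \<times> nat) \<Rightarrow> nat \<Rightarrow> real \<times> real" where
  "vertex A i = (real (fst (A i)), real (snd (A i)))"

definition polygon :: "nat \<Rightarrow> (nat \<Rightarrow> nat \<times> nat) \<Rightarrow> (real \<times> real) set" where
  "polygon m A = convex hull (vertex A ` {..<m})"

definition convex_polygon :: "nat \<Rightarrow> (nat \<Rightarrow> nat \<times> nat) \<Rightarrow> bool" where
  "convex_polygon m A \<longleftrightarrow> 3 \<le> m \<and> inj_on A {..<m} \<and>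
     {x. x extreme_point_of polygon m A} = vertex A ` {..<m} \<and>
     (\<forall>i<m. closed_segment (vertex A i) (vertex A (Suc i mod m)) edge_of polygon m A)"

definition lattice_polygon :: "nat \<Rightarrow> (nat \<Rightarrow> nat \<times> nat) \<Rightarrow> (int \<times> int) set" where
  "lattice_polygon m A = {k. ipt k \<in> polygon m A}"

definition side_line :: "nat \<Rightarrow> (nat \<Rightarrow> nat \<times> nat) \<Rightarrow> nat \<Rightarrow> (real \<times> real) set" where
  "side_line m A i = affine hull {vertex A i, vertex A (Suc i mod m)}"

definition half_plane :: "nat \<Rightarrow> (nat \<Rightarrow> nat \<times> nat) \<Rightarrow> nat \<Rightarrow> (real \<times> real) set" where
  "half_plane m A i = (THE S. (\<exists>a b. a \<noteq> 0 \<and> S = {x. a \<bullet> x \<le> b} \<and> side_line m A i = {x. a \<bullet> x = b})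
     \<and> polygon m A \<subseteq> S)"

definition S_minus :: "nat \<Rightarrow> (nat \<Rightarrow> nat \<times> nat) \<Rightarrow> nat \<Rightarrow> (int \<times> int) set" where
  "S_minus m A i = {k. ipt k \<notin> half_plane m A i}"

definition S_plus0 :: "nat \<Rightarrow> (nat \<Rightarrow> nat \<times> nat) \<Rightarrow> nat \<Rightarrow> (int \<times> int) set" where
  "S_plus0 m A i = {k. ipt k \<in> (\<lambda>x. x - vertex A i) ` half_plane m A i}"

text \<open>Half-cone and two-sided cone at the vertex \<open>A i\<close>, translated to the origin. The sides
  through \<open>A i\<close> are those with indices \<open>i - 1\<close> and \<open>i\<close> modulo \<open>m\<close>.\<close>

definition vertex_cone_plus0 :: "nat \<Rightarrow> (nat \<Rightarrow> nat \<times> nat) \<Rightarrow> nat \<Rightarrow> (real \<times> real) set" where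
  "vertex_cone_plus0 m A i =
     (\<lambda>x. x - vertex A i) ` (half_plane m A ((i + m - 1) mod m) \<inter> half_plane m A i)"

definition vertex_cone0 :: "nat \<Rightarrow> (nat \<Rightarrow> nat \<times> nat) \<Rightarrow> nat \<Rightarrow> (real \<times> real) set" where
  "vertex_cone0 m A i = vertex_cone_plus0 m A i \<union> uminus ` vertex_cone_plus0 m A i"

text \<open>A two-sided cone \<open>C\<close> with vertex at the origin, and one of its two half-cones \<open>Cp\<close>.\<close>

definition two_sided_cone :: "(real \<times> real) set \<Rightarrow> (real \<times> real) set \<Rightarrow> bool" where
  "two_sided_cone C Cp \<longleftrightarrow>
     (\<exists>u v. u \<noteq> v \<and> independent {u, v} \<and> Cp = {s *\<^sub>R u + t *\<^sub>R v |s t. 0 \<le> s \<and> 0 \<le> t}) \<and>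
     C = Cp \<union> uminus ` Cp"


section \<open>Factorizations\<close>

text \<open>\<open>I 0, \<dots>, I (p - 1)\<close> partition the sides \<open>0, \<dots>, m - 1\<close> into cyclically consecutive
  blocks; the first block starts at an arbitrary side \<open>s\<close>.\<close>

definition cyclic_blocks :: "nat \<Rightarrow> nat \<Rightarrow> (nat \<Rightarrow> nat set) \<Rightarrow> bool" where
  "cyclic_blocks m p I \<longleftrightarrow>
     (\<exists>s c. c 0 = 0 \<and> c p = m \<and>
        (\<forall>i<p. c i < c (Suc i) \<and> I i = (\<lambda>t. (s + t) mod m) ` {c i..<c (Suc i)}))"

text \<open>The spectral condition is imposed on \<open>G k\<close> and on \<open>1 / G k\<close>, that is, \<open>G k\<close> is invertible
  among the bounded functions with spectrum in \<open>S_plus0 m A k\<close>. With the condition on \<open>G k\<close> alone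
  the inversion formula fails: on a rectangle with sides parallel to the axes, take
  \<open>f = |1 + z/2|\<^sup>2\<close> and \<open>\<alpha> = z (1 + z/2)\<close>, where \<open>z\<close> is the first coordinate.\<close>

definition factorization ::
  "nat \<Rightarrow> (nat \<Rightarrow> nat \<times> nat) \<Rightarrow> (complex \<times> complex \<Rightarrow> real) \<Rightarrow> nat \<Rightarrow> (nat \<Rightarrow> nat set) \<Rightarrow> (nat \<Rightarrow> tfun) \<Rightarrow> bool"
  where
  "factorization m A f p I g \<longleftrightarrow> 2 \<le> p \<and> cyclic_blocks m p I \<and>
     (\<exists>v C Cp \<alpha> G.
        v < m \<and> two_sided_cone C Cp \<and> C \<subseteq> vertex_cone0 m A v \<and> Cp \<subseteq> vertex_cone_plus0 m A v \<and>
        \<alpha> \<in> Linf \<and> ipt ` Spec \<alpha> \<subseteq> Cp \<and>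
        aeq (\<lambda>x. complex_of_real (f x)) (\<lambda>x. \<alpha> x * cnj (\<alpha> x)) \<and>
        (\<forall>k<m. (aeq (G k) \<alpha> \<or> aeq (G k) (\<lambda>x. cnj (\<alpha> x))) \<and>
           aeq (\<lambda>x. complex_of_real (f x)) (\<lambda>x. G k x * cnj (G k x)) \<and>
           G k \<in> Linf \<and> (\<lambda>x. 1 / G k x) \<in> Linf \<and>
           Spec (G k) \<subseteq> S_plus0 m A k \<and> Spec (\<lambda>x. 1 / G k x) \<subseteq> S_plus0 m A k) \<and>
        (\<forall>i<p. g i \<in> Linf \<and> (\<forall>k\<in>I i. aeq (G k) (g i)) \<and> \<not> aeq (g i) (g (Suc i mod p))))"


section \<open>The Hankel operator\<close>

definition block_minus :: "nat \<Rightarrow> (nat \<Rightarrow> nat \<times> nat) \<Rightarrow> (nat \<Rightarrow> nat set) \<Rightarrow> nat \<Rightarrow> (int \<times> int) set" where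
  "block_minus m A I i = (\<Union>k\<in>I i. S_minus m A k)"

text \<open>In what follows \<open>B i\<close> stands for \<open>block_minus m A I i\<close>, and \<open>g 0\<close> is the first function of
  the factorization. Only the components \<open>\<theta> 0, \<dots>, \<theta> (p - 1)\<close> of \<open>\<theta>\<close> are relevant.\<close>

definition hilbert_sum :: "(nat \<Rightarrow> (int \<times> int) set) \<Rightarrow> nat \<Rightarrow> (nat \<Rightarrow> tfun) set" where
  "hilbert_sum B p = {\<theta>. \<forall>i<p. \<theta> i \<in> PS (B i)}"

definition aeq_sum :: "nat \<Rightarrow> (nat \<Rightarrow> tfun) \<Rightarrow> (nat \<Rightarrow> tfun) \<Rightarrow> bool" where
  "aeq_sum p \<theta> \<eta> \<longleftrightarrow> (\<forall>i<p. aeq (\<theta> i) (\<eta> i))"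

definition Phi :: "(nat \<Rightarrow> tfun) \<Rightarrow> nat \<Rightarrow> tfun" where
  "Phi g i x = cnj (g i x) / cnj (g 0 x)"

definition hankel_entry ::
  "(nat \<Rightarrow> (int \<times> int) set) \<Rightarrow> (nat \<Rightarrow> tfun) \<Rightarrow> nat \<Rightarrow> nat \<Rightarrow> tfun \<Rightarrow> tfun" where
  "hankel_entry B g i j \<theta>j = proj (B i) (\<lambda>x. Phi g j x / Phi g i x * \<theta>j x)"

definition hankel ::
  "(nat \<Rightarrow> (int \<times> int) set) \<Rightarrow> nat \<Rightarrow> (nat \<Rightarrow> tfun) \<Rightarrow> (nat \<Rightarrow> tfun) \<Rightarrow> (nat \<Rightarrow> tfun)" where
  "hankel B p g \<theta> i = (\<lambda>x. \<Sum>j<p. hankel_entry B g i j (\<theta> j) x)"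

definition hankel_range ::
  "(nat \<Rightarrow> (int \<times> int) set) \<Rightarrow> nat \<Rightarrow> (nat \<Rightarrow> tfun) \<Rightarrow> (nat \<Rightarrow> tfun) set" where
  "hankel_range B p g =
     {\<eta> \<in> hilbert_sum B p. \<exists>\<theta>\<in>hilbert_sum B p. aeq_sum p \<eta> (hankel B p g \<theta>)}"

definition gamma_map ::
  "(nat \<Rightarrow> (int \<times> int) set) \<Rightarrow> (nat \<Rightarrow> tfun) \<Rightarrow> tfun \<Rightarrow> (nat \<Rightarrow> tfun)" where
  "gamma_map B g q i = proj (B i) (\<lambda>x. cnj (Phi g i x) * (q x / cnj (g 0 x)))"

end

(* Write \<Phi> i = cnj (g i) / cnj (g 0), V \<theta> = (SUM i. \<Phi> i \<theta> i) on the Hilbert sum of the spaces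
   PS (B i), and V* for the adjoint of V. Then H = V* V and \<gamma> q = V* (q / cnj (g 0)). Since the spectra
   of g i and 1 / g i lie in the translated half-planes of the i-th block, cnj (g i) and its inverse
   preserve PS (B i), while g i and its inverse preserve the orthogonal complement. Hence g 0 PS \<Lambda> is
   exactly the orthogonal complement of the range of V, so any solution \<theta> of H \<theta> = \<gamma> q gives
   T^-1 q = (q / cnj (g 0) - V \<theta>) / g 0.

   The Toeplitz operator is invertible because f is bounded below. As \<Lambda> is the complement of the union
   of the B i, this invertibility decomposes every function, with control of the norms, into an element
   of g 0 PS \<Lambda> and one of the range of V. Therefore V V* + g 0 \<Pi> cnj (g 0), \<Pi> the projection onto PS \<Lambda>,
   is coercive, hence onto, and if it maps w to q / cnj (g 0), then V* w is a solution that lies in the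
   range of V* = range of H. *)

theory Submission
  imports Defs
begin

text \<open>The obstacle is that the range of \<open>V\<close>, a sum of several closed subspaces,
  is not known beforehand to be closed, so the equation cannot be solved by projecting onto it. The
  substitute is quantitative: every w is written as g 0 h + V \<theta> with h and \<theta> bounded
  by a multiple of w. Pairing this with w itself bounds norm w by the norms of V* w and of the
  projection of cnj (g 0) w, which is the coercivity. The operator to be inverted acts on the single
  space \<open>l2\<close> and not on the Hilbert sum, so the sum never needs a Hilbert space
  structure of its own; the summand with g 0 compensates for the kernel of V*. The same
  decomposition shows why V* and H have the same range: V* annihilates g 0 h. Uniqueness has a
  different source: the difference of two solutions in the range of H lies in the kernel of V and in
  the range of V*, and these are orthogonal. The lower bound for f is used in the form of the
  boundedness of 1 / g 0, as f = |g 0|^2.\<close>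

section \<open>Two facts on Hilbert spaces\<close>

text \<open>A minimizing sequence for the distance to \<open>S\<close> is Cauchy by the
  parallelogram identity, and its limit is a nearest point. Moving a nearest point along
  \<open>z\<close> cannot lower the distance, which forces orthogonality.\<close>

lemma subspace_projection_exists:
  fixes S :: "'a::{real_inner, complete_space} set"
  assumes S: "subspace S" "closed S"
  shows "\<exists>y\<in>S. \<forall>z\<in>S. inner (x - y) z = 0"
proof -
  define d where "d = (INF y\<in>S. (norm (x - y))\<^sup>2)"
  have bdd: "bdd_below ((\<lambda>y. (norm (x - y))\<^sup>2) ` S)"
    by (rule bdd_belowI[of _ 0]) auto
  have dle: "d \<le> (norm (x - y))\<^sup>2" if "y \<in> S" for y
    unfolding d_def by (rule cINF_lower[OF bdd that])
  have ne: "S \<noteq> {}" using S(1) subspace_0 by auto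
  have "\<exists>y\<in>S. (norm (x - y))\<^sup>2 < d + 1 / real (Suc n)" for n
    using cINF_less_iff[OF ne bdd, of "d + 1 / real (Suc n)"] by (simp add: d_def)
  then obtain y where yS: "\<And>n. y n \<in> S"
    and yd: "\<And>n. (norm (x - y n))\<^sup>2 < d + 1 / real (Suc n)" by metis
  \<comment> \<open>The midpoint of \<open>y m\<close> and \<open>y n\<close> lies in
    \<open>S\<close>, so its squared distance to \<open>x\<close> is at least \<open>d\<close>; the
    parallelogram identity converts this into a bound on \<open>y m - y n\<close>.\<close>
  have par: "(norm (y m - y n))\<^sup>2 < 2 / real (Suc m) + 2 / real (Suc n)" for m n
  proof -
    have "(1/2) *\<^sub>R (y m + y n) \<in> S" by (intro subspace_scale subspace_add S yS)
    from dle[OF this] have "4 * d \<le> 4 * (norm (x - (1/2) *\<^sub>R (y m + y n)))\<^sup>2" by simp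
    also have "\<dots> = 2 * (norm (x - y m))\<^sup>2 + 2 * (norm (x - y n))\<^sup>2 - (norm (y m - y n))\<^sup>2"
      unfolding power2_norm_eq_inner by (simp add: inner_simps inner_commute algebra_simps)
    finally show ?thesis using yd[of m] yd[of n] by simp
  qed
  have "Cauchy y"
  proof (rule metric_CauchyI)
    fix e :: real assume e: "0 < e"
    then obtain M where M: "4 / e\<^sup>2 < real M" using reals_Archimedean2 by blast
    show "\<exists>M. \<forall>m\<ge>M. \<forall>n\<ge>M. dist (y m) (y n) < e"
    proof (intro exI allI impI)
      fix m n assume mn: "m \<ge> M" "n \<ge> M"
      have h: "2 / real (Suc k) \<le> e\<^sup>2 / 2" if "k \<ge> M" for k
      proof -
        have "4 / e\<^sup>2 < real (Suc k)" using M that by simp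
        then show ?thesis using e by (simp add: field_simps)
      qed
      have "(norm (y m - y n))\<^sup>2 < e\<^sup>2" using par[of m n] h[OF mn(1)] h[OF mn(2)] by simp
      then show "dist (y m) (y n) < e"
        using e by (simp add: dist_norm power2_less_imp_less)
    qed
  qed
  then obtain l where l: "y \<longlonglongrightarrow> l" using Cauchy_convergent convergent_def by blast
  have lS: "l \<in> S" using closed_sequentially[OF S(2) _ l] yS by blast
  have "(\<lambda>n. (norm (x - y n))\<^sup>2) \<longlonglongrightarrow> (norm (x - l))\<^sup>2" by (intro tendsto_intros l)
  moreover have "(\<lambda>n. d + 1 / real (Suc n)) \<longlonglongrightarrow> d + 0"
    by (intro tendsto_intros LIMSEQ_inverse_real_of_nat[unfolded inverse_eq_divide])
  ultimately have "(norm (x - l))\<^sup>2 \<le> d + 0"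
    by (rule LIMSEQ_le) (use yd less_imp_le in blast)
  have min: "(norm (x - l))\<^sup>2 \<le> (norm (x - z))\<^sup>2" if "z \<in> S" for z
    using dle[OF that] \<open>(norm (x - l))\<^sup>2 \<le> d + 0\<close> by linarith
  have "inner (x - l) z = 0" if z: "z \<in> S" for z
  proof (cases "z = 0")
    case False
    \<comment> \<open>The value of \<open>t\<close> that minimizes the squared norm of x - l - t
      z.\<close>
    define t where "t = inner (x - l) z / inner z z"
    have zz: "inner z z > 0" using False by simp
    have "l + t *\<^sub>R z \<in> S" by (intro subspace_scale subspace_add S lS z)
    from min[OF this] have "0 \<le> t * (t * inner z z) - 2 * t * inner (x - l) z"
      unfolding power2_norm_eq_inner by (simp add: inner_simps inner_commute algebra_simps)
    also have "\<dots> = - ((inner (x - l) z)\<^sup>2 / inner z z)"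
      using zz unfolding t_def by (simp add: field_simps power2_eq_square)
    finally have "(inner (x - l) z)\<^sup>2 / inner z z \<le> 0" by simp
    then show ?thesis using zz by (simp add: divide_le_0_iff)
  qed simp
  with lS show ?thesis by blast
qed

text \<open>The Lax-Milgram argument: a solution of \<open>A x = b\<close> is a fixed point of x - t
  (A x - b), and coercivity makes this map a contraction for a suitable \<open>t\<close>.\<close>

lemma coercive_imp_surj:
  fixes A :: "'a::{real_inner, complete_space} \<Rightarrow> 'a"
  assumes A: "bounded_linear A" and c: "c > 0" and coer: "\<And>x. c * (norm x)\<^sup>2 \<le> inner (A x) x"
  shows "\<exists>x. A x = b"
proof -
  interpret bounded_linear A by (rule A)
  obtain K0 where K0: "\<And>x. norm (A x) \<le> norm x * K0" "K0 > 0" using pos_bounded by blast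
  \<comment> \<open>The maximum ensures \<open>c \<le> K\<close>, so that the square root defining
    \<open>q\<close> has a nonnegative argument.\<close>
  define K where "K = max K0 c"
  have K: "norm (A x) \<le> norm x * K" for x
    using K0(1)[of x] mult_left_mono[of K0 K "norm x"] by (simp add: K_def)
  have Kc: "c \<le> K" "K > 0" using c by (auto simp: K_def)
  \<comment> \<open>This \<open>t\<close> minimizes 1 - 2 t c + t^2 K^2; the minimum is 1 - c^2 /
    K^2, hence the choice of \<open>q\<close>.\<close>
  define t where "t = c / K\<^sup>2"
  have t: "t > 0" using c Kc by (simp add: t_def)
  define q where "q = sqrt (1 - c\<^sup>2 / K\<^sup>2)"
  have ck: "0 < c\<^sup>2 / K\<^sup>2" "c\<^sup>2 / K\<^sup>2 \<le> 1"
    using c Kc by (auto simp: power_mono)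
  then have q: "0 \<le> q" "q < 1" "q\<^sup>2 = 1 - c\<^sup>2 / K\<^sup>2" by (auto simp: q_def)
  have contr: "norm (x - t *\<^sub>R A x) \<le> q * norm x" for x
  proof (rule power2_le_imp_le)
    have "(norm (x - t *\<^sub>R A x))\<^sup>2 = (norm x)\<^sup>2 - 2 * t * inner (A x) x + t\<^sup>2 * (norm (A x))\<^sup>2"
      unfolding power2_norm_eq_inner by (simp add: inner_simps inner_commute algebra_simps power2_eq_square)
    also have "\<dots> \<le> (norm x)\<^sup>2 - 2 * t * (c * (norm x)\<^sup>2) + t\<^sup>2 * (norm x * K)\<^sup>2"
      using coer[of x] t K[of x]
      by (intro add_mono diff_mono mult_left_mono power_mono) auto
    also have "\<dots> = (1 - 2 * t * c + t\<^sup>2 * K\<^sup>2) * (norm x)\<^sup>2"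
      by (simp add: algebra_simps power_mult_distrib)
    also have "1 - 2 * t * c + t\<^sup>2 * K\<^sup>2 = q\<^sup>2"
      using Kc unfolding q(3) t_def by (simp add: field_simps power2_eq_square)
    finally show "(norm (x - t *\<^sub>R A x))\<^sup>2 \<le> (q * norm x)\<^sup>2" by (simp add: power_mult_distrib)
  qed (use q in simp)
  define g where "g x = x - t *\<^sub>R (A x - b)" for x
  have "\<exists>!x. g x = x"
  proof (rule banach_fix_type[OF q(1,2)], intro allI)
    fix x y
    have "g x - g y = (x - y) - t *\<^sub>R A (x - y)" by (simp add: g_def diff algebra_simps)
    then show "dist (g x) (g y) \<le> q * dist x y" using contr[of "x - y"] by (simp add: dist_norm)
  qed
  then obtain x where "g x = x" by blast
  then show ?thesis using t by (auto simp: g_def)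
qed

section \<open>The Hilbert space of square integrable functions on the torus\<close>

lemma compact_torus: "compact torus"
  unfolding torus_def by (intro compact_Times compact_sphere)

lemma space_T2 [simp]: "space T2 = torus"
  by (simp add: T2_def space_restrict_space)

lemma sets_T2: "sets T2 = sets (restrict_space borel torus)"
  by (simp add: T2_def)

lemma borel_measurable_T2I: "g \<in> borel_measurable borel \<Longrightarrow> g \<in> borel_measurable T2"
  using measurable_cong_sets[OF sets_T2 refl] measurable_restrict_space1 by blast

lemma continuous_on_borel_measurable_T2: "continuous_on torus g \<Longrightarrow> g \<in> borel_measurable T2"
  using measurable_cong_sets[OF sets_T2 refl] borel_measurable_continuous_on_restrict by blast

lemma param_measurable:
  "(\<lambda>(s, t). (cis (2 * pi * s), cis (2 * pi * t)))
     \<in> measurable (restrict_space lborel ({0..1} \<times> {0..1})) (restrict_space borel torus)"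
proof (rule measurable_restrict_space2)
  have "continuous_on UNIV (\<lambda>x::real \<times> real. (cis (2 * pi * fst x), cis (2 * pi * snd x)))"
    by (intro continuous_intros)
  then have "(\<lambda>x::real \<times> real. (cis (2 * pi * fst x), cis (2 * pi * snd x))) \<in> borel_measurable borel"
    by (rule borel_measurable_continuous_onI)
  then have "(\<lambda>x::real \<times> real. (cis (2 * pi * fst x), cis (2 * pi * snd x))) \<in> borel_measurable lborel"
    by simp
  then show "(\<lambda>(s::real, t::real). (cis (2 * pi * s), cis (2 * pi * t)))
      \<in> borel_measurable (restrict_space lborel ({0..1} \<times> {0..1}))"
    by (simp add: case_prod_beta' measurable_restrict_space1)
qed (auto simp: torus_def)

lemma emeasure_T2_torus: "emeasure T2 torus = 1"
proof -
  have S: "({0..1} \<times> {0..1} :: (real \<times> real) set) = cbox (0, 0) (1, 1)"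
    by (auto simp: cbox_Pair_eq)
  have "emeasure T2 torus = emeasure (restrict_space lborel ({0..1} \<times> {0..1} :: (real \<times> real) set)) ({0..1} \<times> {0..1})"
    unfolding T2_def
    by (subst emeasure_distr[OF param_measurable])
       (auto simp: sets_restrict_space space_restrict_space torus_def intro!: arg_cong[where f="emeasure _"])
  also have "\<dots> = emeasure lborel (cbox (0, 0) (1, 1) :: (real \<times> real) set)"
    by (simp add: emeasure_restrict_space S)
  also have "\<dots> = 1"
    by (subst emeasure_lborel_cbox) (auto simp: Basis_prod_def)
  finally show ?thesis .
qed

interpretation T2: finite_measure T2
  by standard (simp add: emeasure_T2_torus)

lemma measure_T2_torus: "measure T2 torus = 1"
  by (simp add: measure_def emeasure_T2_torus)

lemma measurable_cnj [measurable (raw)]: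
  "g \<in> borel_measurable M \<Longrightarrow> (\<lambda>x. cnj (g x)) \<in> borel_measurable M"
  using measurable_compose[OF _ borel_measurable_continuous_onI[OF continuous_on_cnj[OF continuous_on_id]]] .

lemma mult_cnj_cmod: "z * cnj z = complex_of_real ((cmod z)\<^sup>2)"
  by (rule complex_norm_square[symmetric])

section \<open>Square integrable and essentially bounded functions\<close>

lemma L2_measurable: "g \<in> L2 \<Longrightarrow> g \<in> borel_measurable T2"
  and L2_integrable: "g \<in> L2 \<Longrightarrow> integrable T2 (\<lambda>x. (cmod (g x))\<^sup>2)"
  by (auto simp: L2_def)

lemma Linf_measurable: "g \<in> Linf \<Longrightarrow> g \<in> borel_measurable T2"
  by (auto simp: Linf_def)

lemma L2_I: "g \<in> borel_measurable T2 \<Longrightarrow> integrable T2 (\<lambda>x. (cmod (g x))\<^sup>2) \<Longrightarrow> g \<in> L2"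
  by (auto simp: L2_def)

lemma L2_add: assumes "g \<in> L2" "h \<in> L2" shows "(\<lambda>x. g x + h x) \<in> L2"
proof (rule L2_I)
  note [measurable] = assms[THEN L2_measurable]
  show "(\<lambda>x. g x + h x) \<in> borel_measurable T2" by measurable
  have "integrable T2 (\<lambda>x. 2 * (cmod (g x))\<^sup>2 + 2 * (cmod (h x))\<^sup>2)"
    using assms[THEN L2_integrable] by simp
  then show "integrable T2 (\<lambda>x. (cmod (g x + h x))\<^sup>2)"
  proof (rule Bochner_Integration.integrable_bound)
    have "(cmod (g x + h x))\<^sup>2 \<le> 2 * (cmod (g x))\<^sup>2 + 2 * (cmod (h x))\<^sup>2" for x
    proof -
      have "(cmod (g x + h x))\<^sup>2 \<le> (cmod (g x) + cmod (h x))\<^sup>2"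
        by (intro power_mono norm_triangle_ineq) auto
      also have "\<dots> \<le> 2 * (cmod (g x))\<^sup>2 + 2 * (cmod (h x))\<^sup>2"
        using sum_squares_bound[of "cmod (g x)" "cmod (h x)"] by (simp add: power2_sum)
      finally show ?thesis .
    qed
    then show "AE x in T2. norm ((cmod (g x + h x))\<^sup>2) \<le> norm (2 * (cmod (g x))\<^sup>2 + 2 * (cmod (h x))\<^sup>2)"
      by simp
  qed measurable
qed

lemma Linf_mult_L2: assumes "a \<in> Linf" "g \<in> L2" shows "(\<lambda>x. a x * g x) \<in> L2"
proof (rule L2_I)
  note [measurable] = Linf_measurable[OF assms(1)] L2_measurable[OF assms(2)]
  show "(\<lambda>x. a x * g x) \<in> borel_measurable T2" by measurable
  obtain C where C: "AE x in T2. cmod (a x) \<le> C" using assms(1) by (auto simp: Linf_def)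
  have "integrable T2 (\<lambda>x. C\<^sup>2 * (cmod (g x))\<^sup>2)" using L2_integrable[OF assms(2)] by simp
  then show "integrable T2 (\<lambda>x. (cmod (a x * g x))\<^sup>2)"
  proof (rule Bochner_Integration.integrable_bound)
    show "AE x in T2. norm ((cmod (a x * g x))\<^sup>2) \<le> norm (C\<^sup>2 * (cmod (g x))\<^sup>2)"
      using C by eventually_elim
        (auto simp: norm_mult power_mult_distrib intro!: mult_right_mono power_mono)
  qed measurable
qed

lemma Linf_const: "(\<lambda>x. c) \<in> Linf"
  by (auto simp: Linf_def)

lemma Linf_mult: assumes "a \<in> Linf" "b \<in> Linf" shows "(\<lambda>x. a x * b x) \<in> Linf"
proof -
  note [measurable] = assms[THEN Linf_measurable]
  obtain C D where "AE x in T2. cmod (a x) \<le> C" "AE x in T2. cmod (b x) \<le> D"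
    using assms by (auto simp: Linf_def)
  then have "AE x in T2. cmod (a x * b x) \<le> C * D"
  proof eventually_elim
    case (elim x)
    then have "0 \<le> C" using norm_ge_zero order_trans by blast
    with elim show ?case by (simp add: norm_mult mult_mono)
  qed
  then show ?thesis by (auto simp: Linf_def)
qed

lemma Linf_cnj: "a \<in> Linf \<Longrightarrow> (\<lambda>x. cnj (a x)) \<in> Linf"
  by (auto simp: Linf_def)

lemma Linf_subset_L2: "a \<in> Linf \<Longrightarrow> a \<in> L2"
  using Linf_mult_L2[of a "\<lambda>x. 1"] by (auto simp: L2_def)

lemma L2_cmult: "g \<in> L2 \<Longrightarrow> (\<lambda>x. c * g x) \<in> L2"
  using Linf_mult_L2[OF Linf_const] .

lemma L2_zero: "(\<lambda>x. 0) \<in> L2"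
  by (auto simp: L2_def)

lemma L2_uminus: "g \<in> L2 \<Longrightarrow> (\<lambda>x. - g x) \<in> L2"
  using L2_cmult[of g "-1"] by simp

lemma L2_diff: "g \<in> L2 \<Longrightarrow> h \<in> L2 \<Longrightarrow> (\<lambda>x. g x - h x) \<in> L2"
  using L2_add[OF _ L2_uminus, of g h] by simp

lemma L2_sum: "(\<And>i. i \<in> K \<Longrightarrow> g i \<in> L2) \<Longrightarrow> (\<lambda>x. \<Sum>i\<in>K. g i x) \<in> L2"
  by (induction K rule: infinite_finite_induct) (auto simp: L2_zero L2_add)

lemma L2_mult_integrable:
  assumes "g \<in> L2" "h \<in> L2" shows "integrable T2 (\<lambda>x. g x * cnj (h x))"
proof (rule Bochner_Integration.integrable_bound)
  note [measurable] = assms[THEN L2_measurable]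
  show "integrable T2 (\<lambda>x. (cmod (g x))\<^sup>2 + (cmod (h x))\<^sup>2)"
    using assms[THEN L2_integrable] by simp
  show "(\<lambda>x. g x * cnj (h x)) \<in> borel_measurable T2" by measurable
  have "cmod (g x) * cmod (h x) \<le> (cmod (g x))\<^sup>2 + (cmod (h x))\<^sup>2" for x
  proof -
    have "2 * (cmod (g x) * cmod (h x)) \<le> (cmod (g x))\<^sup>2 + (cmod (h x))\<^sup>2"
      using sum_squares_bound[of "cmod (g x)" "cmod (h x)"] by (simp add: mult.assoc)
    moreover have "0 \<le> cmod (g x) * cmod (h x)" by simp
    ultimately show ?thesis by linarith
  qed
  then show "AE x in T2. norm (g x * cnj (h x)) \<le> norm ((cmod (g x))\<^sup>2 + (cmod (h x))\<^sup>2)"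
    by (simp add: norm_mult)
qed

lemma L2_integrable_T2: assumes "g \<in> L2" shows "integrable T2 g"
  using L2_mult_integrable[OF assms, of "\<lambda>x. 1"] Linf_subset_L2[OF Linf_const, of 1] by simp

section \<open>Classes modulo almost everywhere equality as an inner product space\<close>

lemma aeq_refl [simp]: "aeq g g"
  and aeq_sym: "aeq g h \<Longrightarrow> aeq h g"
  and aeq_trans: "aeq g h \<Longrightarrow> aeq h k \<Longrightarrow> aeq g k"
  by (auto simp: aeq_def)

\<comment> \<open>The relation is partial because \<open>tfun\<close> also contains functions
  outside \<open>L2\<close>. Hence \<open>abs_l2\<close> is meaningful on \<open>L2\<close> only,
  and the rules for \<open>cls\<close> carry membership assumptions.\<close>
quotient_type l2 = tfun / partial: "\<lambda>g h. g \<in> L2 \<and> h \<in> L2 \<and> aeq g h"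
proof (rule part_equivpI)
  show "\<exists>x. x \<in> L2 \<and> x \<in> L2 \<and> aeq x x" using L2_zero by auto
qed (auto simp: symp_def transp_def intro: aeq_sym aeq_trans)

text \<open>A real Hilbert space suffices: a complex subspace has the same orthogonal complement for \<open>ip\<close>
  and for its real part.\<close>

instantiation l2 :: real_inner
begin

lift_definition zero_l2 :: l2 is "\<lambda>x. 0" by (simp add: L2_zero)
lift_definition plus_l2 :: "l2 \<Rightarrow> l2 \<Rightarrow> l2" is "\<lambda>g h x. g x + h x"
  by (auto simp: L2_add aeq_def)
lift_definition minus_l2 :: "l2 \<Rightarrow> l2 \<Rightarrow> l2" is "\<lambda>g h x. g x - h x"
  by (auto simp: L2_diff aeq_def)
lift_definition uminus_l2 :: "l2 \<Rightarrow> l2" is "\<lambda>g x. - g x"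
  by (auto simp: L2_uminus aeq_def)
lift_definition scaleR_l2 :: "real \<Rightarrow> l2 \<Rightarrow> l2" is "\<lambda>r g x. of_real r * g x"
  by (auto simp: L2_cmult aeq_def)
lift_definition inner_l2 :: "l2 \<Rightarrow> l2 \<Rightarrow> real" is "\<lambda>g h. Re (ip g h)"
  unfolding ip_def aeq_def
  by (intro arg_cong[where f=Re] integral_cong_AE) (auto dest!: L2_measurable)

definition norm_l2 :: "l2 \<Rightarrow> real" where "norm_l2 x = sqrt (inner x x)"
definition dist_l2 :: "l2 \<Rightarrow> l2 \<Rightarrow> real" where "dist_l2 x y = norm (x - y)"
definition sgn_l2 :: "l2 \<Rightarrow> l2" where "sgn_l2 x = scaleR (inverse (norm x)) x"
definition uniformity_l2 :: "(l2 \<times> l2) filter"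
  where "uniformity_l2 = (INF e\<in>{0<..}. principal {(x, y). dist x y < e})"
definition open_l2 :: "l2 set \<Rightarrow> bool"
  where "open_l2 U \<longleftrightarrow> (\<forall>x\<in>U. \<forall>\<^sub>F (x', y) in uniformity. x' = x \<longrightarrow> y \<in> U)"

instance
proof
  fix x y z :: l2 and a b r :: real
  show "x + y + z = x + (y + z)" by transfer (simp add: L2_add add.assoc)
  show "x + y = y + x" by transfer (simp add: L2_add add.commute)
  show "0 + x = x" by transfer simp
  show "- x + x = 0" by transfer (simp add: L2_zero)
  show "x - y = x + - y" by transfer (simp add: L2_diff)
  show "a *\<^sub>R (x + y) = a *\<^sub>R x + a *\<^sub>R y" by transfer (simp add: L2_add L2_cmult distrib_left)
  show "(a + b) *\<^sub>R x = a *\<^sub>R x + b *\<^sub>R x" by transfer (auto simp: L2_add L2_cmult distrib_right intro: L2_cmult[of _ "of_real a + of_real b", unfolded distrib_right])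
  show "a *\<^sub>R b *\<^sub>R x = (a * b) *\<^sub>R x"
    by transfer (auto simp: mult.assoc intro!: L2_cmult)
  show "1 *\<^sub>R x = x" by transfer simp
  show "inner x y = inner y x"
  proof transfer
    fix x y assume "x \<in> L2 \<and> x \<in> L2 \<and> aeq x x" "y \<in> L2 \<and> y \<in> L2 \<and> aeq y y"
    have "ip y x = cnj (ip x y)" unfolding ip_def by (simp add: mult.commute flip: Bochner_Integration.integral_cnj)
    then show "Re (ip x y) = Re (ip y x)" by simp
  qed
  show "inner (x + y) z = inner x z + inner y z"
    by transfer (simp add: ip_def distrib_right L2_mult_integrable)
  show "inner (r *\<^sub>R x) y = r * inner x y"
    by transfer (simp add: ip_def mult.assoc)
  show "inner x x \<ge> 0"
    by transfer (simp add: ip_def mult_cnj_cmod del: of_real_power)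
  show "inner x x = 0 \<longleftrightarrow> x = 0"
  proof transfer
    fix g assume g: "g \<in> L2 \<and> g \<in> L2 \<and> aeq g g"
    have "Re (ip g g) = (LINT x|T2. (cmod (g x))\<^sup>2)"
      by (simp add: ip_def mult_cnj_cmod del: of_real_power)
    moreover have "(LINT x|T2. (cmod (g x))\<^sup>2) = 0 \<longleftrightarrow> (AE x in T2. (cmod (g x))\<^sup>2 = 0)"
      using g by (intro integral_nonneg_eq_0_iff_AE) (auto simp: L2_def)
    ultimately show "Re (ip g g) = 0 \<longleftrightarrow> g \<in> L2 \<and> (\<lambda>x. 0) \<in> L2 \<and> aeq g (\<lambda>x. 0)"
      using g by (simp add: aeq_def L2_zero)
  qed
qed (simp_all add: norm_l2_def dist_l2_def sgn_l2_def uniformity_l2_def open_l2_def)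

end

abbreviation cls :: "tfun \<Rightarrow> l2" where "cls \<equiv> abs_l2"

lemma rep_L2: "rep_l2 x \<in> L2"
  using Quotient3_rep_reflp[OF Quotient3_l2] by auto

lemma cls_rep [simp]: "cls (rep_l2 x) = x"
  using Quotient3_abs_rep[OF Quotient3_l2] .

lemma cls_eq_iff: "g \<in> L2 \<Longrightarrow> h \<in> L2 \<Longrightarrow> cls g = cls h \<longleftrightarrow> aeq g h"
  using Quotient3_rel[OF Quotient3_l2, of g h] by auto

lemma rep_cls: "g \<in> L2 \<Longrightarrow> aeq (rep_l2 (cls g)) g"
  using cls_eq_iff rep_L2 cls_rep by metis

lemma cls_add: "g \<in> L2 \<Longrightarrow> h \<in> L2 \<Longrightarrow> cls (\<lambda>x. g x + h x) = cls g + cls h"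
  by (simp add: plus_l2.abs_eq)

lemma cls_diff: "g \<in> L2 \<Longrightarrow> h \<in> L2 \<Longrightarrow> cls (\<lambda>x. g x - h x) = cls g - cls h"
  by (simp add: minus_l2.abs_eq)

lemma cls_zero: "cls (\<lambda>x. 0) = 0"
  by (simp add: zero_l2_def)

lemma cls_sum: "(\<And>i. i \<in> K \<Longrightarrow> g i \<in> L2) \<Longrightarrow> cls (\<lambda>x. \<Sum>i\<in>K. g i x) = (\<Sum>i\<in>K. cls (g i))"
  by (induction K rule: infinite_finite_induct) (auto simp: cls_zero cls_add L2_sum)

lemma inner_cls: "g \<in> L2 \<Longrightarrow> h \<in> L2 \<Longrightarrow> inner (cls g) (cls h) = Re (ip g h)"
  by (simp add: inner_l2.abs_eq)

lemma norm_cls: "g \<in> L2 \<Longrightarrow> norm (cls g) = l2norm g"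
  by (simp add: norm_l2_def inner_cls l2norm_def ip_def mult_cnj_cmod del: of_real_power)

section \<open>Completeness of the space of classes\<close>

lemma nn_integral_norm_cls:
  "g \<in> L2 \<Longrightarrow> (\<integral>\<^sup>+x. ennreal ((cmod (g x))\<^sup>2) \<partial>T2) = ennreal ((norm (cls g))\<^sup>2)"
  by (subst nn_integral_eq_integral) (auto simp: L2_integrable norm_cls l2norm_def)

text \<open>Cauchy-Schwarz against the constant 1, whose norm is 1 because the torus has total mass
  1.\<close>

lemma integral_cmod_le_norm:
  assumes "g \<in> L2" shows "(LINT x|T2. cmod (g x)) \<le> norm (cls g)"
proof -
  have i: "integrable T2 (\<lambda>x. cmod (g x))" using L2_integrable_T2[OF assms] by simp
  have 1: "(\<lambda>x. complex_of_real (cmod (g x))) \<in> L2"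
    using assms by (auto simp: L2_def)
  have 2: "(\<lambda>x. 1) \<in> L2" using Linf_const Linf_subset_L2 by blast
  have n1: "norm (cls (\<lambda>x. complex_of_real (cmod (g x)))) = norm (cls g)"
    using 1 assms by (simp add: norm_cls l2norm_def)
  have n2: "norm (cls (\<lambda>x. 1)) = 1" using 2 by (simp add: norm_cls l2norm_def measure_T2_torus)
  have "(LINT x|T2. cmod (g x)) = inner (cls (\<lambda>x. complex_of_real (cmod (g x)))) (cls (\<lambda>x. 1))"
    using 1 2 by (simp add: inner_cls ip_def)
  also have "\<dots> \<le> norm (cls g)"
    using norm_cauchy_schwarz[of "cls (\<lambda>x. complex_of_real (cmod (g x)))" "cls (\<lambda>x. 1)"] n1 n2 by simp
  finally show ?thesis .
qed

text \<open>The Riesz-Fischer argument: along a fast Cauchy subsequence the integrals of the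
  absolute increments are summable, so the subsequence converges almost everywhere; Fatou's lemma
  turns the pointwise limit into a limit in norm.\<close>

instance l2 :: complete_space
proof
  fix X :: "nat \<Rightarrow> l2" assume X: "Cauchy X"
  have "\<exists>M. \<forall>m\<ge>M. \<forall>n\<ge>M. norm (X m - X n) < (1/2) ^ k" for k
    using metric_CauchyD[OF X, of "(1/2)^k"] by (simp add: dist_norm)
  then obtain M where M: "\<And>k m n. m \<ge> M k \<Longrightarrow> n \<ge> M k \<Longrightarrow> norm (X m - X n) < (1/2) ^ k" by metis
  \<comment> \<open>Summing \<open>Suc (M i)\<close> makes \<open>r\<close> strictly increasing and
    at the same time at least \<open>M k\<close> from index \<open>k\<close> on.\<close>
  define r where "r k = (\<Sum>i\<le>k. Suc (M i))" for k
  have r: "strict_mono r" by (rule strict_monoI_Suc) (simp add: r_def)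
  have rM: "r j \<ge> M k" if "j \<ge> k" for j k
    using member_le_sum[of k "{..j}" "\<lambda>i. Suc (M i)"] that by (simp add: r_def)
  define u where "u k = rep_l2 (X (r k))" for k
  have uL: "u k \<in> L2" and uc: "cls (u k) = X (r k)" for k by (auto simp: u_def rep_L2)
  note [measurable] = uL[THEN L2_measurable]
  have close: "norm (X (r k) - X (r j)) < (1/2) ^ k" if "j \<ge> k" for j k
    using M[OF rM rM] that by blast
  have int1: "(\<integral>\<^sup>+x. ennreal (cmod (u (Suc k) x - u k x)) \<partial>T2) \<le> ennreal ((1/2) ^ k)" for k
  proof -
    have d: "(\<lambda>x. u (Suc k) x - u k x) \<in> L2" by (intro L2_diff uL)
    have "(\<integral>\<^sup>+x. ennreal (cmod (u (Suc k) x - u k x)) \<partial>T2) = ennreal (LINT x|T2. cmod (u (Suc k) x - u k x))"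
      using L2_integrable_T2[OF d] by (intro nn_integral_eq_integral) auto
    also have "\<dots> \<le> ennreal ((1/2) ^ k)"
      using integral_cmod_le_norm[OF d] close[of k "Suc k"]
      by (intro ennreal_leI) (simp add: cls_diff uL uc norm_minus_commute)
    finally show ?thesis .
  qed
  have "(\<integral>\<^sup>+x. (\<Sum>k. ennreal (cmod (u (Suc k) x - u k x))) \<partial>T2)
      = (\<Sum>k. \<integral>\<^sup>+x. ennreal (cmod (u (Suc k) x - u k x)) \<partial>T2)"
    by (intro nn_integral_suminf) measurable
  also have "\<dots> \<le> (\<Sum>k. ennreal ((1/2) ^ k))" by (intro suminf_le int1) auto
  also have "\<dots> = ennreal (\<Sum>k. (1/2) ^ k)" by (intro suminf_ennreal2) (auto intro: summable_geometric)
  also have "\<dots> < \<infinity>" by simp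
  finally have "AE x in T2. (\<Sum>k. ennreal (cmod (u (Suc k) x - u k x))) \<noteq> \<infinity>"
    by (intro nn_integral_noteq_infinite) (auto simp: less_top)
  then have conv: "AE x in T2. convergent (\<lambda>k. u k x)"
  proof eventually_elim
    case (elim x)
    then have "summable (\<lambda>k. cmod (u (Suc k) x - u k x))"
      by (intro summable_suminf_not_top) (auto simp: top_ennreal_def)
    then have "summable (\<lambda>k. u (Suc k) x - u k x)" by (rule summable_norm_cancel)
    then have "convergent (\<lambda>n. \<Sum>k<n. u (Suc k) x - u k x)" by (simp add: summable_iff_convergent)
    then have "convergent (\<lambda>n. u n x - u 0 x)" unfolding sum_lessThan_telescope[of "\<lambda>k. u k x"] .
    then have "convergent (\<lambda>n. (u n x - u 0 x) + u 0 x)" by (rule convergent_add[OF _ convergent_const])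
    then show ?case by simp
  qed
  define U where "U x = lim (\<lambda>k. u k x)" for x
  have [measurable]: "U \<in> borel_measurable T2" unfolding U_def by measurable
  have lim: "AE x in T2. (\<lambda>k. u k x) \<longlonglongrightarrow> U x"
    using conv by eventually_elim (simp add: U_def convergent_LIMSEQ_iff)
  \<comment> \<open>Fatou's lemma, as j tends to infinity, applied to the bound on
    \<open>X (r k) - X (r j)\<close> that holds for all j from k on.\<close>
  have fatou: "(\<integral>\<^sup>+x. ennreal ((cmod (U x - u k x))\<^sup>2) \<partial>T2) \<le> ennreal (((1/2) ^ k)\<^sup>2)" for k
  proof -
    have "(\<integral>\<^sup>+x. ennreal ((cmod (U x - u k x))\<^sup>2) \<partial>T2)
        = (\<integral>\<^sup>+x. liminf (\<lambda>j. ennreal ((cmod (u j x - u k x))\<^sup>2)) \<partial>T2)"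
    proof (rule nn_integral_cong_AE, use lim in eventually_elim)
      case (elim x)
      then have "(\<lambda>j. ennreal ((cmod (u j x - u k x))\<^sup>2)) \<longlonglongrightarrow> ennreal ((cmod (U x - u k x))\<^sup>2)"
        by (intro tendsto_intros)
      then show ?case using lim_imp_Liminf[OF sequentially_bot] by metis
    qed
    also have "\<dots> \<le> liminf (\<lambda>j. \<integral>\<^sup>+x. ennreal ((cmod (u j x - u k x))\<^sup>2) \<partial>T2)"
      by (intro nn_integral_liminf) measurable
    also have "\<dots> \<le> ennreal (((1/2) ^ k)\<^sup>2)"
    proof (rule Liminf_le[OF sequentially_bot], rule eventually_sequentiallyI[of k])
      fix j assume "k \<le> j"
      then show "(\<integral>\<^sup>+x. ennreal ((cmod (u j x - u k x))\<^sup>2) \<partial>T2) \<le> ennreal (((1/2) ^ k)\<^sup>2)"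
        using close[of k j]
        by (subst nn_integral_norm_cls)
           (auto simp: L2_diff uL cls_diff uc norm_minus_commute intro!: ennreal_leI power_mono less_imp_le)
    qed
    finally show ?thesis .
  qed
  have dL: "(\<lambda>x. U x - u k x) \<in> L2" for k
  proof (rule L2_I)
    show "integrable T2 (\<lambda>x. (cmod (U x - u k x))\<^sup>2)"
      by (rule integrableI_bounded) (use fatou[of k] in \<open>auto intro: le_less_trans\<close>)
  qed measurable
  have UL: "U \<in> L2" using L2_add[OF dL[of 0] uL[of 0]] by simp
  have "norm (cls U - X (r k)) \<le> (1/2) ^ k" for k
  proof (rule power2_le_imp_le)
    show "(norm (cls U - X (r k)))\<^sup>2 \<le> ((1/2) ^ k)\<^sup>2"
      using fatou[of k] nn_integral_norm_cls[OF dL[of k]] by (simp add: cls_diff UL uL uc)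
  qed simp
  then have "(\<lambda>k. dist (X (r k)) (cls U)) \<longlonglongrightarrow> 0"
    by (intro tendsto_sandwich[OF _ _ tendsto_const LIMSEQ_realpow_zero[of "1/2"]])
       (auto simp: dist_norm norm_minus_commute intro!: always_eventually)
  then have "(X \<circ> r) \<longlonglongrightarrow> cls U" unfolding o_def by (rule tendsto_dist_iff[THEN iffD2])
  then show "convergent X" using Cauchy_converges_subseq[OF X r] unfolding convergent_def by blast
qed

section \<open>Fourier coefficients\<close>

lemma norm_chr: "x \<in> torus \<Longrightarrow> cmod (chr k x) = 1"
  by (auto simp: torus_def chr_def norm_mult norm_power_int)

lemma nonzero_if_norm_1: "cmod z = 1 \<Longrightarrow> z \<noteq> 0"
  by auto

lemma chr_0 [simp]: "chr 0 x = 1"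
  by (simp add: chr_def)

lemma chr_add: "x \<in> torus \<Longrightarrow> chr (k + l) x = chr k x * chr l x"
  by (auto simp: torus_def chr_def power_int_add nonzero_if_norm_1 mult_ac)

lemma cnj_chr: assumes "x \<in> torus" shows "cnj (chr k x) = chr (- k) x"
proof -
  have 1: "chr k x * cnj (chr k x) = 1" unfolding mult_cnj_cmod norm_chr[OF assms] by simp
  have 2: "chr (- k) x * chr k x = 1" using chr_add[OF assms, of "- k" k] by simp
  have "cnj (chr k x) = (chr (- k) x * chr k x) * cnj (chr k x)" unfolding 2 by simp
  also have "\<dots> = chr (- k) x * (chr k x * cnj (chr k x))" by (rule mult.assoc)
  finally show ?thesis unfolding 1 by simp
qed

lemma continuous_on_chr: "continuous_on torus (chr k)"
  unfolding chr_def torus_def by (intro continuous_intros) (auto simp: mem_Times_iff)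

lemma chr_Linf: "chr k \<in> Linf"
  using continuous_on_borel_measurable_T2[OF continuous_on_chr] by (auto simp: Linf_def norm_chr intro!: AE_I2 exI[of _ 1])

lemma chr_L2: "chr k \<in> L2"
  by (rule Linf_subset_L2[OF chr_Linf])

text \<open>The antiderivative \<open>F\<close> takes the same value at 0 and 1 because
  \<open>n\<close> is an integer.\<close>

lemma integral_cis_Icc:
  assumes "n \<noteq> 0" shows "(LINT s|lborel. indicator {0..1} s *\<^sub>R cis (2 * pi * of_int n * s)) = 0"
proof -
  define F where "F s = cis (2 * pi * of_int n * s) / (\<i> * of_real (2 * pi * of_int n))" for s :: real
  have n: "\<i> * of_real (2 * pi * of_int n) \<noteq> 0" using assms by simp
  have "((\<lambda>s. exp (\<i> * (of_real (2 * pi * of_int n) * of_real s))) has_vector_derivative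
      \<i> * of_real (2 * pi * of_int n) * exp (\<i> * (of_real (2 * pi * of_int n) * of_real s))) (at s within S)" for s :: real and S
    by (auto intro!: derivative_eq_intros has_vector_derivative_real_field)
  then have "(F has_vector_derivative cis (2 * pi * of_int n * s)) (at s within S)" for s S
    unfolding F_def cis_conv_exp
    using n by (auto intro!: derivative_eq_intros simp: mult.assoc)
  moreover have "continuous_on {0..1} (\<lambda>s::real. cis (2 * pi * of_int n * s))" by (intro continuous_intros)
  ultimately have "(LINT s|lborel. indicator {0..1} s *\<^sub>R cis (2 * pi * of_int n * s)) = F 1 - F 0"
    by (intro integral_FTC_Icc) auto
  also have "F 1 = F 0" using cis_multiple_2pi[of "of_int n"] by (simp add: F_def mult.commute)
  finally show ?thesis by simp
qed

text \<open>By Fubini the integral is iterated, and one of the two frequencies is nonzero. The case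
  distinction picks the order of integration for which the inner integral is the vanishing
  one.\<close>

lemma integral_chr: assumes "k \<noteq> 0" shows "(LINT x|T2. chr k x) = 0"
proof -
  define e where "e n s = (indicator {0..1} s *\<^sub>R cis (2 * pi * of_int n * s) :: complex)" for n :: int and s :: real
  have S: "({0..1} \<times> {0..1} :: (real \<times> real) set) = cbox (0, 0) (1, 1)"
    by (auto simp: cbox_Pair_eq)
  let ?E = "\<lambda>(s, t). (cis (2 * pi * of_int (fst k) * s) * cis (2 * pi * of_int (snd k) * t))"
  have "(LINT x|T2. chr k x) = (LINT p|restrict_space lborel ({0..1} \<times> {0..1}). ?E p)"
    unfolding T2_def
    by (subst integral_distr[OF param_measurable])
       (use borel_measurable_continuous_on_restrict[OF continuous_on_chr] in \<open>auto simp: chr_def cis_power_int case_prod_beta' mult_ac\<close>)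
  also have "\<dots> = (LINT p|lborel. indicator ({0..1} \<times> {0..1}) p *\<^sub>R ?E p)"
    by (subst integral_restrict_space) (auto simp: S)
  also have "\<dots> = integral\<^sup>L (lborel \<Otimes>\<^sub>M lborel) (\<lambda>(s, t). e (fst k) s * e (snd k) t)"
    unfolding lborel_prod
    by (intro Bochner_Integration.integral_cong) (auto simp: e_def indicator_def)
  also have "\<dots> = 0"
  proof -
    have "integrable lborel (\<lambda>p::real\<times>real. indicator (cbox (0, 0) (1, 1)) p *\<^sub>R
        (cis (2 * pi * of_int (fst k) * fst p) * cis (2 * pi * of_int (snd k) * snd p)))"
      by (intro borel_integrable_compact compact_cbox continuous_intros)
    then have i: "integrable (lborel \<Otimes>\<^sub>M lborel) (\<lambda>(s, t). e (fst k) s * e (snd k) t)"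
      unfolding lborel_prod S[symmetric]
      by (rule Bochner_Integration.integrable_cong[OF refl, THEN iffD1, rotated])
         (auto simp: e_def indicator_def)
    show ?thesis
    proof (cases "fst k = 0")
      case False
      then have "(LINT s|lborel. e (fst k) s) = 0" unfolding e_def by (rule integral_cis_Icc)
      then show ?thesis by (subst lborel_pair.integral_snd[OF i, symmetric]) simp
    next
      case True
      then have "(LINT s|lborel. e (snd k) s) = 0"
        unfolding e_def using assms by (intro integral_cis_Icc) (auto simp: prod_eq_iff)
      then show ?thesis by (subst lborel_pair.integral_fst[OF i, symmetric]) simp
    qed
  qed
  finally show ?thesis .
qed

lemma fourier_eq_ip: "fourier g k = ip g (chr k)"
  by (simp add: fourier_def ip_def)

lemma fourier_cong: assumes "g \<in> borel_measurable T2" "h \<in> borel_measurable T2" "aeq g h" shows "fourier g = fourier h"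
proof
  note [measurable] = assms(1,2) Linf_measurable[OF chr_Linf]
  show "fourier g k = fourier h k" for k
    unfolding fourier_def using assms(3) by (intro integral_cong_AE) (auto simp: aeq_def)
qed

lemma fourier_integrable: "g \<in> L2 \<Longrightarrow> integrable T2 (\<lambda>x. g x * cnj (chr k x))"
  by (intro L2_mult_integrable chr_L2)

lemma fourier_add: "g \<in> L2 \<Longrightarrow> h \<in> L2 \<Longrightarrow> fourier (\<lambda>x. g x + h x) k = fourier g k + fourier h k"
  by (simp add: fourier_def distrib_right fourier_integrable)

lemma fourier_cmult: "fourier (\<lambda>x. c * g x) k = c * fourier g k"
  by (simp add: fourier_def mult.assoc)

lemma fourier_mult_chr: "fourier (\<lambda>x. chr l x * g x) k = fourier g (k - l)"
  unfolding fourier_def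
  by (intro Bochner_Integration.integral_cong refl)
     (simp add: cnj_chr mult_ac flip: chr_add)

lemma fourier_chr: "fourier (chr l) k = (if k = l then 1 else 0)"
proof -
  have "fourier (chr l) k = (LINT x|T2. chr (l - k) x)"
    unfolding fourier_def
    by (intro Bochner_Integration.integral_cong refl) (simp add: cnj_chr flip: chr_add)
  then show ?thesis by (auto simp: integral_chr measure_T2_torus)
qed

subsection \<open>Uniqueness\<close>

text \<open>The property is stable under multiplication by characters. This lets the proof of
  uniqueness test such a function against polynomials, continuous functions, indicators of closed
  sets and of Borel sets in turn.\<close>

definition fourier_null :: "tfun \<Rightarrow> bool" where
  "fourier_null u \<longleftrightarrow> u \<in> L2 \<and> (\<forall>k. fourier u k = 0)"

lemma fourier_null_add: "fourier_null u \<Longrightarrow> fourier_null v \<Longrightarrow> fourier_null (\<lambda>x. u x + v x)"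
  by (simp add: fourier_null_def L2_add fourier_add)

lemma fourier_null_cmult: "fourier_null u \<Longrightarrow> fourier_null (\<lambda>x. c * u x)"
  by (simp add: fourier_null_def L2_cmult fourier_cmult)

lemma fourier_null_chr: "fourier_null u \<Longrightarrow> fourier_null (\<lambda>x. chr l x * u x)"
  by (simp add: fourier_null_def Linf_mult_L2 chr_Linf fourier_mult_chr del: split_paired_All)

text \<open>Equality is asked for on the torus only, since the formulas that express real and
  imaginary parts by powers hold only on the unit circle.\<close>

lemma fourier_null_cong:
  assumes u: "fourier_null u" and eq: "\<And>x. x \<in> torus \<Longrightarrow> u x = v x" shows "fourier_null v"
proof -
  have "u \<in> borel_measurable T2 \<longleftrightarrow> v \<in> borel_measurable T2"
    by (rule measurable_cong) (simp add: eq)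
  moreover have "integrable T2 (\<lambda>x. (cmod (u x))\<^sup>2) \<longleftrightarrow> integrable T2 (\<lambda>x. (cmod (v x))\<^sup>2)"
    by (rule Bochner_Integration.integrable_cong) (simp_all add: eq)
  moreover have "fourier u k = fourier v k" for k
    unfolding fourier_def by (rule Bochner_Integration.integral_cong) (simp_all add: eq)
  ultimately show ?thesis using u by (simp add: fourier_null_def L2_def)
qed

lemma Re_Im_unit_circle:
  assumes "cmod z = 1"
  shows "complex_of_real (Re z) = (1/2) * z + (1/2) * (z powi -1)"
    "complex_of_real (Im z) = (-\<i>/2) * z + (\<i>/2) * (z powi -1)"
proof -
  have "z powi -1 = cnj z"
    using assms complex_div_cnj[of 1 z] by (simp add: power_int_minus inverse_eq_divide)
  then show "complex_of_real (Re z) = (1/2) * z + (1/2) * (z powi -1)"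
    "complex_of_real (Im z) = (-\<i>/2) * z + (\<i>/2) * (z powi -1)"
    by (auto simp: complex_eq_iff)
qed

text \<open>On the torus the real coordinates are trigonometric polynomials.\<close>

lemma fourier_null_real_polynomial:
  fixes P :: "complex \<times> complex \<Rightarrow> real"
  assumes "real_polynomial_function P" "fourier_null u"
  shows "fourier_null (\<lambda>x. complex_of_real (P x) * u x)"
  using assms
proof (induction arbitrary: u rule: real_polynomial_function.induct)
  case (linear P)
  interpret bounded_linear P by (rule linear(1))
  define a b c d where "a = P (1, 0)" and "b = P (\<i>, 0)" and "c = P (0, 1)" and "d = P (0, \<i>)"
  have P: "P x = Re (fst x) * a + Im (fst x) * b + Re (snd x) * c + Im (snd x) * d" for x
  proof -
    have x: "x = Re (fst x) *\<^sub>R (1, 0) + Im (fst x) *\<^sub>R (\<i>, 0) + Re (snd x) *\<^sub>R (0, 1) + Im (snd x) *\<^sub>R (0, \<i>)"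
      by (auto simp: prod_eq_iff complex_eq_iff)
    have "P x = P (Re (fst x) *\<^sub>R (1, 0) + Im (fst x) *\<^sub>R (\<i>, 0) + Re (snd x) *\<^sub>R (0, 1) + Im (snd x) *\<^sub>R (0, \<i>))"
      using x by simp
    also have "\<dots> = Re (fst x) * a + Im (fst x) * b + Re (snd x) * c + Im (snd x) * d"
      unfolding add scaleR a_def b_def c_def d_def by simp
    finally show ?thesis .
  qed
  \<comment> \<open>The coefficients come from Re z = (z + 1/z) / 2 and Im z = (z - 1/z) / (2 \<i>)
    on the unit circle, inserted into the coordinate form of \<open>P\<close>.\<close>
  define \<alpha> \<beta> where "\<alpha> = (complex_of_real a - \<i> * of_real b) / 2" and "\<beta> = (complex_of_real a + \<i> * of_real b) / 2"
  define \<gamma> \<delta> where "\<gamma> = (complex_of_real c - \<i> * of_real d) / 2" and "\<delta> = (complex_of_real c + \<i> * of_real d) / 2"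
  have null: "fourier_null (\<lambda>x. \<alpha> * (chr (1, 0) x * u x) + (\<beta> * (chr (-1, 0) x * u x)
      + (\<gamma> * (chr (0, 1) x * u x) + \<delta> * (chr (0, -1) x * u x))))"
    by (intro fourier_null_add fourier_null_cmult fourier_null_chr linear.prems)
  show ?case
  proof (rule fourier_null_cong[OF null])
    fix x assume "x \<in> torus"
    then have n: "cmod (fst x) = 1" "cmod (snd x) = 1" by (auto simp: torus_def)
    show "\<alpha> * (chr (1, 0) x * u x) + (\<beta> * (chr (-1, 0) x * u x)
      + (\<gamma> * (chr (0, 1) x * u x) + \<delta> * (chr (0, -1) x * u x))) = complex_of_real (P x) * u x"
      unfolding P of_real_add of_real_mult Re_Im_unit_circle[OF n(1)] Re_Im_unit_circle[OF n(2)]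
        chr_def \<alpha>_def \<beta>_def \<gamma>_def \<delta>_def by (simp add: algebra_simps add_divide_distrib diff_divide_distrib)
  qed
next
  case (const c)
  then show ?case by (simp add: fourier_null_cmult)
next
  case (add P Q)
  then show ?case using fourier_null_add by (simp add: distrib_right)
next
  case (mult P Q)
  then show ?case by (simp add: mult.assoc)
qed

text \<open>By Stone-Weierstrass \<open>P\<close> is uniformly close to a polynomial
  \<open>Q\<close>, and the integral of Q u is the coefficient at 0 of the function Q u, all of
  whose coefficients vanish.\<close>

lemma fourier_null_integral_continuous:
  fixes P :: "complex \<times> complex \<Rightarrow> real"
  assumes u: "fourier_null u" and P: "continuous_on torus P"
  shows "(LINT x|T2. complex_of_real (P x) * u x) = 0"
proof -
  have uL: "u \<in> L2" using u by (simp add: fourier_null_def)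
  note [measurable] = L2_measurable[OF uL] continuous_on_borel_measurable_T2[OF P]
  have iu: "integrable T2 (\<lambda>x. cmod (u x))" using L2_integrable_T2[OF uL] by simp
  have bound: "cmod (LINT x|T2. complex_of_real (P x) * u x) \<le> e * (LINT x|T2. cmod (u x))" if e: "e > 0" for e
  proof -
    obtain Q where Q: "real_polynomial_function Q" "\<And>x. x \<in> torus \<Longrightarrow> \<bar>P x - Q x\<bar> < e"
      using Stone_Weierstrass_real_polynomial_function[OF compact_torus P e] by blast
    have Qle: "\<bar>P x - Q x\<bar> \<le> e" if "x \<in> torus" for x using Q(2)[OF that] by simp
    have "continuous_on torus Q"
      using Q(1) continuous_on_polymonial_function real_polynomial_function_eq by metis
    then have [measurable]: "Q \<in> borel_measurable T2" by (rule continuous_on_borel_measurable_T2)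
    have nQ: "fourier_null (\<lambda>x. complex_of_real (Q x) * u x)"
      by (rule fourier_null_real_polynomial[OF Q(1) u])
    have "fourier (\<lambda>x. complex_of_real (Q x) * u x) 0 = (LINT x|T2. complex_of_real (Q x) * u x)"
      by (simp add: fourier_def)
    then have Q0: "(LINT x|T2. complex_of_real (Q x) * u x) = 0" using nQ unfolding fourier_null_def by metis
    have iQ: "integrable T2 (\<lambda>x. complex_of_real (Q x) * u x)"
      using nQ by (intro L2_integrable_T2) (simp add: fourier_null_def)
    have iD: "integrable T2 (\<lambda>x. complex_of_real (P x - Q x) * u x)"
    proof (rule Bochner_Integration.integrable_bound)
      show "integrable T2 (\<lambda>x. e * cmod (u x))" using iu by simp
      show "AE x in T2. cmod (complex_of_real (P x - Q x) * u x) \<le> norm (e * cmod (u x))"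
        using Qle e by (intro AE_I2) (auto simp: norm_mult simp flip: of_real_diff intro!: mult_right_mono)
    qed measurable
    have "(LINT x|T2. complex_of_real (P x) * u x)
        = (LINT x|T2. complex_of_real (P x - Q x) * u x + complex_of_real (Q x) * u x)"
      by (simp add: algebra_simps)
    also have "\<dots> = (LINT x|T2. complex_of_real (P x - Q x) * u x)"
      using iD iQ Q0 by simp
    also have "cmod \<dots> \<le> (LINT x|T2. cmod (complex_of_real (P x - Q x) * u x))"
      by (rule integral_norm_bound)
    also have "\<dots> \<le> (LINT x|T2. e * cmod (u x))"
      using iD iu Qle by (intro integral_mono integrable_norm) (auto simp: norm_mult simp flip: of_real_diff intro!: mult_right_mono)
    finally show ?thesis using e by simp
  qed
  have I0: "0 \<le> (LINT x|T2. cmod (u x))" by simp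
  \<comment> \<open>Adding 1 keeps the divisor below positive even if \<open>u\<close> vanishes
    almost everywhere.\<close>
  then have J1: "0 < (LINT x|T2. cmod (u x)) + 1" by linarith
  have "cmod (LINT x|T2. complex_of_real (P x) * u x) \<le> 0 + e" if "e > 0" for e
  proof -
    have "cmod (LINT x|T2. complex_of_real (P x) * u x) \<le> e / ((LINT x|T2. cmod (u x)) + 1) * (LINT x|T2. cmod (u x))"
      by (rule bound[OF divide_pos_pos[OF that J1]])
    also have "\<dots> \<le> e" using J1 that by (simp add: field_simps)
    finally show ?thesis by simp
  qed
  then have "cmod (LINT x|T2. complex_of_real (P x) * u x) \<le> 0" by (rule field_le_epsilon)
  then show ?thesis by simp
qed

text \<open>The indicator of a closed set is the pointwise limit of the continuous cutoffs
  \<open>P n\<close>, and all products are dominated by |u|.\<close>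

lemma fourier_null_integral_closed:
  assumes u: "fourier_null u" and C: "closed C"
  shows "(LINT x|T2. indicator C x *\<^sub>R u x) = 0"
\<comment> \<open>The default value of \<open>infdist\<close> at the empty set is 0, so the cutoffs
  would be constantly 1 there.\<close>
proof (cases "C = {}")
  case False
  have uL: "u \<in> L2" using u by (simp add: fourier_null_def)
  note [measurable] = L2_measurable[OF uL] borel_closed[OF C]
  define P where "P n x = max 0 (1 - real n * infdist x C)" for n and x :: "complex \<times> complex"
  have P: "continuous_on torus (P n)" for n
    unfolding P_def by (intro continuous_intros continuous_on_max)
  have [measurable]: "P n \<in> borel_measurable T2" for n by (rule continuous_on_borel_measurable_T2[OF P])
  have [measurable]: "indicator C \<in> borel_measurable T2" by (rule borel_measurable_T2I) measurable
  have "(\<lambda>n. LINT x|T2. complex_of_real (P n x) * u x) \<longlonglongrightarrow> (LINT x|T2. indicator C x *\<^sub>R u x)"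
  proof (rule integral_dominated_convergence)
    show "integrable T2 (\<lambda>x. cmod (u x))" using L2_integrable_T2[OF uL] by simp
    show "AE x in T2. (\<lambda>n. complex_of_real (P n x) * u x) \<longlonglongrightarrow> indicator C x *\<^sub>R u x"
    proof (rule AE_I2)
      fix x
      have "(\<lambda>n. P n x) \<longlonglongrightarrow> indicator C x"
      proof (cases "x \<in> C")
        case True
        then show ?thesis by (simp add: P_def)
      next
        case x: False
        then have pos: "infdist x C > 0" by (rule infdist_pos_not_in_closed[OF C False])
        then obtain N where N: "1 / infdist x C < real N" using reals_Archimedean2 by blast
        have "P n x = 0" if "n \<ge> N" for n
        proof -
          have "1 / infdist x C < real n" using N that by simp
          then show ?thesis using pos by (simp add: P_def field_simps)
        qed
        then have "eventually (\<lambda>n. P n x = 0) sequentially" by (rule eventually_sequentiallyI)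
        then show ?thesis using x by (simp add: tendsto_eventually)
      qed
      then show "(\<lambda>n. complex_of_real (P n x) * u x) \<longlonglongrightarrow> indicator C x *\<^sub>R u x"
        unfolding scaleR_conv_of_real by (intro tendsto_intros)
    qed
    have "\<bar>P n x\<bar> \<le> 1" for n x by (auto simp: P_def infdist_nonneg)
    then show "AE x in T2. cmod (complex_of_real (P n x) * u x) \<le> cmod (u x)" for n
      by (intro AE_I2) (auto simp: norm_mult intro!: mult_left_le_one_le)
  qed measurable
  then show ?thesis using fourier_null_integral_continuous[OF u P] by (simp add: LIMSEQ_const_iff)
qed simp

text \<open>Closed sets form an intersection-stable generator of the Borel sets, so the vanishing of
  the integrals extends to all Borel sets; a function with vanishing integral over every measurable
  set is zero almost everywhere.\<close>

lemma fourier_null_imp_aeq_0: assumes u: "fourier_null u" shows "aeq u (\<lambda>x. 0)"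
proof -
  have uL: "u \<in> L2" using u by (simp add: fourier_null_def)
  note iu = L2_integrable_T2[OF uL]
  note [measurable] = L2_measurable[OF uL]
  have ind [measurable]: "A \<inter> torus \<in> sets T2" if "A \<in> sets borel" for A
    using that unfolding sets_T2 sets_restrict_space by auto
  have si: "set_integrable T2 A u" if "A \<in> sets T2" for A
    unfolding set_integrable_def using iu that by (rule integrable_mult_indicator[rotated])
  have closed: "(LINT x:(C \<inter> torus)|T2. u x) = 0" if "closed C" for C
    using fourier_null_integral_closed[OF u that] unfolding set_lebesgue_integral_def
    by (subst Bochner_Integration.integral_cong[OF refl, of _ _ "\<lambda>x. indicator C x *\<^sub>R u x"])
       (auto split: split_indicator)
  have stable: "Int_stable (Collect closed :: (complex \<times> complex) set set)" "Collect closed \<subseteq> Pow (UNIV :: (complex \<times> complex) set)"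
    by (auto simp: Int_stable_def)
  have "(LINT x:(A \<inter> torus)|T2. u x) = 0" if "A \<in> sigma_sets UNIV (Collect closed)" for A
    using stable that
  proof (induction rule: sigma_sets_induct_disjoint)
    case empty
    then show ?case by (simp add: set_lebesgue_integral_def)
  next
    case (compl A)
    have A: "A \<in> sets borel" using compl by (simp add: borel_eq_closed)
    \<comment> \<open>The integral over the whole torus is the closed case for \<open>UNIV\<close>;
      it splits into the parts inside and outside \<open>A\<close>.\<close>
    have T: "torus = (UNIV - A) \<inter> torus \<union> A \<inter> torus" by auto
    have "0 = (LINT x:((UNIV - A) \<inter> torus \<union> A \<inter> torus)|T2. u x)"
      using closed[of UNIV] by (simp flip: T)
    also have "\<dots> = (LINT x:((UNIV - A) \<inter> torus)|T2. u x) + (LINT x:(A \<inter> torus)|T2. u x)"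
      using A by (intro set_integral_Un si ind) auto
    finally show ?case using compl by simp
  next
    case (union A)
    have A: "A i \<in> sets borel" for i using union(2) by (auto simp: borel_eq_closed)
    have "(LINT x:(\<Union>i. A i \<inter> torus)|T2. u x) = (\<Sum>i. LINT x:(A i \<inter> torus)|T2. u x)"
    proof (rule lebesgue_integral_countable_add)
      show "A i \<inter> torus \<in> sets T2" for i using A by simp
      then show "set_integrable T2 (\<Union>i. A i \<inter> torus) u" by (intro si sets.countable_UN image_subsetI)
      show "A i \<inter> torus \<inter> (A j \<inter> torus) = {}" if "i \<noteq> j" for i j
        using union(1) that by (auto simp: disjoint_family_on_def)
    qed
    then show ?case using union(3) by simp
  qed (simp add: closed)
  then have "(LINT x:(A \<inter> torus)|T2. u x) = 0" if "A \<in> sets borel" for A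
    using that by (simp add: borel_eq_closed)
  then have "(LINT x:A|T2. u x) = 0" if "A \<in> sets T2" for A
    using that unfolding sets_T2 sets_restrict_space by (auto simp: Int_commute)
  then show ?thesis unfolding aeq_def by (rule T2.density_zero[OF iu])
qed

section \<open>Spectral subspaces and multiplication operators\<close>

text \<open>The two real conditions say that the Fourier coefficient at \<open>k\<close> vanishes.\<close>

definition spec_space :: "(int \<times> int) set \<Rightarrow> l2 set" where
  "spec_space A = {x. \<forall>k\<in>- A. inner x (cls (chr k)) = 0 \<and> inner x (cls (\<lambda>t. \<i> * chr k t)) = 0}"

text \<open>Recovers the complex product from the real one: replacing \<open>h\<close> by \<i> h
  multiplies \<open>ip g h\<close> by -\<i>, which moves its imaginary part into the real
  part.\<close>

lemma ip_inner:
  assumes "g \<in> L2" "h \<in> L2"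
  shows "ip g h = Complex (inner (cls g) (cls h)) (inner (cls g) (cls (\<lambda>t. \<i> * h t)))"
proof -
  have "ip g (\<lambda>t. \<i> * h t) = - \<i> * ip g h"
    by (simp add: ip_def mult.left_commute flip: integral_mult_right_zero)
  then show ?thesis using assms by (simp add: inner_cls L2_cmult complex_eq_iff)
qed

lemma cls_in_spec_space_iff: "g \<in> L2 \<Longrightarrow> cls g \<in> spec_space A \<longleftrightarrow> (\<forall>k\<in>- A. fourier g k = 0)"
  by (simp add: spec_space_def fourier_eq_ip ip_inner chr_L2 complex_eq_iff)

lemma Spec_iff_spec_space: "g \<in> L2 \<Longrightarrow> Spec g \<subseteq> A \<longleftrightarrow> cls g \<in> spec_space A"
  by (auto simp: cls_in_spec_space_iff Spec_def)

lemma spec_space_empty_imp_0: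
  assumes "x \<in> spec_space {}" shows "x = 0"
proof -
  have "fourier_null (rep_l2 x)"
    using assms cls_in_spec_space_iff[OF rep_L2, of x "{}"] rep_L2 by (auto simp: fourier_null_def)
  then have "cls (rep_l2 x) = cls (\<lambda>x. 0)"
    by (subst cls_eq_iff) (auto simp: rep_L2 L2_zero fourier_null_imp_aeq_0)
  then show ?thesis by (simp add: cls_zero)
qed

lemma subspace_spec_space: "subspace (spec_space A)"
  by (auto simp: spec_space_def subspace_def inner_add_left)

lemma closed_spec_space: "closed (spec_space A)"
proof -
  have "spec_space A = (\<Inter>k\<in>- A. {x. inner x (cls (chr k)) = 0} \<inter> {x. inner x (cls (\<lambda>t. \<i> * chr k t)) = 0})"
    by (auto simp: spec_space_def)
  also have "closed \<dots>" by (intro closed_INT ballI closed_Int closed_Collect_eq continuous_intros)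
  finally show ?thesis .
qed

lemma spec_space_mono: "A \<subseteq> B \<Longrightarrow> spec_space A \<subseteq> spec_space B"
  by (auto simp: spec_space_def)

lemma spec_space_Int: "spec_space A \<inter> spec_space B = spec_space (A \<inter> B)"
  by (auto simp: spec_space_def)

lemma spec_space_INT: "x \<in> spec_space (\<Inter>i\<in>J. A i) \<longleftrightarrow> (\<forall>i\<in>J. x \<in> spec_space (A i))"
  by (auto simp: spec_space_def)

lemma cls_chr_spec_space: "k \<in> A \<Longrightarrow> cls (\<lambda>t. c * chr k t) \<in> spec_space A"
  by (auto simp: cls_in_spec_space_iff L2_cmult chr_L2 fourier_cmult fourier_chr)

section \<open>Orthogonal projections onto spectral subspaces\<close>

definition Pr :: "(int \<times> int) set \<Rightarrow> l2 \<Rightarrow> l2" where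
  "Pr A x = (SOME y. y \<in> spec_space A \<and> (\<forall>z\<in>spec_space A. inner (x - y) z = 0))"

lemma Pr: "Pr A x \<in> spec_space A" and inner_diff_Pr: "z \<in> spec_space A \<Longrightarrow> inner (x - Pr A x) z = 0"
proof -
  have "\<exists>y. y \<in> spec_space A \<and> (\<forall>z\<in>spec_space A. inner (x - y) z = 0)"
    using subspace_projection_exists[OF subspace_spec_space closed_spec_space] by blast
  from someI_ex[OF this] show "Pr A x \<in> spec_space A" "z \<in> spec_space A \<Longrightarrow> inner (x - Pr A x) z = 0"
    by (auto simp: Pr_def)
qed

text \<open>The difference of two candidates lies in the space and is orthogonal to it. So the
  choice in \<open>Pr\<close> is unique, whereas the one in \<open>proj\<close> is unique only up to
  \<open>aeq\<close>.\<close>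

lemma Pr_eqI:
  assumes "y \<in> spec_space A" "\<And>z. z \<in> spec_space A \<Longrightarrow> inner (x - y) z = 0"
  shows "Pr A x = y"
proof -
  have z: "Pr A x - y \<in> spec_space A" by (intro subspace_diff subspace_spec_space Pr assms)
  have "inner (Pr A x - y) (Pr A x - y) = inner (x - y) (Pr A x - y) - inner (x - Pr A x) (Pr A x - y)"
    by (simp add: inner_diff_left)
  also have "\<dots> = 0" using assms(2)[OF z] inner_diff_Pr[OF z] by simp
  finally show ?thesis by simp
qed

lemma Pr_id: "x \<in> spec_space A \<Longrightarrow> Pr A x = x"
  by (rule Pr_eqI) auto

lemma inner_Pr_left: "z \<in> spec_space A \<Longrightarrow> inner (Pr A x) z = inner x z"
  using inner_diff_Pr[of z A x] by (simp add: inner_diff_left)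

lemma norm_Pr_le: "norm (Pr A x) \<le> norm x"
proof -
  have "(norm (Pr A x))\<^sup>2 = inner x (Pr A x)" by (simp add: power2_norm_eq_inner inner_Pr_left Pr)
  also have "\<dots> \<le> norm x * norm (Pr A x)" by (rule norm_cauchy_schwarz)
  finally show ?thesis
    by (cases "norm (Pr A x) = 0") (auto simp: power2_eq_square)
qed

lemma bounded_linear_Pr: "bounded_linear (Pr A)"
proof
  show "Pr A (x + y) = Pr A x + Pr A y" for x y
    by (rule Pr_eqI) (auto simp: Pr subspace_add subspace_spec_space inner_Pr_left inner_diff_left inner_add_left)
  show "Pr A (r *\<^sub>R x) = r *\<^sub>R Pr A x" for r x
    by (rule Pr_eqI) (auto simp: Pr subspace_scale subspace_spec_space inner_Pr_left inner_diff_left)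
  show "\<exists>K. \<forall>x. norm (Pr A x) \<le> norm x * K" using norm_Pr_le by (intro exI[of _ 1]) simp
qed

text \<open>Testing against \<open>chr k\<close> and \<i> \<open>chr k\<close> for k in
  \<open>A\<close> suffices. Together with \<open>inner_spec_space_compl\<close> this identifies the
  orthogonal complement of \<open>spec_space A\<close> as \<open>spec_space (- A)\<close>.\<close>

lemma orth_spec_space_imp:
  assumes "\<And>y. y \<in> spec_space A \<Longrightarrow> inner x y = 0" shows "x \<in> spec_space (- A)"
  using assms cls_chr_spec_space[of _ A 1] cls_chr_spec_space[of _ A \<i>] by (auto simp: spec_space_def)

lemma spec_space_disjoint: "x \<in> spec_space A \<Longrightarrow> x \<in> spec_space (- A) \<Longrightarrow> x = 0"
  using spec_space_Int[of A "- A"] by (intro spec_space_empty_imp_0) auto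

lemma diff_Pr_spec_space: "x - Pr A x \<in> spec_space (- A)"
  by (rule orth_spec_space_imp) (rule inner_diff_Pr)

lemma Pr_compl: assumes "x \<in> spec_space (- A)" shows "Pr A x = 0"
proof (rule spec_space_disjoint[OF Pr])
  have "x - (x - Pr A x) \<in> spec_space (- A)"
    by (intro subspace_diff subspace_spec_space assms diff_Pr_spec_space)
  then show "Pr A x \<in> spec_space (- A)" by simp
qed

lemma Pr_eq_0_iff: "Pr A x = 0 \<longleftrightarrow> x \<in> spec_space (- A)"
  using Pr_compl diff_Pr_spec_space[of x A] by auto

lemma inner_spec_space_compl: "x \<in> spec_space A \<Longrightarrow> y \<in> spec_space (- A) \<Longrightarrow> inner y x = 0"
  using inner_Pr_left[of x A y] Pr_compl[of y A] by simp

text \<open>One set is split off at a time by an orthogonal projection. The pieces therefore have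
  disjoint spectra even when the sets overlap, and Pythagoras bounds each of them by
  \<open>x\<close> with constant 1.\<close>

lemma spec_space_UN_decompose:
  assumes "finite J" "x \<in> spec_space (\<Union>i\<in>J. A i)"
  shows "\<exists>r. (\<forall>i\<in>J. r i \<in> spec_space (A i) \<and> norm (r i) \<le> norm x) \<and> x = (\<Sum>i\<in>J. r i)"
  using assms
proof (induction J arbitrary: x rule: finite_induct)
  case empty
  then show ?case using spec_space_empty_imp_0 by auto
next
  case (insert j J)
  define y where "y = Pr (\<Union>i\<in>J. A i) x"
  obtain r where r: "\<forall>i\<in>J. r i \<in> spec_space (A i) \<and> norm (r i) \<le> norm y" "y = (\<Sum>i\<in>J. r i)"
    using insert.IH[OF Pr[of _ x], folded y_def] by blast
  have "x - y \<in> spec_space (- (\<Union>i\<in>J. A i))" unfolding y_def by (rule diff_Pr_spec_space)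
  moreover have "x - y \<in> spec_space (\<Union>i\<in>insert j J. A i)"
    using insert.prems spec_space_mono[of "\<Union>i\<in>J. A i" "\<Union>i\<in>insert j J. A i"] Pr
    by (intro subspace_diff subspace_spec_space) (auto simp: y_def)
  \<comment> \<open>Spectrum in the enlarged union but outside the old one is contained in
    \<open>A j\<close>.\<close>
  ultimately have "x - y \<in> spec_space (- (\<Union>i\<in>J. A i) \<inter> (\<Union>i\<in>insert j J. A i))"
    using spec_space_Int by blast
  then have d: "x - y \<in> spec_space (A j)"
    using spec_space_mono[of "- (\<Union>i\<in>J. A i) \<inter> (\<Union>i\<in>insert j J. A i)" "A j"] by auto
  have 0: "inner (x - y) y = 0" unfolding y_def by (rule inner_diff_Pr[OF Pr])
  then have 1: "inner y (x - y) = 0" by (simp add: inner_commute)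
  have "(norm x)\<^sup>2 = inner ((x - y) + y) ((x - y) + y)" by (simp add: power2_norm_eq_inner)
  also have "\<dots> = (norm (x - y))\<^sup>2 + (norm y)\<^sup>2"
    unfolding inner_add_left inner_add_right 0 1 by (simp add: power2_norm_eq_inner)
  finally have n: "norm (x - y) \<le> norm x" by (simp add: power2_le_imp_le)
  have ny: "norm y \<le> norm x" unfolding y_def by (rule norm_Pr_le)
  show ?case
  proof (intro exI[of _ "r(j := x - y)"] conjI ballI)
    fix i assume "i \<in> insert j J"
    then show "(r(j := x - y)) i \<in> spec_space (A i)" "norm ((r(j := x - y)) i) \<le> norm x"
      using r(1) d n ny by force+
  next
    have "(\<Sum>i\<in>J. (r(j := x - y)) i) = (\<Sum>i\<in>J. r i)" using insert.hyps by (intro sum.cong) auto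
    then show "x = (\<Sum>i\<in>insert j J. (r(j := x - y)) i)" using insert.hyps r(2) by simp
  qed
qed

subsection \<open>The spaces \<open>PS A\<close>\<close>

definition trig_space :: "(int \<times> int) set \<Rightarrow> l2 set" where
  "trig_space A = {cls p |p. trig_poly p \<and> Spec p \<subseteq> A}"

lemma trig_polyI: "finite K \<Longrightarrow> trig_poly (\<lambda>x. \<Sum>k\<in>K. c k * chr k x)"
  unfolding trig_poly_def by (intro exI conjI) auto

lemma trig_polyE:
  assumes "trig_poly p" obtains K c where "finite K" "p = (\<lambda>x. \<Sum>k\<in>K. c k * chr k x)"
  using assms unfolding trig_poly_def by (elim exE conjE)

lemma trig_poly_L2: "trig_poly p \<Longrightarrow> p \<in> L2"
  by (erule trig_polyE) (simp add: L2_sum L2_cmult chr_L2)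

lemma trig_poly_add: assumes "trig_poly p" "trig_poly q" shows "trig_poly (\<lambda>x. p x + q x)"
proof -
  obtain K c where K: "finite K" "p = (\<lambda>x. \<Sum>k\<in>K. c k * chr k x)"
    using assms(1) by (rule trig_polyE)
  obtain L d where L: "finite L" "q = (\<lambda>x. \<Sum>k\<in>L. d k * chr k x)"
    using assms(2) by (rule trig_polyE)
  have "(\<Sum>k\<in>K. c k * chr k x) = (\<Sum>k\<in>K \<union> L. (if k \<in> K then c k else 0) * chr k x)" for x
    using K(1) L(1) by (intro sum.mono_neutral_cong_left) auto
  moreover have "(\<Sum>k\<in>L. d k * chr k x) = (\<Sum>k\<in>K \<union> L. (if k \<in> L then d k else 0) * chr k x)" for x
    using K(1) L(1) by (intro sum.mono_neutral_cong_left) auto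
  ultimately have "(\<lambda>x. p x + q x)
      = (\<lambda>x. \<Sum>k\<in>K \<union> L. ((if k \<in> K then c k else 0) + (if k \<in> L then d k else 0)) * chr k x)"
    by (simp only: K(2) L(2) distrib_right sum.distrib)
  then show ?thesis by (simp only: trig_polyI finite_UnI K(1) L(1))
qed

lemma trig_poly_cmult: assumes "trig_poly p" shows "trig_poly (\<lambda>x. a * p x)"
proof -
  obtain K c where K: "finite K" "p = (\<lambda>x. \<Sum>k\<in>K. c k * chr k x)"
    using assms by (rule trig_polyE)
  then have "(\<lambda>x. a * p x) = (\<lambda>x. \<Sum>k\<in>K. (a * c k) * chr k x)"
    by (simp only: sum_distrib_left mult.assoc)
  then show ?thesis by (simp only: trig_polyI K(1))
qed

lemma trig_spaceI: "trig_poly p \<Longrightarrow> Spec p \<subseteq> A \<Longrightarrow> cls p \<in> trig_space A"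
  unfolding trig_space_def by blast

lemma trig_spaceE:
  assumes "x \<in> trig_space A" obtains p where "x = cls p" "trig_poly p" "Spec p \<subseteq> A"
proof -
  have "\<exists>p. x = cls p \<and> trig_poly p \<and> Spec p \<subseteq> A" using assms by (simp add: trig_space_def)
  then show thesis by (elim exE conjE) (rule that)
qed

lemma subspace_trig_space: "subspace (trig_space A)"
proof (rule subspaceI)
  have "trig_poly (\<lambda>x. 0)" using trig_polyI[of "{}" "\<lambda>_. 0"] by simp
  moreover have "Spec (\<lambda>x. 0) \<subseteq> A" by (simp add: Spec_def fourier_def)
  ultimately show "0 \<in> trig_space A" unfolding cls_zero[symmetric] by (rule trig_spaceI)
  show "x + y \<in> trig_space A" if x: "x \<in> trig_space A" and y: "y \<in> trig_space A" for x y
  proof -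
    obtain p where p: "x = cls p" "trig_poly p" "Spec p \<subseteq> A" using x by (rule trig_spaceE)
    obtain q where q: "y = cls q" "trig_poly q" "Spec q \<subseteq> A" using y by (rule trig_spaceE)
    have "k \<in> A" if "fourier (\<lambda>t. p t + q t) k \<noteq> 0" for k
    proof -
      have "fourier p k \<noteq> 0 \<or> fourier q k \<noteq> 0"
        using that fourier_add[OF trig_poly_L2[OF p(2)] trig_poly_L2[OF q(2)], of k] by auto
      then show ?thesis using p(3) q(3) unfolding Spec_def by blast
    qed
    then have "Spec (\<lambda>t. p t + q t) \<subseteq> A" unfolding Spec_def by blast
    with trig_poly_add[OF p(2) q(2)] have "cls (\<lambda>t. p t + q t) \<in> trig_space A" by (rule trig_spaceI)
    then show ?thesis unfolding p(1) q(1) by (simp only: cls_add trig_poly_L2 p(2) q(2))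
  qed
  show "r *\<^sub>R x \<in> trig_space A" if x: "x \<in> trig_space A" for r x
  proof -
    obtain p where p: "x = cls p" "trig_poly p" "Spec p \<subseteq> A" using x by (rule trig_spaceE)
    have "Spec (\<lambda>t. of_real r * p t) \<subseteq> A"
      using p(3) unfolding Spec_def fourier_cmult by (simp add: subset_iff)
    with trig_poly_cmult[OF p(2)] have "cls (\<lambda>t. of_real r * p t) \<in> trig_space A" by (rule trig_spaceI)
    then show ?thesis unfolding p(1) by (subst scaleR_l2.abs_eq) (auto simp: trig_poly_L2 p(2))
  qed
qed

lemma trig_space_subset: "trig_space A \<subseteq> spec_space A"
  by (auto simp: trig_space_def Spec_iff_spec_space[symmetric] trig_poly_L2)

lemma cls_chr_trig_space: assumes "k \<in> A" shows "cls (\<lambda>t. c * chr k t) \<in> trig_space A"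
proof -
  have "trig_poly (\<lambda>t. c * chr k t)"
    using trig_polyI[of "{k}" "\<lambda>_. c"] by simp
  moreover have "Spec (\<lambda>t. c * chr k t) \<subseteq> A"
    using assms unfolding Spec_def fourier_cmult fourier_chr by (auto split: if_splits)
  ultimately show ?thesis by (rule trig_spaceI)
qed

lemma subspace_closure:
  fixes S :: "'a::real_normed_vector set"
  assumes S: "subspace S" shows "subspace (closure S)"
proof (rule subspaceI)
  show "0 \<in> closure S" using subspace_0[OF S] closure_subset by blast
  show "x + y \<in> closure S" if x: "x \<in> closure S" and y: "y \<in> closure S" for x y
  proof -
    obtain X where X: "\<And>n. X n \<in> S" "X \<longlonglongrightarrow> x" using x unfolding closure_sequential by blast
    obtain Y where Y: "\<And>n. Y n \<in> S" "Y \<longlonglongrightarrow> y" using y unfolding closure_sequential by blast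
    show ?thesis unfolding closure_sequential
      by (intro exI[of _ "\<lambda>n. X n + Y n"] conjI allI subspace_add S X Y tendsto_add)
  qed
  show "c *\<^sub>R x \<in> closure S" if x: "x \<in> closure S" for c x
  proof -
    obtain X where X: "\<And>n. X n \<in> S" "X \<longlonglongrightarrow> x" using x unfolding closure_sequential by blast
    show ?thesis unfolding closure_sequential
      by (intro exI[of _ "\<lambda>n. c *\<^sub>R X n"] conjI allI subspace_scale S X tendsto_scaleR tendsto_const)
  qed
qed

text \<open>The difference between an element of \<open>spec_space A\<close> and its projection onto
  the closure has spectrum in \<open>A\<close> and is orthogonal to all characters of
  \<open>A\<close>; uniqueness of Fourier coefficients makes it zero.\<close>

lemma closure_trig_space: "closure (trig_space A) = spec_space A"
proof
  show "closure (trig_space A) \<subseteq> spec_space A"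
    by (intro closure_minimal trig_space_subset closed_spec_space)
  show "spec_space A \<subseteq> closure (trig_space A)"
  proof
    fix x assume x: "x \<in> spec_space A"
    obtain y where y: "y \<in> closure (trig_space A)" "\<And>z. z \<in> closure (trig_space A) \<Longrightarrow> inner (x - y) z = 0"
      using subspace_projection_exists[OF subspace_closure[OF subspace_trig_space] closed_closure] by blast
    have "inner (x - y) (cls (\<lambda>t. c * chr k t)) = 0" if "k \<in> A" for k c
      using y(2) closure_subset cls_chr_trig_space[OF that] by blast
    from this[of _ 1] this[of _ \<i>] have "x - y \<in> spec_space (- A)" by (auto simp: spec_space_def)
    moreover have "x - y \<in> spec_space A"
      using x y(1) \<open>closure (trig_space A) \<subseteq> spec_space A\<close> by (intro subspace_diff subspace_spec_space) auto
    ultimately have "x - y = 0" by (intro spec_space_disjoint)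
    then show "x \<in> closure (trig_space A)" using y(1) by simp
  qed
qed

text \<open>Replaces approximation by trigonometric polynomials by the vanishing of Fourier
  coefficients, so that the operator theory can be done in \<open>l2\<close>.\<close>

lemma PS_iff: "g \<in> PS A \<longleftrightarrow> g \<in> L2 \<and> cls g \<in> spec_space A"
proof -
  have "(\<exists>p. trig_poly p \<and> Spec p \<subseteq> A \<and> l2norm (\<lambda>x. g x - p x) < e) \<longleftrightarrow> (\<exists>y\<in>trig_space A. dist y (cls g) < e)"
    if "g \<in> L2" for e
  proof -
    have "l2norm (\<lambda>x. g x - p x) = dist (cls p) (cls g)" if "trig_poly p" for p
      using norm_cls[OF L2_diff[OF \<open>g \<in> L2\<close> trig_poly_L2[OF that]]]
      by (simp add: dist_norm norm_minus_commute[of "cls p"] cls_diff \<open>g \<in> L2\<close> trig_poly_L2[OF that])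
    then show ?thesis unfolding trig_space_def by auto
  qed
  then show ?thesis unfolding closure_trig_space[symmetric] closure_approachable PS_def by auto
qed

lemma PS_L2: "g \<in> PS A \<Longrightarrow> g \<in> L2"
  by (simp add: PS_iff)

text \<open>The class of the chosen function is determined although the function is not:
  orthogonality with respect to \<open>ip\<close> contains orthogonality with respect to the real
  product, which characterizes \<open>Pr\<close>.\<close>

lemma proj_PS: assumes "g \<in> L2" shows "proj A g \<in> PS A \<and> cls (proj A g) = Pr A (cls g)"
proof -
  define h where "h = rep_l2 (Pr A (cls g))"
  have h: "h \<in> L2" "cls h = Pr A (cls g)" by (auto simp: h_def rep_L2)
  have "h \<in> PS A \<and> (\<forall>\<phi>\<in>PS A. ip (\<lambda>x. g x - h x) \<phi> = 0)"
  proof (intro conjI ballI)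
    show "h \<in> PS A" using h Pr by (simp add: PS_iff)
    fix \<phi> assume "\<phi> \<in> PS A"
    then have p: "\<phi> \<in> L2" "cls \<phi> \<in> spec_space A" by (auto simp: PS_iff)
    have "cls (\<lambda>t. \<i> * \<phi> t) \<in> spec_space A"
      \<comment> \<open>The space is complex, so \<i> \<phi> is an admissible test function; it
        accounts for the imaginary part of \<open>ip\<close>.\<close>
      using p by (simp add: cls_in_spec_space_iff L2_cmult fourier_cmult)
    then show "ip (\<lambda>x. g x - h x) \<phi> = 0"
      using assms h p inner_diff_Pr by (simp add: ip_inner L2_diff cls_diff complex_eq_iff)
  qed
  then have "\<exists>h. h \<in> PS A \<and> (\<forall>\<phi>\<in>PS A. ip (\<lambda>x. g x - h x) \<phi> = 0)" by blast
  from someI_ex[OF this]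
  have pr: "proj A g \<in> PS A" "\<And>\<phi>. \<phi> \<in> PS A \<Longrightarrow> ip (\<lambda>x. g x - proj A g x) \<phi> = 0"
    by (auto simp: proj_def)
  have "Pr A (cls g) = cls (proj A g)"
  proof (rule Pr_eqI)
    show "cls (proj A g) \<in> spec_space A" using pr(1) by (simp add: PS_iff)
    fix z assume "z \<in> spec_space A"
    then have "rep_l2 z \<in> PS A" by (simp add: PS_iff rep_L2)
    from pr(2)[OF this] have "inner (cls (\<lambda>x. g x - proj A g x)) (cls (rep_l2 z)) = 0"
      using assms PS_L2[OF pr(1)] by (subst inner_cls) (auto simp: L2_diff rep_L2)
    then show "inner (cls g - cls (proj A g)) z = 0"
      using assms PS_L2[OF pr(1)] by (simp add: cls_diff)
  qed
  with pr(1) show ?thesis by simp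
qed

subsection \<open>Multiplication operators\<close>

text \<open>Defined through the chosen representative; by \<open>mul_cls\<close> any other
  representative gives the same class when \<open>a\<close> is bounded.\<close>

definition mul :: "tfun \<Rightarrow> l2 \<Rightarrow> l2" where
  "mul a x = cls (\<lambda>t. a t * rep_l2 x t)"

lemma mul_cls: assumes "a \<in> Linf" "g \<in> L2" shows "mul a (cls g) = cls (\<lambda>t. a t * g t)"
  unfolding mul_def using rep_cls[OF assms(2)] assms
  by (subst cls_eq_iff) (auto simp: Linf_mult_L2 rep_L2 aeq_def)

lemma mul_mul: "a \<in> Linf \<Longrightarrow> b \<in> Linf \<Longrightarrow> mul a (mul b x) = mul (\<lambda>t. a t * b t) x"
  unfolding mul_def[of b] by (subst mul_cls) (auto simp: Linf_mult_L2 rep_L2 mul_def mult.assoc)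

lemma mul_cong: assumes "a \<in> Linf" "b \<in> Linf" "aeq a b" shows "mul a x = mul b x"
  unfolding mul_def using assms by (subst cls_eq_iff) (auto simp: Linf_mult_L2 rep_L2 aeq_def)

lemma mul_1: "mul (\<lambda>t. 1) x = x"
  by (simp add: mul_def)

lemma norm_mul_le:
  assumes a: "a \<in> Linf" "AE t in T2. cmod (a t) \<le> C" and C: "C \<ge> 0"
  shows "norm (mul a x) \<le> C * norm x"
proof (rule power2_le_imp_le)
  have L: "(\<lambda>t. a t * rep_l2 x t) \<in> L2" by (intro Linf_mult_L2 a rep_L2)
  have "(norm (mul a x))\<^sup>2 = (LINT t|T2. (cmod (a t * rep_l2 x t))\<^sup>2)"
    by (simp add: mul_def norm_cls[OF L] l2norm_def)
  also have "\<dots> \<le> (LINT t|T2. C\<^sup>2 * (cmod (rep_l2 x t))\<^sup>2)"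
  proof (rule integral_mono_AE)
    show "AE t in T2. (cmod (a t * rep_l2 x t))\<^sup>2 \<le> C\<^sup>2 * (cmod (rep_l2 x t))\<^sup>2"
      using a(2) by eventually_elim (auto simp: norm_mult power_mult_distrib intro!: mult_right_mono power_mono)
  qed (use L2_integrable[OF L] L2_integrable[OF rep_L2] in auto)
  also have "\<dots> = C\<^sup>2 * (norm (cls (rep_l2 x)))\<^sup>2" by (simp only: norm_cls[OF rep_L2]) (simp add: l2norm_def)
  finally show "(norm (mul a x))\<^sup>2 \<le> (C * norm x)\<^sup>2" by (simp add: power_mult_distrib)
qed (use C in simp)

lemma mul_add: "a \<in> Linf \<Longrightarrow> mul a (x + y) = mul a x + mul a y"
proof -
  assume a: "a \<in> Linf"
  have "mul a (cls (rep_l2 x) + cls (rep_l2 y)) = mul a (cls (rep_l2 x)) + mul a (cls (rep_l2 y))"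
    using a by (simp only: cls_add[symmetric] rep_L2 mul_cls L2_add Linf_mult_L2 distrib_left)
  then show ?thesis by simp
qed

lemma mul_scaleR: "a \<in> Linf \<Longrightarrow> mul a (r *\<^sub>R x) = r *\<^sub>R mul a x"
proof -
  assume a: "a \<in> Linf"
  have "mul a (cls (\<lambda>t. of_real r * rep_l2 x t)) = cls (\<lambda>t. of_real r * (a t * rep_l2 x t))"
    by (subst mul_cls) (auto simp: a L2_cmult rep_L2 mult.left_commute)
  also have "\<dots> = r *\<^sub>R mul a x" by (simp add: mul_def scaleR_l2.abs_eq Linf_mult_L2 a rep_L2)
  also have "cls (\<lambda>t. of_real r * rep_l2 x t) = r *\<^sub>R cls (rep_l2 x)" by (subst scaleR_l2.abs_eq) (auto simp: rep_L2)
  finally show ?thesis by simp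
qed

lemma bounded_linear_mul: assumes a: "a \<in> Linf" shows "bounded_linear (mul a)"
proof
  obtain C where C: "AE t in T2. cmod (a t) \<le> C" using a by (auto simp: Linf_def)
  then have "AE t in T2. cmod (a t) \<le> max C 0" by eventually_elim simp
  from norm_mul_le[OF a this] show "\<exists>K. \<forall>x. norm (mul a x) \<le> norm x * K"
    by (intro exI[of _ "max C 0"]) (simp add: mult.commute)
qed (auto simp: mul_add mul_scaleR a)

lemma inner_mul_left:
  assumes a: "a \<in> Linf" shows "inner (mul a x) y = inner x (mul (\<lambda>t. cnj (a t)) y)"
proof -
  have "inner (mul a x) (cls (rep_l2 y)) = inner (cls (rep_l2 x)) (mul (\<lambda>t. cnj (a t)) y)"
    unfolding mul_def
    by (subst (1 2) inner_cls) (auto simp: Linf_mult_L2 Linf_cnj a rep_L2 ip_def mult_ac)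
  then show ?thesis by simp
qed

text \<open>Spectra add under multiplication. No convolution is formed: the coefficient of a x at n
  is the product of x with cnj a times \<open>chr n\<close>, and the coefficient of the latter at k
  is the conjugate of that of a at n - k, which is zero for k in \<open>A\<close> and n outside
  \<open>C\<close>.\<close>

lemma mul_spec_space:
  assumes a: "a \<in> Linf" "Spec a \<subseteq> B" and x: "x \<in> spec_space A"
    and AB: "\<And>k l. k \<in> A \<Longrightarrow> l \<in> B \<Longrightarrow> k + l \<in> C"
  shows "mul a x \<in> spec_space C"
proof -
  have "inner (mul a x) (cls (\<lambda>t. c * chr n t)) = 0" if n: "n \<notin> C" for n c
  proof -
    have L: "(\<lambda>t. cnj (a t) * (c * chr n t)) \<in> L2" by (intro Linf_mult_L2 Linf_cnj a L2_cmult chr_L2)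
    have "fourier (\<lambda>t. cnj (a t) * (c * chr n t)) k = 0" if k: "k \<in> A" for k
    proof -
      have "n - k \<notin> B" using AB[OF k, of "n - k"] n by auto
      then have 0: "fourier a (n - k) = 0" using a(2) by (auto simp: Spec_def)
      have "fourier (\<lambda>t. cnj (a t) * (c * chr n t)) k = (LINT t|T2. c * cnj (a t * cnj (chr (n - k) t)))"
        unfolding fourier_def
        by (intro Bochner_Integration.integral_cong refl) (simp add: cnj_chr mult_ac flip: chr_add)
      also have "\<dots> = c * cnj (fourier a (n - k))"
        unfolding fourier_def integral_mult_right_zero Bochner_Integration.integral_cnj ..
      finally show ?thesis using 0 by simp
    qed
    then have "cls (\<lambda>t. cnj (a t) * (c * chr n t)) \<in> spec_space (- A)"
      by (auto simp: cls_in_spec_space_iff[OF L])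
    then have "inner x (cls (\<lambda>t. cnj (a t) * (c * chr n t))) = 0"
      using inner_spec_space_compl[OF x] inner_commute by metis
    then show ?thesis
      by (simp add: inner_mul_left a mul_cls Linf_cnj L2_cmult chr_L2)
  qed
  from this[of _ 1] this[of _ \<i>] show ?thesis by (auto simp: spec_space_def)
qed

section \<open>The Hankel equation\<close>

lemma mul_mul_eq:
  assumes "a \<in> Linf" "b \<in> Linf" "c \<in> Linf" "AE t in T2. a t * b t = c t"
  shows "mul a (mul b x) = mul c x"
  unfolding mul_mul[OF assms(1,2)] using assms by (intro mul_cong) (auto simp: Linf_mult aeq_def)

text \<open>Isolates what the operator theory needs from the geometry: \<open>L\<close> is the
  complement of the union of the \<open>B i\<close>, and multiplication by the conjugates of
  \<open>g i\<close> and of its inverse leaves \<open>spec_space (B i)\<close> invariant.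
  \<open>F\<close> is the symbol f.\<close>

locale hankel_setting =
  fixes p :: nat and B :: "nat \<Rightarrow> (int \<times> int) set" and L :: "(int \<times> int) set"
    and g :: "nat \<Rightarrow> tfun" and F :: tfun
  assumes p_pos: "0 < p"
    and L_eq: "L = - (\<Union>i<p. B i)"
    and F_Linf: "F \<in> Linf"
    and g_Linf: "i < p \<Longrightarrow> g i \<in> Linf"
    and inv_Linf: "i < p \<Longrightarrow> (\<lambda>t. 1 / g i t) \<in> Linf"
    and F_eq: "i < p \<Longrightarrow> AE t in T2. F t = g i t * cnj (g i t)"
    and F_nz: "AE t in T2. F t \<noteq> 0"
    and cnj_g_spec: "i < p \<Longrightarrow> x \<in> spec_space (B i) \<Longrightarrow> mul (\<lambda>t. cnj (g i t)) x \<in> spec_space (B i)"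
    and cnj_inv_spec: "i < p \<Longrightarrow> x \<in> spec_space (B i) \<Longrightarrow> mul (\<lambda>t. cnj (1 / g i t)) x \<in> spec_space (B i)"
begin

section \<open>Invariant subspaces of the factors and their inverses\<close>

lemma g_nz: "i < p \<Longrightarrow> AE t in T2. g i t \<noteq> 0"
  using F_eq[of i] F_nz by (auto elim!: eventually_elim2)

lemma cnj_g_Linf: "i < p \<Longrightarrow> (\<lambda>t. cnj (g i t)) \<in> Linf"
  by (rule Linf_cnj[OF g_Linf])

lemma cnj_inv_Linf: "i < p \<Longrightarrow> (\<lambda>t. cnj (1 / g i t)) \<in> Linf"
  by (rule Linf_cnj[OF inv_Linf])

lemma Phi_Linf: assumes "i < p" shows "Phi g i \<in> Linf"
proof -
  have "(\<lambda>t. cnj (g i t) * cnj (1 / g 0 t)) \<in> Linf"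
    by (intro Linf_mult cnj_g_Linf cnj_inv_Linf assms p_pos)
  then show ?thesis by (simp add: Phi_def[abs_def])
qed

lemma cnj_Phi_Linf: "i < p \<Longrightarrow> (\<lambda>t. cnj (Phi g i t)) \<in> Linf"
  by (rule Linf_cnj[OF Phi_Linf])

lemmas Linf_intros = F_Linf g_Linf inv_Linf cnj_g_Linf cnj_inv_Linf Phi_Linf cnj_Phi_Linf p_pos

lemma linear_mul: "a \<in> Linf \<Longrightarrow> linear (mul a)"
  by (rule bounded_linear.linear[OF bounded_linear_mul])

lemma linear_Pr: "linear (Pr A)"
  by (rule bounded_linear.linear[OF bounded_linear_Pr])

lemma mul_F: "i < p \<Longrightarrow> mul (\<lambda>t. cnj (g i t)) (mul (g i) x) = mul F x"
  by (rule mul_mul_eq) (use F_eq[of i] in \<open>auto intro: Linf_intros elim!: eventually_mono\<close>)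

lemma mul_inv: "i < p \<Longrightarrow> mul (\<lambda>t. 1 / g i t) (mul (g i) x) = x"
  using mul_mul_eq[of "\<lambda>t. 1 / g i t" "g i" "\<lambda>t. 1" x] g_nz[of i]
  by (auto simp: mul_1 Linf_intros Linf_const elim!: eventually_mono)

text \<open>Multiplication by \<open>g i\<close> is the adjoint of multiplication by its conjugate,
  and an adjoint preserves the orthogonal complement of an invariant subspace.\<close>

lemma g_spec_compl:
  assumes i: "i < p" and x: "x \<in> spec_space (- B i)" shows "mul (g i) x \<in> spec_space (- B i)"
proof (rule orth_spec_space_imp)
  fix y assume "y \<in> spec_space (B i)"
  from inner_spec_space_compl[OF cnj_g_spec[OF i this] x]
  show "inner (mul (g i) x) y = 0" by (simp add: inner_mul_left Linf_intros i)
qed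

lemma inv_spec_compl:
  assumes i: "i < p" and x: "x \<in> spec_space (- B i)" shows "mul (\<lambda>t. 1 / g i t) x \<in> spec_space (- B i)"
proof (rule orth_spec_space_imp)
  fix y assume "y \<in> spec_space (B i)"
  from inner_spec_space_compl[OF cnj_inv_spec[OF i this] x]
  show "inner (mul (\<lambda>t. 1 / g i t) x) y = 0" by (simp only: inner_mul_left inv_Linf[OF i])
qed

lemma L_subset: "i < p \<Longrightarrow> spec_space L \<subseteq> spec_space (- B i)"
  using L_eq by (intro spec_space_mono) auto

lemma spec_space_L_I:
  assumes "\<And>i. i < p \<Longrightarrow> x \<in> spec_space (- B i)" shows "x \<in> spec_space L"
proof -
  have "L = (\<Inter>i\<in>{..<p}. - B i)" using L_eq by auto
  then show ?thesis using assms by (simp add: spec_space_INT)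
qed

subsection \<open>Invertibility of the Toeplitz operator\<close>

lemma inner_F: "inner (mul F x) x = (norm (mul (g 0) x))\<^sup>2"
  unfolding mul_F[OF p_pos, symmetric] by (simp add: inner_mul_left Linf_intros power2_norm_eq_inner)

text \<open>The quadratic form is the squared norm of g 0 x, and \<open>x\<close> is recovered from
  g 0 x by the bounded multiplication by 1 / g 0.\<close>

lemma F_coercive: "\<exists>c>0. \<forall>x. c * (norm x)\<^sup>2 \<le> inner (mul F x) x"
proof -
  obtain K where K: "\<And>x. norm (mul (\<lambda>t. 1 / g 0 t) x) \<le> norm x * K" "K > 0"
    using bounded_linear.pos_bounded[OF bounded_linear_mul[OF inv_Linf[OF p_pos]]] by blast
  have "1 / K\<^sup>2 * (norm x)\<^sup>2 \<le> inner (mul F x) x" for x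
  proof -
    have "norm x \<le> norm (mul (g 0) x) * K" using K(1)[of "mul (g 0) x"] by (simp only: mul_inv[OF p_pos])
    then have "(norm x)\<^sup>2 \<le> (norm (mul (g 0) x) * K)\<^sup>2" by (rule power_mono) simp
    then show ?thesis using K(2) by (simp add: inner_F power_mult_distrib divide_le_eq)
  qed
  then show ?thesis using K(2) by (intro exI[of _ "1 / K\<^sup>2"]) simp
qed

text \<open>Coercivity and Cauchy-Schwarz on \<open>spec_space L\<close>. This bound provides both
  the injectivity of the Toeplitz operator and the boundedness of its inverse.\<close>

lemma norm_le_toeplitz: "\<exists>C>0. \<forall>h\<in>spec_space L. norm h \<le> C * norm (Pr L (mul F h))"
proof -
  obtain c where c: "c > 0" "\<And>x. c * (norm x)\<^sup>2 \<le> inner (mul F x) x" using F_coercive by blast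
  have "norm h \<le> 1 / c * norm (Pr L (mul F h))" if h: "h \<in> spec_space L" for h
  proof (cases "norm h = 0")
    case False
    have "c * (norm h)\<^sup>2 \<le> inner (Pr L (mul F h)) h" using c(2)[of h] by (simp add: inner_Pr_left h)
    also have "\<dots> \<le> norm (Pr L (mul F h)) * norm h" by (rule norm_cauchy_schwarz)
    finally have "c * norm h \<le> norm (Pr L (mul F h))" using False by (simp add: power2_eq_square)
    then show ?thesis using c(1) by (simp add: field_simps)
  qed (use c(1) in auto)
  then show ?thesis using c(1) by (intro exI[of _ "1 / c"]) simp
qed

lemma toeplitz_surj: "\<exists>h\<in>spec_space L. Pr L (mul F h) = Pr L w"
proof -
  obtain c where c: "c > 0" "\<And>x. c * (norm x)\<^sup>2 \<le> inner (mul F x) x" using F_coercive by blast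
  \<comment> \<open>The identity is added on the orthogonal complement of
    \<open>spec_space L\<close>, because \<open>coercive_imp_surj\<close> concerns operators on a
    whole space; the coercivity constant becomes \<open>min c 1\<close>.\<close>
  define T where "T x = Pr L (mul F (Pr L x)) + (x - Pr L x)" for x
  have "bounded_linear T" unfolding T_def
    by (intro bounded_linear_add bounded_linear_sub bounded_linear_ident bounded_linear_Pr
        bounded_linear_compose[OF bounded_linear_Pr] bounded_linear_compose[OF bounded_linear_mul[OF F_Linf]])
  moreover have "min c 1 * (norm x)\<^sup>2 \<le> inner (T x) x" for x
  proof -
    let ?y = "Pr L x"
    have o: "inner (x - ?y) ?y = 0" by (rule inner_diff_Pr[OF Pr])
    have o2: "inner (Pr L (mul F ?y)) (x - ?y) = 0"
      unfolding inner_commute[of _ "x - ?y"] by (rule inner_diff_Pr[OF Pr])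
    have x: "x = ?y + (x - ?y)" by simp
    have n: "(norm x)\<^sup>2 = (norm ?y)\<^sup>2 + (norm (x - ?y))\<^sup>2"
      unfolding power2_norm_eq_inner
      by (subst (1 2) x) (simp only: inner_add_left inner_add_right o inner_commute[of ?y "x - ?y"])
    have "min c 1 * (norm x)\<^sup>2 \<le> c * (norm ?y)\<^sup>2 + 1 * (norm (x - ?y))\<^sup>2"
      unfolding n distrib_left by (intro add_mono mult_right_mono) auto
    also have "\<dots> \<le> inner (mul F ?y) ?y + inner (x - ?y) (x - ?y)"
      using c(2) by (simp add: power2_norm_eq_inner)
    also have "inner (mul F ?y) ?y = inner (Pr L (mul F ?y)) ?y" by (simp add: inner_Pr_left Pr)
    also have "\<dots> = inner (Pr L (mul F ?y)) x" using o2 by (simp add: inner_diff_right)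
    also have "inner (x - ?y) (x - ?y) = inner (x - ?y) x" using o by (simp add: inner_diff_right)
    finally show ?thesis by (simp add: T_def inner_add_left)
  qed
  ultimately obtain x where x: "T x = Pr L w" using coercive_imp_surj[of T "min c 1"] c(1) by auto
  have "Pr L (T x) = Pr L (mul F (Pr L x))"
    unfolding T_def linear_add[OF linear_Pr] linear_diff[OF linear_Pr] by (simp add: Pr_id Pr)
  then have "Pr L (mul F (Pr L x)) = Pr L w" unfolding x by (simp add: Pr_id Pr)
  then show ?thesis using Pr by blast
qed

subsection \<open>The range of the Hankel operator\<close>

text \<open>The Hankel operator is \<open>\<theta> \<mapsto> Vadj (V \<theta>)\<close>, and \<open>\<gamma> q = Vadj (q / cnj (g 0))\<close>.\<close>

definition V :: "(nat \<Rightarrow> l2) \<Rightarrow> l2" where "V \<theta> = (\<Sum>i<p. mul (Phi g i) (\<theta> i))"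

definition Vadj :: "l2 \<Rightarrow> nat \<Rightarrow> l2" where "Vadj w i = Pr (B i) (mul (\<lambda>t. cnj (Phi g i t)) w)"

text \<open>A set of families, relevant at indices below \<open>p\<close> only. The inner product of
  the Hilbert sum is written out as a finite sum where it occurs.\<close>

definition hsum :: "(nat \<Rightarrow> l2) set" where "hsum = {\<theta>. \<forall>i<p. \<theta> i \<in> spec_space (B i)}"

lemma Vadj_hsum: "Vadj w \<in> hsum"
  by (simp add: hsum_def Vadj_def Pr)

lemma Vadj_add: "i < p \<Longrightarrow> Vadj (x + y) i = Vadj x i + Vadj y i"
  by (simp add: Vadj_def linear_add[OF linear_Pr] linear_add[OF linear_mul] Linf_intros)

lemma Vadj_diff: "i < p \<Longrightarrow> Vadj (x - y) i = Vadj x i - Vadj y i"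
  by (simp add: Vadj_def linear_diff[OF linear_Pr] linear_diff[OF linear_mul] Linf_intros)

lemma V_diff: "V (\<lambda>i. \<theta> i - \<eta> i) = V \<theta> - V \<eta>"
  by (simp add: V_def linear_diff[OF linear_mul] Linf_intros sum_subtractf)

lemma inner_V: assumes "\<theta> \<in> hsum" shows "inner (V \<theta>) w = (\<Sum>i<p. inner (\<theta> i) (Vadj w i))"
  unfolding V_def inner_sum_left
proof (rule sum.cong[OF refl])
  fix i assume i: "i \<in> {..<p}"
  then have "inner (mul (Phi g i) (\<theta> i)) w = inner (mul (\<lambda>t. cnj (Phi g i t)) w) (\<theta> i)"
    unfolding inner_commute[of _ "\<theta> i"] by (simp add: inner_mul_left Linf_intros)
  also have "\<dots> = inner (\<theta> i) (Vadj w i)"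
    using assms i by (simp add: Vadj_def hsum_def inner_Pr_left inner_commute[of "\<theta> i"])
  finally show "inner (mul (Phi g i) (\<theta> i)) w = inner (\<theta> i) (Vadj w i)" .
qed

text \<open>Since cnj (Phi g i) g 0 = g i, the product that \<open>Vadj\<close> projects is g i h,
  which has no spectrum in \<open>B i\<close>.\<close>

lemma Vadj_g0: assumes i: "i < p" and h: "h \<in> spec_space L" shows "Vadj (mul (g 0) h) i = 0"
proof -
  have "AE t in T2. cnj (Phi g i t) * g 0 t = g i t"
    using g_nz[OF p_pos] by eventually_elim (simp add: Phi_def)
  then have "mul (\<lambda>t. cnj (Phi g i t)) (mul (g 0) h) = mul (g i) h"
    using i by (intro mul_mul_eq Linf_intros)
  also have "\<dots> \<in> spec_space (- B i)" using g_spec_compl[OF i] L_subset[OF i] h by blast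
  finally show ?thesis by (simp add: Vadj_def Pr_compl)
qed

text \<open>Multiplied by cnj (g 0), the identity reads: cnj (g 0) w is F h plus the sum of the cnj
  (g i) \<theta> i. The Toeplitz equation determines h so that the remainder has no spectrum in
  \<open>L\<close>; the remainder then splits over the \<open>B i\<close>, and division by cnj (g i)
  keeps each piece in its space.\<close>

lemma decompose:
  "\<exists>C>0. \<forall>w. \<exists>h\<in>spec_space L. \<exists>\<theta>\<in>hsum. w = mul (g 0) h + V \<theta>
     \<and> norm h \<le> C * norm w \<and> (\<forall>i<p. norm (\<theta> i) \<le> C * norm w)"
proof -
  obtain C0 where C0: "C0 > 0" "\<And>h. h \<in> spec_space L \<Longrightarrow> norm h \<le> C0 * norm (Pr L (mul F h))"
    using norm_le_toeplitz by blast
  obtain K1 where K1: "K1 > 0" "\<And>x. norm (mul (\<lambda>t. cnj (g 0 t)) x) \<le> norm x * K1"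
    using bounded_linear.pos_bounded[OF bounded_linear_mul[OF cnj_g_Linf[OF p_pos]]] by blast
  obtain K2 where K2: "K2 > 0" "\<And>x. norm (mul F x) \<le> norm x * K2"
    using bounded_linear.pos_bounded[OF bounded_linear_mul[OF F_Linf]] by blast
  have "\<exists>K>0. \<forall>x. norm (mul (\<lambda>t. cnj (1 / g i t)) x) \<le> norm x * K" if "i < p" for i
    using bounded_linear.pos_bounded[OF bounded_linear_mul[OF cnj_inv_Linf[OF that]]] by blast
  then obtain K3 where K3: "\<And>i. i < p \<Longrightarrow> K3 i > 0"
    "\<And>i x. i < p \<Longrightarrow> norm (mul (\<lambda>t. cnj (1 / g i t)) x) \<le> norm x * K3 i" by metis
  define K where "K = (\<Sum>i<p. K3 i)"
  have K: "K3 i \<le> K" if "i < p" for i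
    unfolding K_def using that K3(1) by (intro member_le_sum) (auto intro: less_imp_le)
  have K0: "K > 0" using K[OF p_pos] K3(1)[OF p_pos] by linarith
  \<comment> \<open>\<open>R\<close> bounds the remainder \<open>z\<close>. In \<open>C\<close> the
    first term serves h, and the second serves \<theta>, with \<open>K\<close> a common bound for
    the divisions by cnj (g i).\<close>
  define R where "R = K1 + C0 * K1 * K2"
  define C where "C = C0 * K1 + R * K"
  have R0: "R > 0" using C0(1) K1(1) K2(1) by (simp add: R_def add_pos_pos)
  have C: "C > 0" using C0(1) K1(1) R0 K0 by (simp add: C_def add_pos_pos)
  have Cge: "C0 * K1 \<le> C" "R * K \<le> C" using C0(1) K1(1) R0 K0 by (auto simp: C_def)
  have "\<exists>h\<in>spec_space L. \<exists>\<theta>\<in>hsum. w = mul (g 0) h + V \<theta>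
     \<and> norm h \<le> C * norm w \<and> (\<forall>i<p. norm (\<theta> i) \<le> C * norm w)" for w
  proof -
    define w' where "w' = mul (\<lambda>t. cnj (g 0 t)) w"
    have w': "norm w' \<le> norm w * K1" unfolding w'_def by (rule K1(2))
    obtain h where h: "h \<in> spec_space L" "Pr L (mul F h) = Pr L w'" using toeplitz_surj by blast
    have "norm h \<le> C0 * norm w'"
      using C0(2)[OF h(1)] norm_Pr_le[of L w'] C0(1) unfolding h(2)
      by (meson mult_left_mono order_trans less_imp_le)
    also have "\<dots> \<le> C0 * (norm w * K1)" using w' C0(1) by simp
    finally have hn: "norm h \<le> C0 * K1 * norm w" by (simp add: mult_ac)
    define z where "z = w' - mul F h"
    have "norm z \<le> norm w' + norm (mul F h)" unfolding z_def by (rule norm_triangle_ineq4)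
    also have "\<dots> \<le> norm w * K1 + norm h * K2" by (intro add_mono w' K2)
    also have "\<dots> \<le> norm w * K1 + (C0 * K1 * norm w) * K2" using hn K2(1) by simp
    finally have zn: "norm z \<le> R * norm w" by (simp add: R_def algebra_simps)
    have "Pr L z = 0" unfolding z_def linear_diff[OF linear_Pr] h(2) by simp
    then have "z \<in> spec_space (\<Union>i\<in>{..<p}. B i)" unfolding Pr_eq_0_iff L_eq by simp
    from spec_space_UN_decompose[OF _ this] obtain r
      where r: "\<And>i. i < p \<Longrightarrow> r i \<in> spec_space (B i)" "\<And>i. i < p \<Longrightarrow> norm (r i) \<le> norm z" "z = (\<Sum>i<p. r i)"
      by auto
    define \<theta> where "\<theta> i = mul (\<lambda>t. cnj (1 / g i t)) (r i)" for i
    have th: "\<theta> \<in> hsum" unfolding hsum_def \<theta>_def using cnj_inv_spec r(1) by blast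
    have thn: "norm (\<theta> i) \<le> C * norm w" if i: "i < p" for i
    proof -
      have "norm (\<theta> i) \<le> norm (r i) * K3 i" unfolding \<theta>_def by (rule K3(2)[OF i])
      also have "\<dots> \<le> (R * norm w) * K"
        using order_trans[OF r(2)[OF i] zn] K[OF i] K3(1)[OF i] R0 by (intro mult_mono) auto
      also have "\<dots> = (R * K) * norm w" by simp
      also have "\<dots> \<le> C * norm w" using Cge(2) by (rule mult_right_mono) simp
      finally show ?thesis .
    qed
    have inv0: "mul (\<lambda>t. cnj (1 / g 0 t)) w' = w"
    proof -
      have "AE t in T2. cnj (1 / g 0 t) * cnj (g 0 t) = 1" using g_nz[OF p_pos] by eventually_elim simp
      then show ?thesis unfolding w'_def using mul_mul_eq[OF cnj_inv_Linf[OF p_pos] cnj_g_Linf[OF p_pos] Linf_const]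
        by (simp only: mul_1)
    qed
    have invF: "mul (\<lambda>t. cnj (1 / g 0 t)) (mul F h) = mul (g 0) h"
    proof (intro mul_mul_eq Linf_intros)
      show "AE t in T2. cnj (1 / g 0 t) * F t = g 0 t" using g_nz[OF p_pos] F_eq[OF p_pos] by eventually_elim simp
    qed
    have ph: "mul (Phi g i) (\<theta> i) = mul (\<lambda>t. cnj (1 / g 0 t)) (r i)" if i: "i < p" for i
      unfolding \<theta>_def
    proof (intro mul_mul_eq Linf_intros i)
      show "AE t in T2. Phi g i t * cnj (1 / g i t) = cnj (1 / g 0 t)"
        using g_nz[OF i] by eventually_elim (simp add: Phi_def)
    qed
    have "w = mul (\<lambda>t. cnj (1 / g 0 t)) (mul F h + z)" using inv0 by (simp add: z_def)
    also have "\<dots> = mul (g 0) h + mul (\<lambda>t. cnj (1 / g 0 t)) (\<Sum>i<p. r i)"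
      unfolding linear_add[OF linear_mul[OF cnj_inv_Linf[OF p_pos]]] invF r(3)[symmetric] ..
    also have "mul (\<lambda>t. cnj (1 / g 0 t)) (\<Sum>i<p. r i) = V \<theta>"
      unfolding linear_sum[OF linear_mul[OF cnj_inv_Linf[OF p_pos]]] V_def
      by (rule sum.cong) (simp_all only: ph lessThan_iff)
    finally have dec: "w = mul (g 0) h + V \<theta>" .
    have "C0 * K1 * norm w \<le> C * norm w" using Cge(1) by (rule mult_right_mono) simp
    with hn have "norm h \<le> C * norm w" by linarith
    with h(1) th dec thn show ?thesis by blast
  qed
  with C show ?thesis by blast
qed

text \<open>In the decomposition of \<open>w\<close> the summand g 0 h is annihilated by
  \<open>Vadj\<close>, so \<open>w\<close> may be replaced by an element of the range of
  \<open>V\<close>.\<close>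

lemma range_Vadj: "\<exists>\<theta>\<in>hsum. \<forall>i<p. Vadj w i = Vadj (V \<theta>) i"
proof -
  obtain h \<theta> where h: "h \<in> spec_space L" "\<theta> \<in> hsum" "w = mul (g 0) h + V \<theta>"
    using decompose by blast
  then have "\<forall>i<p. Vadj w i = Vadj (V \<theta>) i" by (simp add: Vadj_add Vadj_g0)
  with h(2) show ?thesis by blast
qed

text \<open>The form of \<open>T\<close> is \<open>S w\<close>, the sum of the squared norms of
  \<open>Vadj w\<close> and of the projection of cnj (g 0) w. Expanding one factor of the product of
  \<open>w\<close> with itself by \<open>decompose\<close> bounds norm w by a multiple of the square
  root of \<open>S w\<close>.\<close>

lemma V_Vadj_surj: "\<exists>w. \<exists>h\<in>spec_space L. V (Vadj w) + mul (g 0) h = u"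
proof -
  define T where "T w = V (Vadj w) + mul (g 0) (Pr L (mul (\<lambda>t. cnj (g 0 t)) w))" for w
  define S where "S w = (\<Sum>i<p. (norm (Vadj w i))\<^sup>2) + (norm (Pr L (mul (\<lambda>t. cnj (g 0 t)) w)))\<^sup>2" for w
  have T: "bounded_linear T" unfolding T_def V_def Vadj_def
    by (intro bounded_linear_add bounded_linear_sum bounded_linear_Pr
        bounded_linear_compose[OF bounded_linear_mul] bounded_linear_compose[OF bounded_linear_Pr]
        bounded_linear_mul Linf_intros) (simp_all add: Linf_intros)
  have inner_T: "inner (T w) w = S w" for w
    by (simp add: T_def S_def inner_add_left inner_V[OF Vadj_hsum] power2_norm_eq_inner
        inner_mul_left[OF g_Linf[OF p_pos]] inner_Pr_left Pr inner_commute[of "Pr _ _" "mul _ _"])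
  obtain C where C: "C > 0" and dec: "\<And>w. \<exists>h\<in>spec_space L. \<exists>\<theta>\<in>hsum. w = mul (g 0) h + V \<theta>
     \<and> norm h \<le> C * norm w \<and> (\<forall>i<p. norm (\<theta> i) \<le> C * norm w)"
    using decompose by blast
  \<comment> \<open>One term for h and \<open>p\<close> terms for \<theta>, each at most C norm w
    times the square root of \<open>S w\<close>.\<close>
  define D where "D = C * (real p + 1)"
  have D: "D > 0" using C by (simp add: D_def add_nonneg_pos)
  have "1 / D\<^sup>2 * (norm w)\<^sup>2 \<le> inner (T w) w" for w
  proof -
    obtain h \<theta> where h: "h \<in> spec_space L" "norm h \<le> C * norm w"
      and th: "\<theta> \<in> hsum" "\<And>i. i < p \<Longrightarrow> norm (\<theta> i) \<le> C * norm w" and w: "w = mul (g 0) h + V \<theta>"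
      using dec[of w] by blast
    have S0: "S w \<ge> 0" unfolding S_def by (intro add_nonneg_nonneg sum_nonneg) auto
    have Vn: "norm (Vadj w i) \<le> sqrt (S w)" if "i < p" for i
    proof (rule real_le_rsqrt)
      have "(norm (Vadj w i))\<^sup>2 \<le> (\<Sum>i<p. (norm (Vadj w i))\<^sup>2)" using that by (intro member_le_sum) auto
      then show "(norm (Vadj w i))\<^sup>2 \<le> S w" unfolding S_def by (rule add_increasing2[rotated]) simp
    qed
    have Pn: "norm (Pr L (mul (\<lambda>t. cnj (g 0 t)) w)) \<le> sqrt (S w)"
      unfolding S_def by (intro real_le_rsqrt add_increasing sum_nonneg) auto
    have "(norm w)\<^sup>2 = inner (mul (g 0) h) w + inner (V \<theta>) w"
      unfolding power2_norm_eq_inner inner_add_left[symmetric] w[symmetric] ..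
    also have "inner (mul (g 0) h) w = inner h (Pr L (mul (\<lambda>t. cnj (g 0 t)) w))"
      by (simp only: inner_mul_left[OF g_Linf[OF p_pos]] inner_commute[of h] inner_Pr_left[OF h(1)])
    also have "\<dots> \<le> norm h * norm (Pr L (mul (\<lambda>t. cnj (g 0 t)) w))" by (rule norm_cauchy_schwarz)
    also have "\<dots> \<le> (C * norm w) * sqrt (S w)" using h(2) Pn C by (intro mult_mono) auto
    also have "inner (V \<theta>) w \<le> (\<Sum>i<p. (C * norm w) * sqrt (S w))"
      unfolding inner_V[OF th(1)]
    proof (rule sum_mono)
      fix i assume "i \<in> {..<p}"
      then have i: "i < p" by simp
      have "inner (\<theta> i) (Vadj w i) \<le> norm (\<theta> i) * norm (Vadj w i)" by (rule norm_cauchy_schwarz)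
      also have "\<dots> \<le> (C * norm w) * sqrt (S w)" using th(2)[OF i] Vn[OF i] C by (intro mult_mono) auto
      finally show "inner (\<theta> i) (Vadj w i) \<le> (C * norm w) * sqrt (S w)" .
    qed
    finally have "(norm w)\<^sup>2 \<le> norm w * (D * sqrt (S w))" by (simp add: D_def algebra_simps)
    then have "norm w \<le> D * sqrt (S w)"
      using D S0 by (cases "norm w = 0") (auto simp: power2_eq_square)
    then have "(norm w)\<^sup>2 \<le> (D * sqrt (S w))\<^sup>2" by (rule power_mono) simp
    also have "\<dots> = D\<^sup>2 * S w" using S0 by (simp add: power_mult_distrib)
    finally show ?thesis unfolding inner_T using D by (simp add: divide_le_eq mult.commute)
  qed
  then obtain w where "T w = u" using coercive_imp_surj[OF T, of "1 / D\<^sup>2"] D by auto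
  then show ?thesis unfolding T_def using Pr by blast
qed

section \<open>Existence, uniqueness and the inversion formula for classes\<close>

lemma hankel_solvable:
  "\<exists>\<theta>\<in>hsum. \<exists>\<eta>\<in>hsum. (\<forall>i<p. \<theta> i = Vadj (V \<eta>) i) \<and> (\<forall>i<p. Vadj (V \<theta>) i = Vadj u i)"
proof -
  obtain w h where w: "h \<in> spec_space L" "V (Vadj w) + mul (g 0) h = u"
    using V_Vadj_surj by blast
  have "\<forall>i<p. Vadj (V (Vadj w)) i = Vadj u i"
    unfolding w(2)[symmetric] using w(1) by (simp add: Vadj_add Vadj_g0)
  moreover obtain \<eta> where "\<eta> \<in> hsum" "\<forall>i<p. Vadj w i = Vadj (V \<eta>) i" using range_Vadj by blast
  ultimately show ?thesis using Vadj_hsum by blast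
qed

text \<open>The difference \<delta> satisfies Vadj (V \<delta>) = 0, hence V \<delta> = 0 by pairing
  with \<delta>. As \<delta> is itself a value of \<open>Vadj\<close>, its squared norm is a product
  with V \<delta> and vanishes.\<close>

lemma hankel_injective:
  assumes h: "\<theta> \<in> hsum" "\<eta> \<in> hsum" "\<theta>' \<in> hsum" "\<eta>' \<in> hsum"
    and e: "\<And>i. i < p \<Longrightarrow> \<theta> i = Vadj (V \<eta>) i" "\<And>i. i < p \<Longrightarrow> \<theta>' i = Vadj (V \<eta>') i"
    and H: "\<And>i. i < p \<Longrightarrow> Vadj (V \<theta>) i = Vadj (V \<theta>') i"
    and i: "i < p"
  shows "\<theta> i = \<theta>' i"
proof -
  define \<delta> where "\<delta> i = \<theta> i - \<theta>' i" for i
  have d: "\<delta> \<in> hsum" using h unfolding hsum_def \<delta>_def by (auto intro: subspace_diff subspace_spec_space)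
  have Vd: "V \<delta> = V \<theta> - V \<theta>'" unfolding \<delta>_def by (rule V_diff)
  have "(norm (V \<delta>))\<^sup>2 = (\<Sum>i<p. inner (\<delta> i) (Vadj (V \<delta>) i))"
    unfolding power2_norm_eq_inner by (rule inner_V[OF d])
  also have "\<dots> = 0" by (simp add: Vd Vadj_diff H)
  finally have V0: "V \<delta> = 0" by simp
  have "(\<Sum>i<p. (norm (\<delta> i))\<^sup>2) = (\<Sum>i<p. inner (\<delta> i) (Vadj (V \<eta> - V \<eta>') i))"
    by (rule sum.cong) (simp_all add: Vadj_diff e[symmetric] \<delta>_def power2_norm_eq_inner)
  also have "\<dots> = inner (V \<delta>) (V \<eta> - V \<eta>')" by (rule inner_V[OF d, symmetric])
  also have "\<dots> = 0" by (simp add: V0)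
  finally have "\<forall>i\<in>{..<p}. (norm (\<delta> i))\<^sup>2 = 0" by (subst (asm) sum_nonneg_eq_0_iff) auto
  then show ?thesis using i by (simp add: \<delta>_def)
qed

text \<open>The equation says that \<open>Vadj\<close> annihilates \<open>u\<close>. Dividing cnj
  (Phi g i) u by g i gives u / g 0 for every i, so the single function \<open>h\<close> has no
  spectrum in any \<open>B i\<close>. Moreover F h = cnj (g 0) u is \<open>q\<close> minus the sum
  of the cnj (g i) \<theta> i, and these terms have no spectrum in \<open>L\<close>.\<close>

lemma inversion:
  assumes th: "\<theta> \<in> hsum" and q: "q \<in> spec_space L"
    and H: "\<And>i. i < p \<Longrightarrow> Vadj (V \<theta>) i = Vadj (mul (\<lambda>t. cnj (1 / g 0 t)) q) i"
  defines "h \<equiv> mul (\<lambda>t. 1 / g 0 t) (mul (\<lambda>t. cnj (1 / g 0 t)) q - V \<theta>)"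
  shows "h \<in> spec_space L" "Pr L (mul F h) = q"
proof -
  define u where "u = mul (\<lambda>t. cnj (1 / g 0 t)) q - V \<theta>"
  show "h \<in> spec_space L"
  proof (rule spec_space_L_I)
    fix i assume i: "i < p"
    have "Vadj u i = 0" unfolding u_def using H[OF i] by (simp add: Vadj_diff i)
    then have "mul (\<lambda>t. cnj (Phi g i t)) u \<in> spec_space (- B i)" unfolding Vadj_def Pr_eq_0_iff .
    then have "mul (\<lambda>t. 1 / g i t) (mul (\<lambda>t. cnj (Phi g i t)) u) \<in> spec_space (- B i)"
      by (rule inv_spec_compl[OF i])
    moreover have "AE t in T2. 1 / g i t * cnj (Phi g i t) = 1 / g 0 t"
      using g_nz[OF i] by eventually_elim (simp add: Phi_def)
    then have "mul (\<lambda>t. 1 / g i t) (mul (\<lambda>t. cnj (Phi g i t)) u) = h"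
      unfolding h_def u_def[symmetric] using i by (intro mul_mul_eq Linf_intros)
    ultimately show "h \<in> spec_space (- B i)" by simp
  qed
  have 0: "mul F h = mul (\<lambda>t. cnj (g 0 t)) u"
    unfolding h_def u_def[symmetric]
  proof (intro mul_mul_eq Linf_intros)
    show "AE t in T2. F t * (1 / g 0 t) = cnj (g 0 t)"
      using g_nz[OF p_pos] F_eq[OF p_pos] by eventually_elim simp
  qed
  have 1: "mul (\<lambda>t. cnj (g 0 t)) (mul (\<lambda>t. cnj (1 / g 0 t)) q) = q"
  proof -
    have "AE t in T2. cnj (g 0 t) * cnj (1 / g 0 t) = 1" using g_nz[OF p_pos] by eventually_elim simp
    then show ?thesis using mul_mul_eq[OF cnj_g_Linf[OF p_pos] cnj_inv_Linf[OF p_pos] Linf_const]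
      by (simp only: mul_1)
  qed
  have 2: "mul (\<lambda>t. cnj (g 0 t)) (V \<theta>) = (\<Sum>i<p. mul (\<lambda>t. cnj (g i t)) (\<theta> i))"
    unfolding V_def linear_sum[OF linear_mul[OF cnj_g_Linf[OF p_pos]]]
  proof (rule sum.cong[OF refl])
    fix i assume "i \<in> {..<p}"
    then have i: "i < p" by simp
    have "AE t in T2. cnj (g 0 t) * Phi g i t = cnj (g i t)"
      using g_nz[OF p_pos] by eventually_elim (simp add: Phi_def)
    then show "mul (\<lambda>t. cnj (g 0 t)) (mul (Phi g i) (\<theta> i)) = mul (\<lambda>t. cnj (g i t)) (\<theta> i)"
      using i by (intro mul_mul_eq Linf_intros)
  qed
  have 3: "Pr L (mul (\<lambda>t. cnj (g i t)) (\<theta> i)) = 0" if i: "i < p" for i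
  proof -
    have "mul (\<lambda>t. cnj (g i t)) (\<theta> i) \<in> spec_space (B i)"
      using th i cnj_g_spec by (simp add: hsum_def)
    also have "spec_space (B i) \<subseteq> spec_space (- L)" using i L_eq by (intro spec_space_mono) auto
    finally show ?thesis by (rule Pr_compl)
  qed
  have "mul F h = q - (\<Sum>i<p. mul (\<lambda>t. cnj (g i t)) (\<theta> i))"
    unfolding 0 u_def linear_diff[OF linear_mul[OF cnj_g_Linf[OF p_pos]]] 1 2 ..
  then show "Pr L (mul F h) = q"
    by (simp add: linear_diff[OF linear_Pr] linear_sum[OF linear_Pr] 3 Pr_id q)
qed

end

section \<open>Lattice polygons\<close>

text \<open>In the plane the orthogonal complement of \<open>d\<close> is the line through
  \<open>d\<close> rotated by a quarter turn.\<close>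

lemma plane_orthogonal_eq:
  fixes a d :: "real \<times> real"
  assumes "d \<noteq> 0" "inner a d = 0" obtains c where "a = c *\<^sub>R (- snd d, fst d)"
proof
  \<comment> \<open>\<open>N\<close> is the squared norm of \<open>d\<close>, and \<open>K\<close>
    is the inner product of \<open>a\<close> with the rotated \<open>d\<close>.\<close>
  define N where "N = (fst d)\<^sup>2 + (snd d)\<^sup>2"
  define K where "K = snd a * fst d - fst a * snd d"
  have N: "N \<noteq> 0"
    using assms(1) unfolding N_def by (simp add: prod_eq_iff sum_power2_eq_zero_iff)
  have o: "fst a * fst d + snd a * snd d = 0" using assms(2) by (simp add: inner_prod_def)
  have "fst a * N = K * (- snd d) + (fst a * fst d + snd a * snd d) * fst d"
    by (simp add: N_def K_def algebra_simps power2_eq_square)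
  then have 1: "fst a = K * (- snd d) / N" unfolding o using N by (simp add: field_simps)
  have "snd a * N = K * fst d + (fst a * fst d + snd a * snd d) * snd d"
    by (simp add: N_def K_def algebra_simps power2_eq_square)
  then have 2: "snd a = K * fst d / N" unfolding o using N by (simp add: field_simps)
  show "a = (K / N) *\<^sub>R (- snd d, fst d)"
    by (rule prod_eqI) (simp_all add: 1 2)
qed

text \<open>Of three distinct collinear points one lies in the open segment between the other two,
  which is impossible for an extreme point.\<close>

lemma extreme_points_not_collinear:
  fixes x y z :: "'a::euclidean_space"
  assumes e: "x extreme_point_of S" "y extreme_point_of S" "z extreme_point_of S"
    and neq: "x \<noteq> y" "y \<noteq> z" "x \<noteq> z"
  shows "\<not> collinear {x, y, z}"
proof
  assume "collinear {x, y, z}"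
  then consider "x \<in> closed_segment y z" | "y \<in> closed_segment z x" | "z \<in> closed_segment x y"
    unfolding collinear_between_cases between_mem_segment by blast
  then show False
  proof cases
    case 1
    then have "x \<in> open_segment y z" using neq by (simp add: open_segment_def)
    then show False using e unfolding extreme_point_of_def by blast
  next
    case 2
    then have "y \<in> open_segment z x" using neq by (simp add: open_segment_def)
    then show False using e unfolding extreme_point_of_def by blast
  next
    case 3
    then have "z \<in> open_segment x y" using neq by (simp add: open_segment_def)
    then show False using e unfolding extreme_point_of_def by blast
  qed
qed

text \<open>Collects the witnesses for the description in \<open>half_plane\<close>, with the normal
  vector kept explicit.\<close>

definition supporting_line :: "nat \<Rightarrow> (nat \<Rightarrow> nat \<times> nat) \<Rightarrow> nat \<Rightarrow> real \<times> real \<Rightarrow> real \<Rightarrow> bool" where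
  "supporting_line m A i a b \<longleftrightarrow> a \<noteq> 0 \<and> polygon m A \<subseteq> {x. inner a x \<le> b} \<and> side_line m A i = {x. inner a x = b}"

section \<open>Sides and half-planes of a convex polygon\<close>

context
  fixes m :: nat and A :: "nat \<Rightarrow> nat \<times> nat"
  assumes polygon: "convex_polygon m A"
begin

lemma m_ge_3: "3 \<le> m"
  using polygon by (simp add: convex_polygon_def)

lemma Suc_mod_less: "Suc i mod m < m"
  using m_ge_3 by simp

lemma Suc_mod_neq: "i < m \<Longrightarrow> Suc i mod m \<noteq> i"
  using m_ge_3 by (cases "Suc i = m") auto

lemma Suc_Suc_mod_neq: assumes "i < m" shows "Suc (Suc i mod m) mod m \<noteq> i"
  using m_ge_3 assms by (cases "Suc i = m"; cases "Suc (Suc i) = m") auto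

lemma vertex_eq_iff: "i < m \<Longrightarrow> j < m \<Longrightarrow> vertex A i = vertex A j \<longleftrightarrow> i = j"
  using polygon by (auto simp: convex_polygon_def vertex_def prod_eq_iff inj_on_def)

lemma vertex_extreme: "i < m \<Longrightarrow> vertex A i extreme_point_of polygon m A"
  using polygon by (auto simp: convex_polygon_def)

lemma vertex_in_polygon: "i < m \<Longrightarrow> vertex A i \<in> polygon m A"
  using vertex_extreme by (auto simp: extreme_point_of_def)

lemma vertex_not_in_side_line:
  assumes "i < m" "j < m" "j \<noteq> i" "j \<noteq> Suc i mod m" shows "vertex A j \<notin> side_line m A i"
proof
  assume "vertex A j \<in> side_line m A i"
  then have "{vertex A i, vertex A (Suc i mod m), vertex A j} \<subseteq> affine hull {vertex A i, vertex A (Suc i mod m)}"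
    unfolding side_line_def using hull_subset[of "{vertex A i, vertex A (Suc i mod m)}" affine] by auto
  then have "collinear {vertex A i, vertex A (Suc i mod m), vertex A j}"
    unfolding collinear_affine_hull by blast
  moreover have "\<not> collinear {vertex A i, vertex A (Suc i mod m), vertex A j}"
    using assms Suc_mod_less Suc_mod_neq[OF assms(1)] Suc_mod_neq[OF assms(1), symmetric] vertex_eq_iff
    by (intro extreme_points_not_collinear[of _ "polygon m A"] vertex_extreme) auto
  ultimately show False by simp
qed

lemma other_vertex: assumes "i < m"
  obtains j where "j < m" "j \<noteq> i" "j \<noteq> Suc i mod m"
  using Suc_mod_less Suc_Suc_mod_neq[OF assms] Suc_mod_neq[OF Suc_mod_less, of i] by blast

lemma side_line_eq_hyperplane:
  assumes i: "i < m" and a: "a \<noteq> 0" "inner a (vertex A i) = b" "inner a (vertex A (Suc i mod m)) = b"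
  shows "side_line m A i = {x. inner a x = b}"
proof -
  let ?p = "vertex A i" and ?q = "vertex A (Suc i mod m)"
  have "x \<in> side_line m A i" if x: "inner a x = b" for x
  proof -
    have "inner (?q - ?p) a = 0" "inner (x - ?p) a = 0"
      using a x by (simp_all add: inner_commute[of _ a] inner_diff_right)
    then obtain c e where c: "?q - ?p = c *\<^sub>R (- snd a, fst a)" and e: "x - ?p = e *\<^sub>R (- snd a, fst a)"
      using plane_orthogonal_eq[OF a(1)] by metis
    have "?q \<noteq> ?p" using vertex_eq_iff[OF Suc_mod_less i] Suc_mod_neq[OF i] by simp
    have c0: "c \<noteq> 0"
    proof
      assume "c = 0"
      then have "?q - ?p = 0" unfolding c by (rule scaleR_eq_0_iff[THEN iffD2, OF disjI1])
      then show False using \<open>?q \<noteq> ?p\<close> by (simp only: right_minus_eq)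
    qed
    have "x = ?p + (e / c) *\<^sub>R (?q - ?p)" unfolding c using e c0 by (simp add: algebra_simps)
    then have "x = (1 - e / c) *\<^sub>R ?p + (e / c) *\<^sub>R ?q" by (simp add: algebra_simps)
    then show ?thesis unfolding side_line_def affine_hull_2 by (intro CollectI exI conjI) auto
  qed
  moreover have "inner a x = b" if "x \<in> side_line m A i" for x
    using that a unfolding side_line_def affine_hull_2
    by (auto simp: inner_add_right simp flip: distrib_right)
  ultimately show ?thesis by blast
qed

lemma ex_supporting_half_plane:
  assumes i: "i < m"
  shows "\<exists>a b. supporting_line m A i a b"
proof -
  let ?F = "closed_segment (vertex A i) (vertex A (Suc i mod m))"
  have "?F face_of polygon m A" using polygon i by (auto simp: convex_polygon_def edge_of_def)
  then have "?F exposed_face_of polygon m A"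
    unfolding polygon_def by (subst exposed_face_of_polyhedron) (auto intro: polyhedron_convex_hull)
  \<comment> \<open>\<open>exposed_face_of\<close> yields a nonzero normal only for a nonempty
    proper face; a third vertex shows that the side is proper.\<close>
  moreover have "?F \<noteq> polygon m A"
  proof
    assume F: "?F = polygon m A"
    obtain j where j: "j < m" "j \<noteq> i" "j \<noteq> Suc i mod m" using other_vertex[OF i] .
    have "vertex A j \<in> ?F" using vertex_in_polygon[OF j(1)] F by simp
    then have "vertex A j \<in> side_line m A i"
      unfolding side_line_def segment_convex_hull using convex_hull_subset_affine_hull by blast
    then show False using vertex_not_in_side_line[OF i j] by simp
  qed
  ultimately obtain a b where ab: "a \<noteq> 0" "polygon m A \<subseteq> {x. inner a x \<le> b}" "?F = polygon m A \<inter> {x. inner a x = b}"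
    unfolding exposed_face_of by auto
  have "vertex A i \<in> ?F" "vertex A (Suc i mod m) \<in> ?F" by auto
  then have "inner a (vertex A i) = b" "inner a (vertex A (Suc i mod m)) = b" using ab(3) by auto
  from side_line_eq_hyperplane[OF i ab(1) this] have "supporting_line m A i a b"
    using ab(1,2) by (simp add: supporting_line_def)
  then show ?thesis by blast
qed

text \<open>Both normals are orthogonal to the side, hence proportional, and the polygon fixes the
  sign of the factor. This is the uniqueness behind the \<open>THE\<close> in
  \<open>half_plane\<close>.\<close>

lemma half_plane_unique:
  assumes i: "i < m"
    and a: "polygon m A \<subseteq> {x. inner a x \<le> b}" "side_line m A i = {x. inner a x = b}" "a \<noteq> 0"
    and a': "polygon m A \<subseteq> {x. inner a' x \<le> b'}" "side_line m A i = {x. inner a' x = b'}" "a' \<noteq> 0"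
  shows "{x. inner a x \<le> b} = {x. inner a' x \<le> b'}"
proof -
  let ?p = "vertex A i" and ?q = "vertex A (Suc i mod m)"
  have pq: "?p \<in> side_line m A i" "?q \<in> side_line m A i"
    unfolding side_line_def by (auto intro: hull_inc)
  have b: "inner a ?p = b" "inner a ?q = b" "inner a' ?p = b'" "inner a' ?q = b'"
    using pq a(2) a'(2) by auto
  have "?q \<noteq> ?p" using vertex_eq_iff[OF Suc_mod_less i] Suc_mod_neq[OF i] by simp
  then have d: "?q - ?p \<noteq> 0" by simp
  obtain c where c: "a = c *\<^sub>R (- snd (?q - ?p), fst (?q - ?p))"
    using plane_orthogonal_eq[OF d, of a] b by (auto simp: inner_diff_right)
  obtain c' where c': "a' = c' *\<^sub>R (- snd (?q - ?p), fst (?q - ?p))"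
    using plane_orthogonal_eq[OF d, of a'] b by (auto simp: inner_diff_right)
  have c0: "c \<noteq> 0" using a(3) unfolding c by (simp only: scaleR_eq_0_iff de_Morgan_disj simp_thms)
  define r where "r = c' / c"
  have r: "a' = r *\<^sub>R a" unfolding c c' r_def using c0 by (simp only: scaleR_scaleR nonzero_eq_divide_eq[symmetric] nonzero_divide_eq_eq) simp
  \<comment> \<open>A vertex off the line makes both inequalities strict, which forces
    \<open>r\<close> to be positive.\<close>
  obtain j where j: "j < m" "j \<noteq> i" "j \<noteq> Suc i mod m" using other_vertex[OF i] .
  have nj: "vertex A j \<notin> side_line m A i" by (rule vertex_not_in_side_line[OF i j])
  have vj: "vertex A j \<in> polygon m A" by (rule vertex_in_polygon[OF j(1)])
  have "inner a (vertex A j) < b" "inner a' (vertex A j) < b'"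
    using nj vj a(1,2) a'(1,2) by (auto simp: order_less_le)
  then have less: "r * inner a (vertex A j) < r * b" "inner a (vertex A j) < b"
    using b(1,3) by (simp_all add: r)
  have "r > 0"
  proof (rule ccontr)
    assume "\<not> r > 0"
    then have "r * b \<le> r * inner a (vertex A j)" using less(2) by (intro mult_left_mono_neg) simp_all
    then show False using less(1) by simp
  qed
  moreover have "b' = r * b" using b(1,3) by (simp add: r)
  ultimately show ?thesis by (auto simp: r)
qed

lemma half_plane_eq:
  assumes i: "i < m" and ab: "supporting_line m A i a b"
  shows "half_plane m A i = {x. inner a x \<le> b}"
  unfolding half_plane_def
proof (rule the_equality, goal_cases)
  case 1
  have "\<exists>b'. a \<noteq> 0 \<and> {x. inner a x \<le> b} = {x. inner a x \<le> b'} \<and> side_line m A i = {x. inner a x = b'}"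
    using ab unfolding supporting_line_def by (intro exI[of _ b]) simp
  then have "\<exists>a' b'. a' \<noteq> 0 \<and> {x. inner a x \<le> b} = {x. inner a' x \<le> b'} \<and> side_line m A i = {x. inner a' x = b'}"
    by (rule exI[of _ a])
  then show ?case using ab unfolding supporting_line_def by simp
next
  case (2 S)
  then show ?case
  proof (elim conjE exE, goal_cases)
    case (1 a' b')
    then have "supporting_line m A i a' b'" by (simp add: supporting_line_def)
    then show ?case using ab half_plane_unique[OF i] unfolding 1 supporting_line_def by simp
  qed
qed

text \<open>A linear form that separates a point from the polygon is minimal on the polygon at a vertex
  \<open>A i\<close>, hence also on the cone at \<open>A i\<close> bounded by the two sides through it.\<close>

lemma polygon_half_planes:
  obtains a b where "\<And>i. i < m \<Longrightarrow> half_plane m A i = {x. inner (a i) x \<le> b i}"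
    and "\<And>i. i < m \<Longrightarrow> inner (a i) (vertex A i) = b i"
    and "\<And>x. x \<in> polygon m A \<longleftrightarrow> (\<forall>i<m. inner (a i) x \<le> b i)"
proof -
  obtain a b where ab: "\<And>i. i < m \<Longrightarrow> supporting_line m A i (a i) (b i)"
    using ex_supporting_half_plane by metis
  then have hp: "\<And>i. i < m \<Longrightarrow> half_plane m A i = {x. inner (a i) x \<le> b i}"
    and sub: "\<And>i. i < m \<Longrightarrow> polygon m A \<subseteq> {x. inner (a i) x \<le> b i}"
    and sl: "\<And>i. i < m \<Longrightarrow> side_line m A i = {x. inner (a i) x = b i}"
    using half_plane_eq by (simp_all add: supporting_line_def)
  have on1: "inner (a i) (vertex A i) = b i" and on2: "inner (a i) (vertex A (Suc i mod m)) = b i" if "i < m" for i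
    using sl[OF that] hull_inc[of _ "{vertex A i, vertex A (Suc i mod m)}" affine] unfolding side_line_def by auto
  have off: "inner (a i) (vertex A j) < b i" if "i < m" "j < m" "j \<noteq> i" "j \<noteq> Suc i mod m" for i j
    using vertex_not_in_side_line[OF that] vertex_in_polygon[OF that(2)] sub[OF that(1)] sl[OF that(1)]
    by (auto simp: order_less_le)
  have "x \<in> polygon m A" if x: "\<And>i. i < m \<Longrightarrow> inner (a i) x \<le> b i" for x
  proof (rule ccontr)
    assume notin: "x \<notin> polygon m A"
    have cc: "convex (polygon m A)" "closed (polygon m A)"
      unfolding polygon_def by (auto intro: compact_imp_closed finite_imp_compact_convex_hull)
    obtain n \<beta> where n: "inner n x < \<beta>" "\<And>y. y \<in> polygon m A \<Longrightarrow> \<beta> < inner n y"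
      using separating_hyperplane_closed_point[OF cc notin] by metis
    define N where "N i = inner n (vertex A i)" for i
    have "finite (N ` {..<m})" "N ` {..<m} \<noteq> {}" using m_ge_3 by (auto simp: lessThan_empty_iff)
    then obtain i where i: "i < m" "N i = Min (N ` {..<m})"
      using Min_in[of "N ` {..<m}"] by (metis imageE lessThan_iff)
    have min: "N i \<le> N j" if "j < m" for j using i that by simp
    \<comment> \<open>The cyclic predecessor of \<open>i\<close>; the case \<open>i = 0\<close>
      avoids truncated subtraction.\<close>
    define h where "h = (if i = 0 then m - 1 else i - 1)"
    define k where "k = Suc i mod m"
    have hi: "h < m" "Suc h mod m = i" using m_ge_3 i(1) by (auto simp: h_def)
    have k: "k < m" "k \<noteq> i" using Suc_mod_less Suc_mod_neq[OF i(1)] by (auto simp: k_def)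
    have hk: "h \<noteq> i" "h \<noteq> k"
      using hi Suc_mod_neq[OF hi(1)] Suc_Suc_mod_neq[OF hi(1)] by (auto simp: k_def)
    define u v w where "u = vertex A h - vertex A i" and "v = vertex A k - vertex A i" and "w = x - vertex A i"
    \<comment> \<open>The form of each of the two sides vanishes along its own edge and is negative
      along the other. This gives the signs of the coordinates of \<open>w\<close> in the basis
      \<open>u\<close>, \<open>v\<close>.\<close>
    have iv: "inner (a i) v = 0" using on1[OF i(1)] on2[OF i(1)] by (simp add: v_def k_def inner_diff_right)
    have iu: "inner (a i) u < 0"
      using off[OF i(1) hi(1)] hk on1[OF i(1)] by (simp add: u_def k_def inner_diff_right)
    have hv: "inner (a h) v < 0"
      using off[OF hi(1) k(1)] hk k(2) on2[OF hi(1)] hi(2) by (simp add: v_def inner_diff_right)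
    have hu: "inner (a h) u = 0" using on1[OF hi(1)] on2[OF hi(1)] hi(2) by (simp add: u_def inner_diff_right)
    have iw: "inner (a i) w \<le> 0" using x[OF i(1)] on1[OF i(1)] by (simp add: w_def inner_diff_right)
    have hw: "inner (a h) w \<le> 0" using x[OF hi(1)] on2[OF hi(1)] hi(2) by (simp add: w_def inner_diff_right)
    define D where "D = fst u * snd v - snd u * fst v"
    have "v \<noteq> 0" using hv by auto
    then obtain c where c: "a i = c *\<^sub>R (- snd v, fst v)" using plane_orthogonal_eq iv by blast
    have "inner (a i) u = - c * D" unfolding c D_def by (simp add: inner_prod_def algebra_simps)
    then have D: "D \<noteq> 0" using iu by auto
    \<comment> \<open>Cramer's rule for w = s u + t v, with determinant \<open>D\<close>.\<close>
    define s t where "s = (fst w * snd v - snd w * fst v) / D" and "t = (fst u * snd w - snd u * fst w) / D"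
    have "D *\<^sub>R w = (fst w * snd v - snd w * fst v) *\<^sub>R u + (fst u * snd w - snd u * fst w) *\<^sub>R v"
      by (simp add: prod_eq_iff D_def algebra_simps)
    then have "(1 / D) *\<^sub>R (D *\<^sub>R w) = s *\<^sub>R u + t *\<^sub>R v"
      by (simp add: s_def t_def scaleR_add_right)
    then have w: "w = s *\<^sub>R u + t *\<^sub>R v" using D by simp
    have "s * inner (a i) u \<le> 0" using iw iv by (simp add: w inner_add_right)
    then have s: "s \<ge> 0" using iu by (simp add: mult_le_0_iff)
    have "t * inner (a h) v \<le> 0" using hw hu by (simp add: w inner_add_right)
    then have t: "t \<ge> 0" using hv by (simp add: mult_le_0_iff)
    have "inner n u \<ge> 0" "inner n v \<ge> 0"
      using min[OF hi(1)] min[OF k(1)] by (auto simp: N_def u_def v_def inner_diff_right)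
    then have "inner n w \<ge> 0" using s t by (simp add: w inner_add_right)
    then have "inner n x \<ge> inner n (vertex A i)" by (simp add: w_def inner_diff_right)
    then show False using n(1) n(2)[OF vertex_in_polygon[OF i(1)]] by simp
  qed
  moreover have "inner (a i) x \<le> b i" if "x \<in> polygon m A" "i < m" for x i
    using sub[OF that(2)] that(1) by auto
  ultimately have "x \<in> polygon m A \<longleftrightarrow> (\<forall>i<m. inner (a i) x \<le> b i)" for x by metis
  with hp on1 show thesis by (rule that)
qed

lemma lattice_polygon_eq_Compl: "lattice_polygon m A = - (\<Union>i<m. S_minus m A i)"
proof -
  obtain a b where hp: "\<And>i. i < m \<Longrightarrow> half_plane m A i = {x. inner (a i) x \<le> b i}"
    and "\<And>i. i < m \<Longrightarrow> inner (a i) (vertex A i) = b i"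
    and P: "\<And>x. x \<in> polygon m A \<longleftrightarrow> (\<forall>i<m. inner (a i) x \<le> b i)"
    by (rule polygon_half_planes) (rule that)
  show ?thesis
    by (rule set_eqI) (auto simp: lattice_polygon_def S_minus_def hp P)
qed

text \<open>The assumption on \<open>- l\<close> makes the linear form of the side nonnegative at
  \<open>l\<close>, so adding \<open>l\<close> keeps a point strictly outside. The sign is there
  because conjugation reflects spectra.\<close>

lemma S_minus_add:
  assumes i: "i < m" and k: "k \<in> S_minus m A i" and l: "- l \<in> S_plus0 m A i"
  shows "k + l \<in> S_minus m A i"
proof -
  obtain a b where hp: "\<And>i. i < m \<Longrightarrow> half_plane m A i = {x. inner (a i) x \<le> b i}"
    and v: "\<And>i. i < m \<Longrightarrow> inner (a i) (vertex A i) = b i"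
    and "\<And>x. x \<in> polygon m A \<longleftrightarrow> (\<forall>i<m. inner (a i) x \<le> b i)"
    by (rule polygon_half_planes) (rule that)
  obtain y where y: "inner (a i) y \<le> b i" "ipt (- l) = y - vertex A i"
    using l unfolding S_plus0_def hp[OF i] by (simp add: image_iff) blast
  have "inner (a i) (ipt (- l)) \<le> 0" unfolding y(2) using y(1) v[OF i] by (simp add: inner_diff_right)
  then have "inner (a i) (ipt l) \<ge> 0" by (simp add: ipt_def inner_prod_def)
  moreover have "inner (a i) (ipt k) > b i" using k by (simp add: S_minus_def hp[OF i])
  moreover have "ipt (k + l) = ipt k + ipt l" by (simp add: ipt_def)
  ultimately show ?thesis by (simp add: S_minus_def hp[OF i] inner_add_right)
qed

end

section \<open>The inversion formula\<close>

text \<open>Measurability of \<open>h\<close> is a separate assumption: \<open>T2\<close> carries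
  only Borel sets, and a change on a null set can destroy Borel measurability.\<close>

lemma L2_cong: assumes "g \<in> L2" "h \<in> borel_measurable T2" "aeq g h" shows "h \<in> L2"
proof (rule L2_I)
  note [measurable] = L2_measurable[OF assms(1)] assms(2)
  show "integrable T2 (\<lambda>x. (cmod (h x))\<^sup>2)"
    using L2_integrable[OF assms(1)]
    by (rule integrable_cong_AE_imp) (use assms(3) in \<open>auto simp: aeq_def elim!: eventually_mono\<close>)
qed (rule assms(2))

lemma Linf_cong: assumes "g \<in> Linf" "h \<in> borel_measurable T2" "aeq g h" shows "h \<in> Linf"
proof -
  obtain C where "AE x in T2. cmod (g x) \<le> C" using assms(1) by (auto simp: Linf_def)
  then have "AE x in T2. cmod (h x) \<le> C" using assms(3) unfolding aeq_def by eventually_elim simp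
  then show ?thesis using assms(2) by (auto simp: Linf_def)
qed

lemma cls_eqI: "g \<in> L2 \<Longrightarrow> h \<in> borel_measurable T2 \<Longrightarrow> aeq g h \<Longrightarrow> cls h = cls g"
  using cls_eq_iff[of h g] L2_cong aeq_sym by blast

text \<open>Returns from classes to functions: each operator of the definitions is identified by its
  effect on classes.\<close>

locale hankel_toeplitz = hankel_setting p B L g "\<lambda>x. complex_of_real (f x)"
  for p B L g and f :: "complex \<times> complex \<Rightarrow> real"
begin

abbreviation F :: tfun where "F \<equiv> \<lambda>x. complex_of_real (f x)"

lemma toeplitz_PS: assumes "q \<in> L2"
  shows "toeplitz L f q \<in> PS L" "cls (toeplitz L f q) = Pr L (mul F (cls q))"
  using proj_PS[OF Linf_mult_L2[OF F_Linf assms], of L]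
  by (auto simp: toeplitz_def mul_cls F_Linf assms)

lemma toeplitz_inj:
  assumes "h \<in> spec_space L" "h' \<in> spec_space L" "Pr L (mul F h) = Pr L (mul F h')" shows "h = h'"
proof -
  obtain C where "\<And>h. h \<in> spec_space L \<Longrightarrow> norm h \<le> C * norm (Pr L (mul F h))"
    using norm_le_toeplitz by blast
  from this[of "h - h'"] show ?thesis
    using assms by (simp add: subspace_diff subspace_spec_space linear_diff[OF linear_Pr] linear_diff[OF linear_mul] F_Linf)
qed

lemma invertible_toeplitz: "invertible_op (PS L) (toeplitz L f)"
proof -
  obtain K where K: "\<And>y. K y \<in> spec_space L" "\<And>y. Pr L (mul F (K y)) = Pr L y"
    using toeplitz_surj by metis
  obtain C where C: "\<And>h. h \<in> spec_space L \<Longrightarrow> norm h \<le> C * norm (Pr L (mul F h))"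
    using norm_le_toeplitz by blast
  \<comment> \<open>\<open>S\<close> depends on the class of \<open>q\<close> only, so almost
    everywhere equal arguments give the same function.\<close>
  define S where "S q = rep_l2 (K (cls q))" for q
  have S: "S q \<in> L2" "cls (S q) = K (cls q)" "S q \<in> PS L" for q
    by (auto simp: S_def rep_L2 PS_iff K)
  show ?thesis unfolding invertible_op_def
  proof (intro conjI exI[of _ S] exI[of _ C] ballI impI)
    show "toeplitz L f h \<in> PS L" if "h \<in> PS L" for h using that toeplitz_PS PS_L2 by blast
    fix q assume q: "q \<in> PS L"
    note Tq = toeplitz_PS[OF PS_L2[OF q]]
    show "S q \<in> PS L" by (rule S)
    have q': "cls q \<in> spec_space L" using q by (simp add: PS_iff)
    have "cls (toeplitz L f (S q)) = cls q"
      using toeplitz_PS(2)[OF S(1)] by (simp add: S(2) K(2) Pr_id q')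
    then show "aeq (toeplitz L f (S q)) q"
      using cls_eq_iff toeplitz_PS(1)[OF S(1)] q PS_L2 by blast
    have "K (cls (toeplitz L f q)) = cls q"
      by (rule toeplitz_inj) (simp_all add: K q' Tq Pr_id Pr)
    then show "aeq (S (toeplitz L f q)) q"
      using cls_eq_iff[OF S(1) PS_L2[OF q]] S(2) by simp
    show "l2norm (S q) \<le> C * l2norm q"
      using C[OF K(1), of "cls q"] by (simp add: K(2) Pr_id q' S(1,2) PS_L2[OF q] flip: norm_cls)
    show "aeq (S q) (S r)" if "r \<in> PS L" "aeq q r" for r
    proof -
      have "cls q = cls r" using cls_eq_iff PS_L2 q that by blast
      then show ?thesis by (simp add: S_def)
    qed
  qed
qed

text \<open>Since |g i|^2 = f = |g 0|^2, the function \<open>Phi g i\<close> is unimodular and its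
  conjugate is its inverse. This turns the quotients in the Hankel entries into the products that
  occur in Vadj composed with V.\<close>

lemma Phi_quotient: assumes "i < p" "j < p"
  shows "AE t in T2. cnj (Phi g i t) * Phi g j t = Phi g j t / Phi g i t"
  using g_nz[OF assms(1)] g_nz[OF p_pos] F_eq[OF assms(1)] F_eq[OF p_pos]
proof eventually_elim
  case (elim t)
  then have "Phi g i t \<noteq> 0" by (simp add: Phi_def)
  moreover have "cnj (Phi g i t) * Phi g i t = 1"
    using elim by (simp add: Phi_def mult.commute)
  ultimately show ?case by (simp add: field_simps)
qed

section \<open>The Hankel equation for functions\<close>

lemma hankel_entry_PS:
  assumes i: "i < p" and j: "j < p" and x: "x \<in> L2"
  shows "hankel_entry B g i j x \<in> PS (B i)"
    "cls (hankel_entry B g i j x) = Pr (B i) (mul (\<lambda>t. cnj (Phi g i t)) (mul (Phi g j) (cls x)))"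
proof -
  note [measurable] = Phi_Linf[THEN Linf_measurable, OF i] Phi_Linf[THEN Linf_measurable, OF j] L2_measurable[OF x]
  have 1: "(\<lambda>t. cnj (Phi g i t) * (Phi g j t * x t)) \<in> L2"
    using i j x by (intro Linf_mult_L2 Linf_intros)
  have 2: "aeq (\<lambda>t. cnj (Phi g i t) * (Phi g j t * x t)) (\<lambda>t. Phi g j t / Phi g i t * x t)"
    unfolding aeq_def using Phi_quotient[OF i j] by eventually_elim (simp flip: mult.assoc)
  have 3: "(\<lambda>t. Phi g j t / Phi g i t * x t) \<in> borel_measurable T2" by measurable
  have "cls (\<lambda>t. Phi g j t / Phi g i t * x t) = mul (\<lambda>t. cnj (Phi g i t)) (mul (Phi g j) (cls x))"
    unfolding cls_eqI[OF 1 3 2] using i j x by (simp add: mul_cls Linf_mult_L2 Linf_intros)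
  then show "hankel_entry B g i j x \<in> PS (B i)"
    "cls (hankel_entry B g i j x) = Pr (B i) (mul (\<lambda>t. cnj (Phi g i t)) (mul (Phi g j) (cls x)))"
    using proj_PS[OF L2_cong[OF 1 3 2], of "B i"] by (simp_all add: hankel_entry_def)
qed

lemma hilbert_sum_L2: "\<theta> \<in> hilbert_sum B p \<Longrightarrow> i < p \<Longrightarrow> \<theta> i \<in> L2"
  by (auto simp: hilbert_sum_def intro: PS_L2)

lemma hilbert_sum_hsum: "\<theta> \<in> hilbert_sum B p \<Longrightarrow> (\<lambda>i. cls (\<theta> i)) \<in> hsum"
  by (simp add: hilbert_sum_def hsum_def PS_iff)

lemma hankel_cls:
  assumes th: "\<theta> \<in> hilbert_sum B p" and i: "i < p"
  shows "hankel B p g \<theta> i \<in> L2" "cls (hankel B p g \<theta> i) = Vadj (V (\<lambda>i. cls (\<theta> i))) i"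
proof -
  have e: "hankel_entry B g i j (\<theta> j) \<in> L2" if "j < p" for j
    using hankel_entry_PS(1)[OF i that hilbert_sum_L2[OF th that]] by (rule PS_L2)
  then show "hankel B p g \<theta> i \<in> L2" unfolding hankel_def by (intro L2_sum) simp
  have "cls (hankel B p g \<theta> i) = (\<Sum>j<p. cls (hankel_entry B g i j (\<theta> j)))"
    unfolding hankel_def using e by (intro cls_sum) simp
  also have "\<dots> = (\<Sum>j<p. Pr (B i) (mul (\<lambda>t. cnj (Phi g i t)) (mul (Phi g j) (cls (\<theta> j)))))"
    by (intro sum.cong refl hankel_entry_PS(2) i hilbert_sum_L2[OF th]) simp_all
  also have "\<dots> = Vadj (V (\<lambda>i. cls (\<theta> i))) i"
    by (simp add: Vadj_def V_def linear_sum[OF linear_Pr] linear_sum[OF linear_mul] Linf_intros i)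
  finally show "cls (hankel B p g \<theta> i) = Vadj (V (\<lambda>i. cls (\<theta> i))) i" .
qed

lemma gamma_map_cls:
  assumes q: "q \<in> L2" and i: "i < p"
  shows "gamma_map B g q i \<in> L2" "cls (gamma_map B g q i) = Vadj (mul (\<lambda>t. cnj (1 / g 0 t)) (cls q)) i"
proof -
  have 1: "(\<lambda>t. cnj (Phi g i t) * (cnj (1 / g 0 t) * q t)) \<in> L2"
    using i q by (intro Linf_mult_L2 Linf_intros)
  have "gamma_map B g q i = proj (B i) (\<lambda>t. cnj (Phi g i t) * (cnj (1 / g 0 t) * q t))"
    by (simp add: gamma_map_def)
  moreover have "cls (\<lambda>t. cnj (Phi g i t) * (cnj (1 / g 0 t) * q t))
      = mul (\<lambda>t. cnj (Phi g i t)) (mul (\<lambda>t. cnj (1 / g 0 t)) (cls q))"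
    using i q by (simp only: mul_cls Linf_mult_L2 Linf_intros)
  ultimately show "gamma_map B g q i \<in> L2" "cls (gamma_map B g q i) = Vadj (mul (\<lambda>t. cnj (1 / g 0 t)) (cls q)) i"
    using proj_PS[OF 1, of "B i"] by (auto simp: Vadj_def intro: PS_L2)
qed

lemma hankel_eq_gamma_iff:
  assumes "\<theta> \<in> hilbert_sum B p" "q \<in> L2"
  shows "aeq_sum p (hankel B p g \<theta>) (gamma_map B g q) \<longleftrightarrow>
    (\<forall>i<p. Vadj (V (\<lambda>i. cls (\<theta> i))) i = Vadj (mul (\<lambda>t. cnj (1 / g 0 t)) (cls q)) i)"
  unfolding aeq_sum_def
  using hankel_cls[OF assms(1)] gamma_map_cls[OF assms(2)] cls_eq_iff by metis

lemma hankel_rangeE: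
  assumes "\<theta> \<in> hankel_range B p g"
  obtains \<eta> where "\<theta> \<in> hilbert_sum B p" "\<eta> \<in> hilbert_sum B p"
    "\<And>i. i < p \<Longrightarrow> cls (\<theta> i) = Vadj (V (\<lambda>i. cls (\<eta> i))) i"
proof -
  obtain \<eta> where \<eta>: "\<theta> \<in> hilbert_sum B p" "\<eta> \<in> hilbert_sum B p" "aeq_sum p \<theta> (hankel B p g \<eta>)"
    using assms unfolding hankel_range_def by blast
  then have "cls (\<theta> i) = Vadj (V (\<lambda>i. cls (\<eta> i))) i" if "i < p" for i
    using cls_eq_iff[OF hilbert_sum_L2[OF \<eta>(1) that] hankel_cls(1)[OF \<eta>(2) that]] that
    by (simp add: aeq_sum_def hankel_cls)
  with \<eta>(1,2) show thesis by (rule that)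
qed

lemma hankel_equation_ex:
  assumes q: "q \<in> L2"
  shows "\<exists>\<theta>\<in>hankel_range B p g. aeq_sum p (hankel B p g \<theta>) (gamma_map B g q)"
proof -
  obtain \<theta> \<eta> where h: "\<theta> \<in> hsum" "\<eta> \<in> hsum" "\<forall>i<p. \<theta> i = Vadj (V \<eta>) i"
    "\<forall>i<p. Vadj (V \<theta>) i = Vadj (mul (\<lambda>t. cnj (1 / g 0 t)) (cls q)) i"
    using hankel_solvable by blast
  define \<theta>' \<eta>' where "\<theta>' i = rep_l2 (\<theta> i)" and "\<eta>' i = rep_l2 (\<eta> i)" for i
  have th: "\<theta>' \<in> hilbert_sum B p" and et: "\<eta>' \<in> hilbert_sum B p"
    using h(1,2) by (simp_all add: hilbert_sum_def hsum_def PS_iff rep_L2 \<theta>'_def \<eta>'_def)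
  have c: "(\<lambda>i. cls (\<theta>' i)) = \<theta>" "(\<lambda>i. cls (\<eta>' i)) = \<eta>" by (simp_all add: \<theta>'_def \<eta>'_def)
  have "aeq (\<theta>' i) (hankel B p g \<eta>' i)" if i: "i < p" for i
    using cls_eq_iff[OF hilbert_sum_L2[OF th i] hankel_cls(1)[OF et i]] hankel_cls(2)[OF et i] h(3) i
    by (simp add: c) (simp add: \<theta>'_def)
  then have "\<theta>' \<in> hankel_range B p g"
    unfolding hankel_range_def aeq_sum_def using th et by blast
  moreover have "aeq_sum p (hankel B p g \<theta>') (gamma_map B g q)"
    unfolding hankel_eq_gamma_iff[OF th q] c by (rule h(4))
  ultimately show ?thesis by blast
qed

lemma hankel_equation_unique:
  assumes q: "q \<in> L2" and th: "\<theta> \<in> hankel_range B p g" "\<theta>' \<in> hankel_range B p g"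
    and eq: "aeq_sum p (hankel B p g \<theta>) (gamma_map B g q)" "aeq_sum p (hankel B p g \<theta>') (gamma_map B g q)"
  shows "aeq_sum p \<theta>' \<theta>"
  unfolding aeq_sum_def
proof (intro allI impI)
  fix i assume i: "i < p"
  obtain \<eta> where \<eta>: "\<theta> \<in> hilbert_sum B p" "\<eta> \<in> hilbert_sum B p"
    "\<And>i. i < p \<Longrightarrow> cls (\<theta> i) = Vadj (V (\<lambda>i. cls (\<eta> i))) i"
    using th(1) by (rule hankel_rangeE) (rule that)
  obtain \<eta>' where \<eta>': "\<theta>' \<in> hilbert_sum B p" "\<eta>' \<in> hilbert_sum B p"
    "\<And>i. i < p \<Longrightarrow> cls (\<theta>' i) = Vadj (V (\<lambda>i. cls (\<eta>' i))) i"
    using th(2) by (rule hankel_rangeE) (rule that)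
  have "Vadj (V (\<lambda>i. cls (\<theta>' i))) j = Vadj (V (\<lambda>i. cls (\<theta> i))) j" if "j < p" for j
    using eq that unfolding hankel_eq_gamma_iff[OF \<eta>(1) q] hankel_eq_gamma_iff[OF \<eta>'(1) q] by simp
  from hankel_injective[OF hilbert_sum_hsum[OF \<eta>'(1)] hilbert_sum_hsum[OF \<eta>'(2)]
      hilbert_sum_hsum[OF \<eta>(1)] hilbert_sum_hsum[OF \<eta>(2)] \<eta>'(3) \<eta>(3) this i]
  show "aeq (\<theta>' i) (\<theta> i)" using cls_eq_iff hilbert_sum_L2 \<eta>(1) \<eta>'(1) i by blast
qed

lemma inverse_toeplitz:
  assumes q: "q \<in> PS L" and th: "\<theta> \<in> hankel_range B p g"
    and eq: "aeq_sum p (hankel B p g \<theta>) (gamma_map B g q)"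
  shows "aeq (inverse_op (PS L) (toeplitz L f) q)
    (\<lambda>x. q x / complex_of_real (f x) - 1 / g 0 x * (\<Sum>i<p. Phi g i x * \<theta> i x))"
proof -
  have ths: "\<theta> \<in> hilbert_sum B p" using th by (simp add: hankel_range_def)
  note thL = hilbert_sum_L2[OF ths]
  have qL: "q \<in> L2" and qs: "cls q \<in> spec_space L" using q by (auto simp: PS_iff)
  define R where "R x = q x / complex_of_real (f x) - 1 / g 0 x * (\<Sum>i<p. Phi g i x * \<theta> i x)" for x
  \<comment> \<open>\<open>R'\<close> is the claimed function \<open>R\<close> with 1 / f factored
    by means of \<open>g 0\<close>, so that only bounded multiplications occur and its class can be
    computed.\<close>
  define R' where "R' x = 1 / g 0 x * (cnj (1 / g 0 x) * q x) - 1 / g 0 x * (\<Sum>i<p. Phi g i x * \<theta> i x)" for x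
  define h where "h = mul (\<lambda>t. 1 / g 0 t) (mul (\<lambda>t. cnj (1 / g 0 t)) (cls q) - V (\<lambda>i. cls (\<theta> i)))"
  have s: "(\<lambda>x. Phi g i x * \<theta> i x) \<in> L2" if "i < p" for i
    using that thL by (intro Linf_mult_L2 Linf_intros)
  then have sum: "(\<lambda>x. \<Sum>i<p. Phi g i x * \<theta> i x) \<in> L2" by (intro L2_sum) simp
  have clsV: "cls (\<lambda>x. \<Sum>i<p. Phi g i x * \<theta> i x) = V (\<lambda>i. cls (\<theta> i))"
    using s thL by (subst cls_sum) (auto simp: V_def mul_cls Linf_intros)
  have q1: "(\<lambda>x. cnj (1 / g 0 x) * q x) \<in> L2" by (intro Linf_mult_L2 Linf_intros qL)
  have q2: "(\<lambda>x. 1 / g 0 x * (cnj (1 / g 0 x) * q x)) \<in> L2" by (intro Linf_mult_L2 Linf_intros q1)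
  have s2: "(\<lambda>x. 1 / g 0 x * (\<Sum>i<p. Phi g i x * \<theta> i x)) \<in> L2" by (intro Linf_mult_L2 Linf_intros sum)
  have R'L: "R' \<in> L2" unfolding R'_def using q2 s2 by (rule L2_diff)
  have clsR': "cls R' = h"
    unfolding R'_def h_def cls_diff[OF q2 s2] linear_diff[OF linear_mul[OF inv_Linf[OF p_pos]]] clsV[symmetric]
    by (simp only: mul_cls q1 sum qL inv_Linf[OF p_pos] cnj_inv_Linf[OF p_pos])
  have ae: "aeq R' R" unfolding aeq_def
    using F_eq[OF p_pos] g_nz[OF p_pos] by eventually_elim (simp add: R_def R'_def)
  have Rm: "R \<in> borel_measurable T2"
  proof -
    note [measurable] = L2_measurable[OF qL] Linf_measurable[OF F_Linf] L2_measurable[OF s2]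
    show ?thesis unfolding R_def by measurable
  qed
  have RL: "R \<in> L2" by (rule L2_cong[OF R'L Rm ae])
  have clsR: "cls R = h" using cls_eqI[OF R'L Rm ae] clsR' by simp
  have H: "Vadj (V (\<lambda>i. cls (\<theta> i))) i = Vadj (mul (\<lambda>t. cnj (1 / g 0 t)) (cls q)) i" if "i < p" for i
    using eq that unfolding hankel_eq_gamma_iff[OF ths qL] by simp
  have hL: "h \<in> spec_space L" unfolding h_def by (rule inversion(1)[OF hilbert_sum_hsum[OF ths] qs H])
  have Th: "Pr L (mul F h) = cls q" unfolding h_def by (rule inversion(2)[OF hilbert_sum_hsum[OF ths] qs H])
  have RP: "R \<in> PS L" using RL clsR hL by (simp add: PS_iff)
  have "cls (toeplitz L f R) = cls q" using toeplitz_PS(2)[OF RL] by (simp add: clsR Th)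
  then have "aeq (toeplitz L f R) q"
    using cls_eq_iff[OF PS_L2[OF toeplitz_PS(1)[OF RL]] qL] by simp
  \<comment> \<open>\<open>R\<close> shows that the choice in \<open>inverse_op\<close> is not void;
    injectivity of the Toeplitz operator then identifies the chosen function with \<open>R\<close>
    up to \<open>aeq\<close>.\<close>
  with RP have "\<exists>h. h \<in> PS L \<and> aeq (toeplitz L f h) q" by blast
  from someI_ex[OF this] have inv: "inverse_op (PS L) (toeplitz L f) q \<in> PS L"
    "aeq (toeplitz L f (inverse_op (PS L) (toeplitz L f) q)) q"
    by (simp_all add: inverse_op_def)
  let ?h = "inverse_op (PS L) (toeplitz L f) q"
  have hL2: "?h \<in> L2" using inv(1) by (rule PS_L2)
  have "cls (toeplitz L f ?h) = cls q"
    using inv(2) cls_eq_iff[OF PS_L2[OF toeplitz_PS(1)[OF hL2]] qL] by simp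
  then have T: "Pr L (mul F (cls ?h)) = Pr L (mul F h)" using toeplitz_PS(2)[OF hL2] Th by simp
  have "cls ?h \<in> spec_space L" using inv(1) unfolding PS_iff by (rule conjunct2)
  from this hL T have "cls ?h = cls R" unfolding clsR by (rule toeplitz_inj)
  then have "aeq ?h R" by (rule cls_eq_iff[OF hL2 RL, THEN iffD1])
  then show ?thesis unfolding R_def .
qed

end

subsection \<open>Factorizations\<close>

lemma ex_consecutive:
  fixes c :: "nat \<Rightarrow> nat"
  shows "c 0 \<le> t \<Longrightarrow> t < c n \<Longrightarrow> \<exists>i<n. c i \<le> t \<and> t < c (Suc i)"
proof (induction n)
  case (Suc n)
  then show ?case by (cases "t < c n") (auto simp: less_Suc_eq not_less)
qed simp

lemma cyclic_blocks_cover: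
  assumes "cyclic_blocks m p I" "0 < m"
  shows "(\<Union>i<p. I i) = {..<m}" and "\<And>i. i < p \<Longrightarrow> I i \<noteq> {}"
proof -
  obtain s c where c: "c 0 = 0" "c p = m"
    and I: "\<And>i. i < p \<Longrightarrow> c i < c (Suc i) \<and> I i = (\<lambda>t. (s + t) mod m) ` {c i..<c (Suc i)}"
    using assms(1) unfolding cyclic_blocks_def by blast
  show "I i \<noteq> {}" if "i < p" for i using I[OF that] by auto
  have "k \<in> (\<Union>i<p. I i)" if k: "k < m" for k
  proof -
    \<comment> \<open>The residue of k - s modulo m, written so that no subtraction of natural
      numbers is truncated.\<close>
    define t where "t = (k + (m - s mod m)) mod m"
    have t: "t < m" using assms(2) by (simp add: t_def)
    have "(s + t) mod m = (s mod m + (k + (m - s mod m))) mod m"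
      unfolding t_def by (simp add: mod_simps)
    also have "s mod m + (k + (m - s mod m)) = k + m" using mod_less_divisor[OF assms(2), of s] by simp
    also have "(k + m) mod m = k" using k by simp
    finally have st: "(s + t) mod m = k" .
    obtain i where i: "i < p" "c i \<le> t" "t < c (Suc i)" using ex_consecutive[of c t p] c t by auto
    have "(s + t) mod m \<in> I i" unfolding I[OF i(1), THEN conjunct2] using i(2,3) by (intro imageI) simp
    then show ?thesis using i(1) st by blast
  qed
  moreover have "I i \<subseteq> {..<m}" if "i < p" for i using I[OF that] assms(2) by auto
  ultimately show "(\<Union>i<p. I i) = {..<m}" by blast
qed

lemma fourier_cnj: "fourier (\<lambda>t. cnj (a t)) k = cnj (fourier a (- k))"
proof -
  have "fourier (\<lambda>t. cnj (a t)) k = (LINT t|T2. cnj (a t * cnj (chr (- k) t)))"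
    unfolding fourier_def by (intro Bochner_Integration.integral_cong refl) (simp add: cnj_chr)
  then show ?thesis unfolding Bochner_Integration.integral_cnj fourier_def .
qed

text \<open>A frequency in the block lies in \<open>S_minus m A k\<close> for one side
  \<open>k\<close>, and the shifts in the spectrum of the conjugate keep it there. As that side can
  be any in the block, the spectral condition is required for each of them.\<close>

lemma mul_cnj_block_minus:
  assumes polygon: "convex_polygon m A" and J: "I i \<subseteq> {..<m}" and a: "a \<in> Linf"
    and Spec: "\<And>k. k \<in> I i \<Longrightarrow> Spec a \<subseteq> S_plus0 m A k"
    and x: "x \<in> spec_space (block_minus m A I i)"
  shows "mul (\<lambda>t. cnj (a t)) x \<in> spec_space (block_minus m A I i)"
proof (rule mul_spec_space[OF Linf_cnj[OF a] subset_refl x])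
  fix n l assume n: "n \<in> block_minus m A I i" and l: "l \<in> Spec (\<lambda>t. cnj (a t))"
  obtain k where k: "k \<in> I i" "n \<in> S_minus m A k" using n by (auto simp: block_minus_def)
  have "- l \<in> Spec a" using l by (simp add: Spec_def fourier_cnj)
  then have "- l \<in> S_plus0 m A k" using Spec[OF k(1)] by blast
  moreover have "k < m" using J k(1) by auto
  ultimately have "n + l \<in> S_minus m A k" by (intro S_minus_add[OF polygon _ k(2)])
  then show "n + l \<in> block_minus m A I i" using k(1) by (auto simp: block_minus_def)
qed

lemma factorizationE:
  assumes "factorization m A f p I g"
  obtains G where "2 \<le> p" "cyclic_blocks m p I"
    "\<And>k. k < m \<Longrightarrow> aeq (\<lambda>x. complex_of_real (f x)) (\<lambda>x. G k x * cnj (G k x))"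
    "\<And>k. k < m \<Longrightarrow> G k \<in> Linf" "\<And>k. k < m \<Longrightarrow> (\<lambda>x. 1 / G k x) \<in> Linf"
    "\<And>k. k < m \<Longrightarrow> Spec (G k) \<subseteq> S_plus0 m A k"
    "\<And>k. k < m \<Longrightarrow> Spec (\<lambda>x. 1 / G k x) \<subseteq> S_plus0 m A k"
    "\<And>i. i < p \<Longrightarrow> g i \<in> Linf" "\<And>i k. i < p \<Longrightarrow> k \<in> I i \<Longrightarrow> aeq (G k) (g i)"
  using assms unfolding factorization_def
proof (elim conjE exE, goal_cases)
  case (1 v C Cp \<alpha> G)
  note f = 1(2-)
  show ?case by (rule 1(1)[of G]) (simp_all add: f)
qed

text \<open>Bounds and spectra are known for the \<open>G k\<close> and reach \<open>g i\<close>
  through almost everywhere equality; nonemptiness of the blocks supplies a \<open>k\<close> for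
  each \<open>i\<close>.\<close>

lemma factorization_hankel_toeplitz:
  assumes f_pos: "\<forall>x\<in>torus. 0 < f x"
    and f_bounded: "(\<lambda>x. complex_of_real (f x)) \<in> Linf"
    and polygon: "convex_polygon m A"
    and fact: "factorization m A f p I g"
  shows "hankel_toeplitz p (block_minus m A I) (lattice_polygon m A) g f"
proof -
  obtain G where p: "2 \<le> p" and blocks: "cyclic_blocks m p I"
    and Geq: "\<And>k. k < m \<Longrightarrow> aeq (\<lambda>x. complex_of_real (f x)) (\<lambda>x. G k x * cnj (G k x))"
    and GL: "\<And>k. k < m \<Longrightarrow> G k \<in> Linf" and GiL: "\<And>k. k < m \<Longrightarrow> (\<lambda>x. 1 / G k x) \<in> Linf"
    and GS: "\<And>k. k < m \<Longrightarrow> Spec (G k) \<subseteq> S_plus0 m A k"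
    and GiS: "\<And>k. k < m \<Longrightarrow> Spec (\<lambda>x. 1 / G k x) \<subseteq> S_plus0 m A k"
    and gL: "\<And>i. i < p \<Longrightarrow> g i \<in> Linf" and ae: "\<And>i k. i < p \<Longrightarrow> k \<in> I i \<Longrightarrow> aeq (G k) (g i)"
    using fact by (rule factorizationE) (rule that)
  have m: "0 < m" using polygon by (simp add: convex_polygon_def)
  note cover = cyclic_blocks_cover[OF blocks m]
  have sub: "I i \<subseteq> {..<m}" if "i < p" for i using cover(1) that by blast
  have ae': "aeq (\<lambda>x. 1 / G k x) (\<lambda>x. 1 / g i x)" if "i < p" "k \<in> I i" for i k
    using ae[OF that] unfolding aeq_def by eventually_elim simp
  have gm: "(\<lambda>x. 1 / g i x) \<in> borel_measurable T2" if "i < p" for i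
  proof -
    note [measurable] = Linf_measurable[OF gL[OF that]]
    show ?thesis by measurable
  qed
  have iL: "(\<lambda>x. 1 / g i x) \<in> Linf" if i: "i < p" for i
  proof -
    obtain k where k: "k \<in> I i" using cover(2)[OF i] by blast
    then have "k < m" using sub[OF i] by blast
    then show ?thesis by (rule Linf_cong[OF GiL gm[OF i] ae'[OF i k]])
  qed
  have Sg: "Spec (g i) \<subseteq> S_plus0 m A k" if "i < p" "k \<in> I i" for i k
  proof -
    have k: "k < m" using sub that by blast
    then show ?thesis
      using fourier_cong[OF Linf_measurable[OF GL[OF k]] Linf_measurable[OF gL[OF that(1)]] ae[OF that]] GS[OF k]
      by (simp add: Spec_def)
  qed
  have Si: "Spec (\<lambda>x. 1 / g i x) \<subseteq> S_plus0 m A k" if "i < p" "k \<in> I i" for i k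
  proof -
    have k: "k < m" using sub that by blast
    then show ?thesis
      using fourier_cong[OF Linf_measurable[OF GiL[OF k]] gm[OF that(1)] ae'[OF that]] GiS[OF k]
      by (simp add: Spec_def)
  qed
  show ?thesis
  proof unfold_locales
    show "0 < p" using p by simp
    have "(\<Union>i<p. block_minus m A I i) = (\<Union>k\<in>(\<Union>i<p. I i). S_minus m A k)"
      by (auto simp: block_minus_def)
    then show "lattice_polygon m A = - (\<Union>i<p. block_minus m A I i)"
      unfolding cover(1) lattice_polygon_eq_Compl[OF polygon] by simp
    show "(\<lambda>x. complex_of_real (f x)) \<in> Linf" by (rule f_bounded)
    show "AE t in T2. complex_of_real (f t) \<noteq> 0" using f_pos by (intro AE_I2) fastforce
    fix i assume i: "i < p"
    show "g i \<in> Linf" "(\<lambda>t. 1 / g i t) \<in> Linf" using gL[OF i] iL[OF i] .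
    obtain k where k: "k \<in> I i" using cover(2)[OF i] by blast
    have "k < m" using sub[OF i] k by blast
    then have "aeq (\<lambda>x. complex_of_real (f x)) (\<lambda>x. G k x * cnj (G k x))" by (rule Geq)
    then show "AE t in T2. complex_of_real (f t) = g i t * cnj (g i t)"
      using ae[OF i k] unfolding aeq_def by eventually_elim simp
    fix x assume x: "x \<in> spec_space (block_minus m A I i)"
    show "mul (\<lambda>t. cnj (g i t)) x \<in> spec_space (block_minus m A I i)"
      by (rule mul_cnj_block_minus[OF polygon sub[OF i] gL[OF i] Sg[OF i] x])
    show "mul (\<lambda>t. cnj (1 / g i t)) x \<in> spec_space (block_minus m A I i)"
      by (rule mul_cnj_block_minus[OF polygon sub[OF i] iL[OF i] Si[OF i] x])
  qed
qed

theorem mainTheorem5: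
  fixes f :: "complex \<times> complex \<Rightarrow> real"
    and m p :: nat
    and A :: "nat \<Rightarrow> nat \<times> nat"
    and I :: "nat \<Rightarrow> nat set"
    and g :: "nat \<Rightarrow> tfun"
  assumes f_pos: "\<forall>x\<in>torus. 0 < f x"
    and f_bounded: "(\<lambda>x. complex_of_real (f x)) \<in> Linf"
    and f_lsc: "lower_semicontinuous_on torus f"
    and polygon: "convex_polygon m A"
    and fact: "factorization m A f p I g"
  shows "(\<forall>q\<in>PS (lattice_polygon m A).
           \<exists>\<theta>\<in>hankel_range (block_minus m A I) p g.
             aeq_sum p (hankel (block_minus m A I) p g \<theta>) (gamma_map (block_minus m A I) g q) \<and>
             (\<forall>\<theta>'\<in>hankel_range (block_minus m A I) p g.
                aeq_sum p (hankel (block_minus m A I) p g \<theta>') (gamma_map (block_minus m A I) g q)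
                \<longrightarrow> aeq_sum p \<theta>' \<theta>)) \<and>
         invertible_op (PS (lattice_polygon m A)) (toeplitz (lattice_polygon m A) f) \<and>
         (\<forall>q\<in>PS (lattice_polygon m A).
           \<forall>\<theta>\<in>hankel_range (block_minus m A I) p g.
             aeq_sum p (hankel (block_minus m A I) p g \<theta>) (gamma_map (block_minus m A I) g q) \<longrightarrow>
             aeq (inverse_op (PS (lattice_polygon m A)) (toeplitz (lattice_polygon m A) f) q)
                 (\<lambda>x. q x / complex_of_real (f x) - 1 / g 0 x * (\<Sum>i<p. Phi g i x * \<theta> i x)))"
proof -
  interpret hankel_toeplitz p "block_minus m A I" "lattice_polygon m A" g f
    by (rule factorization_hankel_toeplitz[OF f_pos f_bounded polygon fact])
  show ?thesis
  proof (intro conjI ballI impI)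
    fix q assume "q \<in> PS (lattice_polygon m A)"
    then have q: "q \<in> L2" by (rule PS_L2)
    obtain \<theta> where \<theta>: "\<theta> \<in> hankel_range (block_minus m A I) p g"
      "aeq_sum p (hankel (block_minus m A I) p g \<theta>) (gamma_map (block_minus m A I) g q)"
      using hankel_equation_ex[OF q] by blast
    show "\<exists>\<theta>\<in>hankel_range (block_minus m A I) p g.
             aeq_sum p (hankel (block_minus m A I) p g \<theta>) (gamma_map (block_minus m A I) g q) \<and>
             (\<forall>\<theta>'\<in>hankel_range (block_minus m A I) p g.
                aeq_sum p (hankel (block_minus m A I) p g \<theta>') (gamma_map (block_minus m A I) g q)
                \<longrightarrow> aeq_sum p \<theta>' \<theta>)"
      by (intro bexI[OF _ \<theta>(1)] conjI ballI impI \<theta>(2) hankel_equation_unique[OF q \<theta>(1) _ \<theta>(2)])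
  qed (rule invertible_toeplitz, rule inverse_toeplitz)
qed

end
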